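(* Let $u\in\mathbb R^n$. (i) Suppose that the restricted inf-compactness holds at $\bar x$ in direction $u$ with compact set $\Omega_u$. Suppose that the feasible map $\mathcal F$ is RCR-regular at each $(\bar x,y)\in\mathrm{gph}\,S$ and satisfies RS at each $(\bar x,y)\in\mathrm{gph}\,S$ in direction $u$. Then $V$ is directionally Lipschitz continuous at $\bar x$ in direction $u$ and $\emptyset\ne\partial V(\bar x;u)\subseteq\Theta(\bar x;u)$, where $$\Theta(\bar x;u):=\bigcup_{\tilde y\in S(\bar x;u)\cap\Omega_u}\ \bigcup_{v\in\Sigma(\bar x,\tilde y,u)}\Big\{\nabla_xf(\bar x,\tilde y)+\nabla_xg(\bar x,\tilde y)^T\lambda_g\ :\ \lambda_g\in\Lambda(\bar x,\tilde y)\cap\{\nabla g(\bar x,\tilde y)(u,v)\}^\perp\Big\}.$$ (ii) Suppose that there exists $\bar y\in S(\bar x)$ such that $S(x)$ is inner semi-continuous at $(\bar x,\bar y)$ in direction $u$ and $\mathcal F$ is RCR-regular at $(\bar x,\bar y)$. Then $V$ is directionally Lipschitz continuous at $\bar x$ in direction $u$ and $$\emptyset\ne\partial V(\bar x;u)\subseteq\bigcup_{v\in\Sigma(\bar x,\bar y,u)}\Big\{\nabla_xf(\bar x,\bar y)+\nabla_xg(\bar x,\bar y)^T\lambda_g\ :\ \lambda_g\in\Lambda(\bar x,\bar y)\cap\{\nabla g(\bar x,\bar y)(u,v)\}^\perp\Big\}.$$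
   Context: Let $f:\mathbb R^n\times\mathbb R^m\to\mathbb R$ and $g:\mathbb R^n\times\mathbb R^m\to\mathbb R^p$ be continuously differentiable. Consider $(P_x)$: $\min_y f(x,y)$ s.t. $g(x,y)\le0$. Feasible map $\mathcal F(x)=\{y:g(x,y)\le0\}$; value function $V(x)=\inf\{f(x,y):y\in\mathcal F(x)\}$; $S(x)$ = set of optimal solutions of $(P_x)$; $\mathrm{gph}$ denotes the graph. $I_g(x,y)=\{i:g_i(x,y)=0\}$; $\Lambda(x,y)=\{\lambda\in\mathbb R^p:\nabla_yf(x,y)+\nabla_yg(x,y)^T\lambda=0,\ g(x,y)^T\lambda=0,\ \lambda\ge0\}$; $\mathbb L(x,y;u)=\{v\in\mathbb R^m:\nabla g_i(x,y)(u,v)\le0\ \forall i\in I_g(x,y)\}$; $\{w\}^\perp$ is the orthogonal complement of $w$. $\mathbb B$ is the open unit ball, $\mathbb B_\epsilon(\bar y)$ the open ball of radius $\epsilon$ about $\bar y$. For a direction $d$ and $\epsilon,\delta>0$: $\mathcal V_{\epsilon,\delta}(d):=\{z\in\epsilon\mathbb B : \big\|\,\|d\|z-\|z\|d\,\big\|\le\delta\|z\|\|d\|\}$. $V'(x;u)=\lim_{t\downarrow0}(V(x+tu)-V(x))/t$ is the directional derivative (which exists at $\bar x$ in direction $u$ under the hypotheses of (i) and of (ii)), and $\Sigma(x,y,u):=\{v\in\mathbb L(x,y;u):V'(x;u)=\nabla f(x,y)(u,v)\}$. $V$ is directionally Lipschitz continuous at $\bar x$ in direction $u$ if there are $L,\epsilon,\delta>0$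 such that $V$ is finite on $\bar x+\mathcal V_{\epsilon,\delta}(u)$ and $|V(x)-V(x')|\le L\|x-x'\|$ for all $x,x'\in\bar x+\mathcal V_{\epsilon,\delta}(u)$. Regular subdifferential: $\widehat\partial V(\bar x)=\{\xi:V(x)\ge V(\bar x)+\langle\xi,x-\bar x\rangle+o(\|x-\bar x\|)\}$. Directional limiting subdifferential: $\partial V(\bar x;u)=\{\xi:\exists t_k\downarrow0,u^k\to u,\xi^k\to\xi\text{ with }V(\bar x+t_ku^k)\to V(\bar x),\ \xi^k\in\widehat\partial V(\bar x+t_ku^k)\}$. Directional solution set: $S(\bar x;u)=\{y\in S(\bar x):\exists t_k\downarrow0,u^k\to u,y^k\to y,\ y^k\in S(\bar x+t_ku^k)\}$. RCR regularity of $\mathcal F$ at $(\bar x,\bar y)\in\mathrm{gph}\,\mathcal F$: there is $\delta>0$ such that for any $K\subseteq I_g(\bar x,\bar y)$ the family $\{\nabla_yg_j(x,y)\}_{j\in K}$ has the same rank at all $(x,y)\in\mathbb B_\delta(\bar x,\bar y)$. Robinson stability (RS) of $\mathcal F$ at $(\bar x,\bar y)\in\mathrm{gph}\,\mathcal F$ in direction $u$: there are $\kappa,\epsilon,\delta>0$ with $\mathrm{dist}(y,\mathcal F(x))\le\kappa\|g_+(x,y)\|$ for all $x\in\bar x+\mathcal V_{\epsilon,\delta}(u)$, $y\in\mathbb B_\epsilon(\bar y)$, where $g_+=\max\{0,g\}$ componentwise. Restricted inf-compactness at $\bar x$ in direction $u$ with compact set $\Omega_u\subseteq\mathbb R^m$: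 $V(\bar x)$ is finite and there are $\epsilon,\delta>0$ such that for all $x\in\bar x+\mathcal V_{\epsilon,\delta}(u)$ with $V(x)<V(\bar x)+\epsilon$ one has $S(x)\cap\Omega_u\ne\emptyset$. Directional inner semi-continuity: for $\bar y\in S(\bar x)$, $S$ is inner semi-continuous at $(\bar x,\bar y)$ in direction $u$ if for any sequences $t_k\downarrow0$, $u^k\to u$, there exists a sequence $y^k\in S(\bar x+t_ku^k)$ converging to $\bar y$. *)

theory Defs
  imports "HOL-Analysis.Analysis" "HOL-Library.Landau_Symbols"
begin

section \<open>Derivatives\<close>

definition continuously_differentiable ::
    "('a::real_normed_vector \<Rightarrow> 'b::real_normed_vector) \<Rightarrow> bool" where
  "continuously_differentiable h \<longleftrightarrow>
     (\<exists>h'. (\<forall>z. (h has_derivative blinfun_apply (h' z)) (at z)) \<and> continuous_on UNIV h')"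

definition gradient :: "('a::real_inner \<Rightarrow> real) \<Rightarrow> 'a \<Rightarrow> 'a" where
  "gradient h z = (THE D. GDERIV h z :> D)"

definition grad_x :: "('a::real_inner \<times> 'b::real_inner \<Rightarrow> real) \<Rightarrow> 'a \<Rightarrow> 'b \<Rightarrow> 'a" where
  "grad_x f x y = gradient (\<lambda>x'. f (x', y)) x"

definition grad_y :: "('a::real_inner \<times> 'b::real_inner \<Rightarrow> real) \<Rightarrow> 'a \<Rightarrow> 'b \<Rightarrow> 'b" where
  "grad_y f x y = gradient (\<lambda>y'. f (x, y')) y"

definition jac_x :: "((real^'n) \<times> (real^'m) \<Rightarrow> real^'p) \<Rightarrow> real^'n \<Rightarrow> real^'m \<Rightarrow> real^'n^'p" where
  "jac_x g x y = jacobian (\<lambda>x'. g (x', y)) (at x)"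

definition jac_y :: "((real^'n) \<times> (real^'m) \<Rightarrow> real^'p) \<Rightarrow> real^'n \<Rightarrow> real^'m \<Rightarrow> real^'m^'p" where
  "jac_y g x y = jacobian (\<lambda>y'. g (x, y')) (at y)"


section \<open>The parametric program\<close>

text \<open>The order on \<open>real^'p\<close> is componentwise.\<close>

definition feasible :: "('a \<times> 'b \<Rightarrow> real^'p) \<Rightarrow> 'a \<Rightarrow> 'b set" where
  "feasible g x = {y. g (x, y) \<le> 0}"

text \<open>The value function is extended-real-valued, so that it is \<open>\<infinity>\<close> where the program is
  infeasible and \<open>- \<infinity>\<close> where it is unbounded below.\<close>

definition value_fun :: "('a \<times> 'b \<Rightarrow> real) \<Rightarrow> ('a \<times> 'b \<Rightarrow> real^'p) \<Rightarrow> 'a \<Rightarrow> ereal" where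
  "value_fun f g x = (INF y\<in>feasible g x. ereal (f (x, y)))"

definition solutions :: "('a \<times> 'b \<Rightarrow> real) \<Rightarrow> ('a \<times> 'b \<Rightarrow> real^'p) \<Rightarrow> 'a \<Rightarrow> 'b set" where
  "solutions f g x = {y \<in> feasible g x. \<forall>y'\<in>feasible g x. f (x, y) \<le> f (x, y')}"

definition active :: "('a \<times> 'b \<Rightarrow> real^'p) \<Rightarrow> 'a \<Rightarrow> 'b \<Rightarrow> 'p set" where
  "active g x y = {i. g (x, y) $ i = 0}"

definition multipliers ::
    "((real^'n) \<times> (real^'m) \<Rightarrow> real) \<Rightarrow> ((real^'n) \<times> (real^'m) \<Rightarrow> real^'p) \<Rightarrow>
     real^'n \<Rightarrow> real^'m \<Rightarrow> (real^'p) set" where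
  "multipliers f g x y =
     {l. grad_y f x y + transpose (jac_y g x y) *v l = 0 \<and> g (x, y) \<bullet> l = 0 \<and> 0 \<le> l}"

definition linearization_cone ::
    "((real^'n) \<times> (real^'m) \<Rightarrow> real^'p) \<Rightarrow> real^'n \<Rightarrow> real^'m \<Rightarrow> real^'n \<Rightarrow> (real^'m) set" where
  "linearization_cone g x y u =
     {v. \<forall>i\<in>active g x y. frechet_derivative (\<lambda>z. g z $ i) (at (x, y)) (u, v) \<le> 0}"


section \<open>Directional notions\<close>

definition dir_nbhd :: "real \<Rightarrow> real \<Rightarrow> 'a::real_normed_vector \<Rightarrow> 'a set" where
  "dir_nbhd \<epsilon> \<delta> d =
     {z \<in> ball 0 \<epsilon>. norm (norm d *\<^sub>R z - norm z *\<^sub>R d) \<le> \<delta> * norm z * norm d}"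

definition has_dir_deriv :: "('a::real_vector \<Rightarrow> ereal) \<Rightarrow> 'a \<Rightarrow> 'a \<Rightarrow> ereal \<Rightarrow> bool" where
  "has_dir_deriv V x u l \<longleftrightarrow>
     ((\<lambda>t. (V (x + t *\<^sub>R u) - V x) / ereal t) \<longlongrightarrow> l) (at_right 0)"

text \<open>The equation \<open>V'(x;u) = \<nabla>f(x,y)(u,v)\<close> is read as: the directional derivative exists and
  has this value.  Hence existence of \<open>V'(x;u)\<close> follows whenever the set is nonempty.\<close>

definition critical_directions ::
    "((real^'n) \<times> (real^'m) \<Rightarrow> real) \<Rightarrow> ((real^'n) \<times> (real^'m) \<Rightarrow> real^'p) \<Rightarrow>
     real^'n \<Rightarrow> real^'m \<Rightarrow> real^'n \<Rightarrow> (real^'m) set" where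
  "critical_directions f g x y u =
     {v \<in> linearization_cone g x y u.
        has_dir_deriv (value_fun f g) x u (ereal (frechet_derivative f (at (x, y)) (u, v)))}"

definition dir_lipschitz :: "('a::real_normed_vector \<Rightarrow> ereal) \<Rightarrow> 'a \<Rightarrow> 'a \<Rightarrow> bool" where
  "dir_lipschitz V xbar u \<longleftrightarrow>
     (\<exists>L>0. \<exists>\<epsilon>>0. \<exists>\<delta>>0.
        (\<forall>x \<in> (+) xbar ` dir_nbhd \<epsilon> \<delta> u. \<bar>V x\<bar> \<noteq> \<infinity>) \<and>
        (\<forall>x \<in> (+) xbar ` dir_nbhd \<epsilon> \<delta> u. \<forall>x' \<in> (+) xbar ` dir_nbhd \<epsilon> \<delta> u.
           \<bar>V x - V x'\<bar> \<le> ereal (L * norm (x - x'))))"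

text \<open>As usual, the regular subdifferential is empty at points where \<open>V\<close> is not finite.\<close>

definition regular_subdiff :: "('a::real_inner \<Rightarrow> ereal) \<Rightarrow> 'a \<Rightarrow> 'a set" where
  "regular_subdiff V xbar =
     {\<xi>. \<bar>V xbar\<bar> \<noteq> \<infinity> \<and>
        (\<exists>r :: 'a \<Rightarrow> real. r \<in> o[at xbar](\<lambda>x. norm (x - xbar)) \<and>
           (\<forall>\<^sub>F x in at xbar. V x \<ge> V xbar + ereal (\<xi> \<bullet> (x - xbar) + r x)))}"

text \<open>Throughout, \<open>t\<^sub>k \<down> 0\<close> means \<open>t\<^sub>k > 0\<close> and \<open>t\<^sub>k \<longlonglongrightarrow> 0\<close>.\<close>

definition dir_limiting_subdiff :: "('a::real_inner \<Rightarrow> ereal) \<Rightarrow> 'a \<Rightarrow> 'a \<Rightarrow> 'a set" where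
  "dir_limiting_subdiff V xbar u =
     {\<xi>. \<exists>(t :: nat \<Rightarrow> real) (us :: nat \<Rightarrow> 'a) (\<xi>s :: nat \<Rightarrow> 'a).
        (\<forall>k. t k > 0) \<and> t \<longlonglongrightarrow> 0 \<and> us \<longlonglongrightarrow> u \<and> \<xi>s \<longlonglongrightarrow> \<xi> \<and>
        (\<lambda>k. V (xbar + t k *\<^sub>R us k)) \<longlonglongrightarrow> V xbar \<and>
        (\<forall>k. \<xi>s k \<in> regular_subdiff V (xbar + t k *\<^sub>R us k))}"

definition dir_solutions ::
    "('a::real_normed_vector \<times> 'b::topological_space \<Rightarrow> real) \<Rightarrow> ('a \<times> 'b \<Rightarrow> real^'p) \<Rightarrow>
     'a \<Rightarrow> 'a \<Rightarrow> 'b set" where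
  "dir_solutions f g xbar u =
     {y \<in> solutions f g xbar.
        \<exists>(t :: nat \<Rightarrow> real) (us :: nat \<Rightarrow> 'a) (ys :: nat \<Rightarrow> 'b).
          (\<forall>k. t k > 0) \<and> t \<longlonglongrightarrow> 0 \<and> us \<longlonglongrightarrow> u \<and> ys \<longlonglongrightarrow> y \<and>
          (\<forall>k. ys k \<in> solutions f g (xbar + t k *\<^sub>R us k))}"


section \<open>Regularity conditions\<close>

text \<open>The family of gradients is the family of rows of the partial Jacobian; its rank is the
  dimension of its span.\<close>

definition rcr_regular ::
    "((real^'n) \<times> (real^'m) \<Rightarrow> real^'p) \<Rightarrow> real^'n \<Rightarrow> real^'m \<Rightarrow> bool" where
  "rcr_regular g xbar ybar \<longleftrightarrow>
     (\<exists>\<delta>>0. \<forall>K \<subseteq> active g xbar ybar. \<exists>r. \<forall>(x, y) \<in> ball (xbar, ybar) \<delta>.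
        dim ((\<lambda>j. row j (jac_y g x y)) ` K) = r)"

text \<open>Distance to a set, with the convention that the distance to the empty set is \<open>\<infinity>\<close>
  (unlike \<^const>\<open>infdist\<close>, which is then \<open>0\<close>).\<close>

definition edist_to :: "'a::metric_space \<Rightarrow> 'a set \<Rightarrow> ereal" where
  "edist_to y C = (INF c\<in>C. ereal (dist y c))"

definition pos_part :: "real^'p \<Rightarrow> real^'p" where
  "pos_part w = (\<chi> i. max 0 (w $ i))"

definition robinson_stable ::
    "('a::real_normed_vector \<times> 'b::metric_space \<Rightarrow> real^'p) \<Rightarrow> 'a \<Rightarrow> 'b \<Rightarrow> 'a \<Rightarrow> bool" where
  "robinson_stable g xbar ybar u \<longleftrightarrow>
     (\<exists>\<kappa>>0. \<exists>\<epsilon>>0. \<exists>\<delta>>0.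
        \<forall>x \<in> (+) xbar ` dir_nbhd \<epsilon> \<delta> u. \<forall>y \<in> ball ybar \<epsilon>.
          edist_to y (feasible g x) \<le> ereal (\<kappa> * norm (pos_part (g (x, y)))))"

definition restricted_inf_compact ::
    "('a::real_normed_vector \<times> 'b::topological_space \<Rightarrow> real) \<Rightarrow> ('a \<times> 'b \<Rightarrow> real^'p) \<Rightarrow>
     'a \<Rightarrow> 'a \<Rightarrow> 'b set \<Rightarrow> bool" where
  "restricted_inf_compact f g xbar u \<Omega> \<longleftrightarrow>
     compact \<Omega> \<and> \<bar>value_fun f g xbar\<bar> \<noteq> \<infinity> \<and>
     (\<exists>\<epsilon>>0. \<exists>\<delta>>0. \<forall>x \<in> (+) xbar ` dir_nbhd \<epsilon> \<delta> u.
        value_fun f g x < value_fun f g xbar + ereal \<epsilon> \<longrightarrow> solutions f g x \<inter> \<Omega> \<noteq> {})"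

text \<open>The approximating sequence is required to lie in the solution sets for all large \<open>k\<close>.
  Demanding this for every \<open>k\<close> would force solvability at points far away from \<open>xbar\<close>, since the
  first members of the given sequences are arbitrary.\<close>

definition dir_inner_semicontinuous ::
    "('a::real_normed_vector \<Rightarrow> 'b::topological_space set) \<Rightarrow> 'a \<Rightarrow> 'b \<Rightarrow> 'a \<Rightarrow> bool" where
  "dir_inner_semicontinuous S xbar ybar u \<longleftrightarrow>
     (\<forall>(t :: nat \<Rightarrow> real) (us :: nat \<Rightarrow> 'a). (\<forall>k. t k > 0) \<and> t \<longlonglongrightarrow> 0 \<and> us \<longlonglongrightarrow> u \<longrightarrow>
        (\<exists>ys. (\<forall>\<^sub>F k in sequentially. ys k \<in> S (xbar + t k *\<^sub>R us k)) \<and> ys \<longlonglongrightarrow> ybar))"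


section \<open>The upper estimates\<close>

definition estimate_at ::
    "((real^'n) \<times> (real^'m) \<Rightarrow> real) \<Rightarrow> ((real^'n) \<times> (real^'m) \<Rightarrow> real^'p) \<Rightarrow>
     real^'n \<Rightarrow> real^'m \<Rightarrow> real^'n \<Rightarrow> (real^'n) set" where
  "estimate_at f g x y u =
     (\<Union>v\<in>critical_directions f g x y u.
        {grad_x f x y + transpose (jac_x g x y) *v l | l.
           l \<in> multipliers f g x y \<inter> {frechet_derivative g (at (x, y)) (u, v)}\<^sup>\<bottom>})"

definition Theta ::
    "((real^'n) \<times> (real^'m) \<Rightarrow> real) \<Rightarrow> ((real^'n) \<times> (real^'m) \<Rightarrow> real^'p) \<Rightarrow>
     real^'n \<Rightarrow> real^'n \<Rightarrow> (real^'m) set \<Rightarrow> (real^'n) set" where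
  "Theta f g x u \<Omega> = (\<Union>y\<in>dir_solutions f g x u \<inter> \<Omega>. estimate_at f g x y u)"

end

theory Submission
  imports Defs
begin

text \<open>
  Constant rank yields an error bound for the system \<open>g \<le> 0\<close>, \<open>g\<^sub>i = 0\<close> (\<open>i \<in> J\<close>) at every parameter
  near \<open>x0\<close> for which the system is solvable near \<open>y0\<close>: along approximate KKT points of the
  projection problem, multipliers on a linearly independent subfamily of gradients stay bounded.
  Robinson stability transports solutions between nearby parameters, hence \<open>V\<close> is directionally
  Lipschitz, and it bounds multipliers \<open>l\<^sub>k\<close> with
  \<open>\<nabla>f d + \<Sum>\<^sub>i l\<^sub>k\<^sub>i \<nabla>g\<^sub>i d = \<langle>\<xi>\<^sub>k, fst d\<rangle>\<close> at solutions \<open>y\<^sub>k\<close> for regular subgradients \<open>\<xi>\<^sub>k\<close>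
  at \<open>x\<^sub>k = x0 + t\<^sub>k u\<^sub>k\<close>.

  The difficulty is that \<open>y\<^sub>k\<close> may converge more slowly than \<open>t\<^sub>k\<close>, so its difference quotients need
  not give a direction \<open>v\<close>.  Let \<open>J\<close> be the support of the limit multiplier.  The error bound for the
  system with equalities on \<open>J\<close> moves the limit solution into the problem at \<open>x\<^sub>k\<close>, and \<open>y\<^sub>k\<close> into
  the problem at \<open>x0\<close>, by \<open>O(t\<^sub>k)\<close> each.  The first move gives \<open>v\<close>; the two together squeeze
  \<open>(V(x\<^sub>k) - V(x0)) / t\<^sub>k\<close> towards \<open>\<langle>\<xi>, u\<rangle> = \<nabla>f(u, v)\<close>.  By Robinson stability \<open>\<nabla>f(u, v)\<close> also bounds
  the upper slope of \<open>V\<close> in direction \<open>u\<close>, so all these limits agree and \<open>V'(x0; u)\<close> exists.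
\<close>

section \<open>Continuously differentiable maps and linearly independent families\<close>

text \<open>Constant rank does not make a perturbed system solvable; its error bound presupposes a
  solution near \<open>y0\<close>. For the system with equalities on \<open>J\<close> such solutions
  are at hand: at \<open>x0\<close> the limit solution, at \<open>x\<^sub>k\<close> the point
  \<open>y\<^sub>k\<close>, because multipliers positive in the limit are positive for large k and
  complementarity then makes the constraints of \<open>J\<close> active at \<open>y\<^sub>k\<close>.
  Other active constraints of the limit may be inactive at \<open>y\<^sub>k\<close>, so equality
  cannot be imposed on them.

  The two moves may produce different directions. The squeeze closes nevertheless: for every
  \<open>b\<close> with \<open>\<nabla>g\<^sub>i (u, b) = 0\<close> on \<open>J\<close> the limit of
  the multiplier equation reads \<open>\<nabla>f (u, b) = \<xi> \<bullet> u\<close>.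

  The multiplier bound is an exact penalty parameter, a Lipschitz constant of \<open>f\<close> times
  the stability constant. Subgradients, needed for nonemptiness and again for the lower slope of
  \<open>V\<close>, come from minimising \<open>V\<close> plus a quadratic on small balls inside the
  directional neighbourhood.\<close>

lemma C1_strict_derivative:
  fixes h :: "'a::real_normed_vector \<Rightarrow> 'b::real_normed_vector"
  assumes D: "\<And>z. (h has_derivative blinfun_apply (h' z)) (at z)"
    and c: "continuous_on UNIV h'" and e: "e > 0"
  obtains \<rho> where "\<rho> > 0"
    "\<And>p q. p \<in> ball z \<rho> \<Longrightarrow> q \<in> ball z \<rho> \<Longrightarrow>
       norm (h p - h q - h' z (p - q)) \<le> e * norm (p - q)"
proof -
  have "isCont h' z"
    using c by (simp add: continuous_on_eq_continuous_at)
  then obtain \<rho> where \<rho>: "\<rho> > 0" "\<And>x. dist x z < \<rho> \<Longrightarrow> dist (h' x) (h' z) < e"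
    using e continuous_at_eps_delta[of z h'] by metis
  show thesis
  proof (rule that[OF \<rho>(1)])
    fix p q assume pq: "p \<in> ball z \<rho>" "q \<in> ball z \<rho>"
    \<comment> \<open>Mean value inequality on the convex ball for \<open>h - h' z\<close>, whose
      derivative \<open>h' x - h' z\<close> has norm at most \<open>e\<close> there.\<close>
    have "norm ((h p - h' z p) - (h q - h' z q)) \<le> e * norm (p - q)"
    proof (rule differentiable_bound[where S = "ball z \<rho>" and f' = "\<lambda>x. blinfun_apply (h' x - h' z)"])
      fix x assume "x \<in> ball z \<rho>"
      then have "dist (h' x) (h' z) < e"
        using \<rho>(2) by (simp add: dist_commute)
      then show "onorm (blinfun_apply (h' x - h' z)) \<le> e"
        by (simp add: dist_norm norm_blinfun.rep_eq)
      show "((\<lambda>p. h p - blinfun_apply (h' z) p) has_derivative blinfun_apply (h' x - h' z))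
              (at x within ball z \<rho>)"
        by (rule has_derivative_eq_rhs[OF has_derivative_diff
              [OF has_derivative_at_withinI[OF D]
                bounded_linear.has_derivative[OF blinfun.bounded_linear_right has_derivative_ident]]])
           (simp add: blinfun.diff_left fun_eq_iff)
    qed (use pq in auto)
    then show "norm (h p - h q - h' z (p - q)) \<le> e * norm (p - q)"
      by (simp add: blinfun.diff_right algebra_simps)
  qed
qed

lemma C1_local_Lipschitz:
  fixes h :: "'a::real_normed_vector \<Rightarrow> 'b::real_normed_vector"
  assumes D: "\<And>z. (h has_derivative blinfun_apply (h' z)) (at z)"
    and c: "continuous_on UNIV h'"
  obtains \<rho> L where "\<rho> > 0" "L > 0"
    "\<And>p q. p \<in> ball z \<rho> \<Longrightarrow> q \<in> ball z \<rho> \<Longrightarrow> norm (h p - h q) \<le> L * norm (p - q)"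
proof -
  obtain \<rho> where \<rho>: "\<rho> > 0"
    "\<And>p q. p \<in> ball z \<rho> \<Longrightarrow> q \<in> ball z \<rho> \<Longrightarrow>
       norm (h p - h q - h' z (p - q)) \<le> 1 * norm (p - q)"
    using C1_strict_derivative[OF D c zero_less_one, where z = z] by metis
  show thesis
  proof (rule that[OF \<rho>(1), where L = "norm (h' z) + 1"])
    fix p q assume "p \<in> ball z \<rho>" "q \<in> ball z \<rho>"
    then have "norm (h p - h q - h' z (p - q)) \<le> norm (p - q)"
      using \<rho>(2)[of p q] by simp
    moreover have "norm (h' z (p - q)) \<le> norm (h' z) * norm (p - q)"
      by (rule norm_blinfun)
    moreover have "norm (h p - h q) \<le> norm (h p - h q - h' z (p - q)) + norm (h' z (p - q))"
      by (metis diff_add_cancel norm_triangle_ineq)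
    ultimately show "norm (h p - h q) \<le> (norm (h' z) + 1) * norm (p - q)"
      by (simp add: algebra_simps)
  qed (simp add: add_nonneg_pos)
qed

text \<open>Both endpoints may move with the index, so differentiability at \<open>z\<close> alone
  would not do; strict differentiability controls the increment by \<open>norm (p k - q k)\<close>,
  which is of order \<open>t k\<close>.\<close>

lemma C1_difference_quotient:
  fixes h :: "'a::real_normed_vector \<Rightarrow> 'b::real_normed_vector" and t :: "'c \<Rightarrow> real"
  assumes D: "\<And>z. (h has_derivative blinfun_apply (h' z)) (at z)"
    and c: "continuous_on UNIV h'"
    and t: "eventually (\<lambda>k. t k > 0) F"
    and p: "(p \<longlongrightarrow> z) F" and q: "(q \<longlongrightarrow> z) F"
    and d: "((\<lambda>k. (p k - q k) /\<^sub>R t k) \<longlongrightarrow> d) F"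
  shows "((\<lambda>k. (h (p k) - h (q k)) /\<^sub>R t k) \<longlongrightarrow> h' z d) F"
proof -
  have "((\<lambda>k. (h (p k) - h (q k)) /\<^sub>R t k - h' z ((p k - q k) /\<^sub>R t k)) \<longlongrightarrow> 0) F"
  proof (rule tendstoI)
    fix e :: real assume e: "e > 0"
    define e' where "e' = e / (norm d + 2)"
    have nd: "norm d + 2 > 0" by (simp add: add_nonneg_pos)
    then have e': "e' > 0" using e by (simp add: e'_def)
    obtain \<rho> where \<rho>: "\<rho> > 0"
      "\<And>p q. p \<in> ball z \<rho> \<Longrightarrow> q \<in> ball z \<rho> \<Longrightarrow>
         norm (h p - h q - h' z (p - q)) \<le> e' * norm (p - q)"
      using C1_strict_derivative[OF D c e', where z = z] by metis
    have "eventually (\<lambda>k. p k \<in> ball z \<rho>) F" "eventually (\<lambda>k. q k \<in> ball z \<rho>) F"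
      using p q \<rho>(1) by (auto simp: tendsto_iff dist_commute)
    moreover have "eventually (\<lambda>k. norm ((p k - q k) /\<^sub>R t k) < norm d + 1) F"
      by (rule order_tendstoD(2)[OF tendsto_norm[OF d]]) simp
    ultimately show "eventually (\<lambda>k. dist ((h (p k) - h (q k)) /\<^sub>R t k
        - h' z ((p k - q k) /\<^sub>R t k)) 0 < e) F"
      using t
    proof eventually_elim
      case (elim k)
      have "norm ((h (p k) - h (q k)) /\<^sub>R t k - h' z ((p k - q k) /\<^sub>R t k))
          = norm (h (p k) - h (q k) - h' z (p k - q k)) / t k"
        using elim by (simp add: blinfun.scaleR_right flip: scaleR_diff_right) (simp add: divide_inverse mult.commute)
      also have "\<dots> \<le> e' * norm (p k - q k) / t k"
        using \<rho>(2)[OF elim(1,2)] elim(4) by (simp add: divide_right_mono)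
      also have "\<dots> = e' * norm ((p k - q k) /\<^sub>R t k)"
        using elim by (simp add: divide_inverse mult.commute)
      also have "\<dots> \<le> e' * (norm d + 1)"
        using elim(3) e' by (intro mult_left_mono) auto
      also have "\<dots> < e' * (norm d + 2)"
        using e' by (intro mult_strict_left_mono) auto
      also have "\<dots> = e" using nd by (simp add: e'_def)
      finally show ?case by (simp add: dist_norm)
    qed
  qed
  moreover have "((\<lambda>k. h' z ((p k - q k) /\<^sub>R t k)) \<longlongrightarrow> h' z d) F"
    by (intro tendsto_intros d)
  ultimately show ?thesis
    using tendsto_add by fastforce
qed

text \<open>A family rather than a set: two indices with the same vector make it dependent, whereas
  the set of values forgets the repetition. Multipliers are attached to indices, so this is the
  notion they need.\<close>

definition lin_indep_family :: "('i \<Rightarrow> 'a::real_vector) \<Rightarrow> 'i set \<Rightarrow> bool" where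
  "lin_indep_family a J \<longleftrightarrow> (\<forall>c. (\<Sum>i\<in>J. c i *\<^sub>R a i) = 0 \<longrightarrow> (\<forall>i\<in>J. c i = 0))"

lemma lin_indep_family_iff:
  assumes "finite J"
  shows "lin_indep_family a J \<longleftrightarrow> inj_on a J \<and> independent (a ` J)"
proof
  assume L: "lin_indep_family a J"
  have inj: "inj_on a J"
  proof (rule inj_onI, rule ccontr)
    fix i j assume ij: "i \<in> J" "j \<in> J" "a i = a j" "i \<noteq> j"
    define c where "c = (\<lambda>k. (if k = i then 1 else 0) - (if k = j then 1 else (0::real)))"
    have "(\<Sum>k\<in>J. c k *\<^sub>R a k) = 0"
      using ij assms
      by (simp add: c_def scaleR_diff_left sum_subtractf if_distrib[of "\<lambda>r. r *\<^sub>R _"] cong: if_cong)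
    then have "c i = 0" using L ij(1) unfolding lin_indep_family_def by blast
    then show False using ij by (simp add: c_def)
  qed
  moreover have "independent (a ` J)"
  proof
    assume "dependent (a ` J)"
    then obtain e v where e: "v \<in> a ` J" "e v \<noteq> 0" "(\<Sum>v\<in>a ` J. e v *\<^sub>R v) = 0"
      using dependent_finite[of "a ` J"] assms by auto
    have "(\<Sum>i\<in>J. e (a i) *\<^sub>R a i) = 0"
      using e(3) sum.reindex[OF inj, of "\<lambda>v. e v *\<^sub>R v"] by simp
    then show False using L e(1,2) unfolding lin_indep_family_def by fastforce
  qed
  ultimately show "inj_on a J \<and> independent (a ` J)" ..
next
  assume A: "inj_on a J \<and> independent (a ` J)"
  show "lin_indep_family a J"
    unfolding lin_indep_family_def
  proof (intro allI impI ballI)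
    fix c i assume c: "(\<Sum>i\<in>J. c i *\<^sub>R a i) = 0" and i: "i \<in> J"
    have "(\<Sum>v\<in>a ` J. c (the_inv_into J a v) *\<^sub>R v) = (\<Sum>i\<in>J. c i *\<^sub>R a i)"
      using A by (subst sum.reindex) (auto intro!: sum.cong simp: the_inv_into_f_f)
    then have "c (the_inv_into J a (a i)) = 0"
      using A c assms i
      by (intro independentD[of "a ` J" "a ` J" "\<lambda>v. c (the_inv_into J a v)"]) auto
    then show "c i = 0" using i A by (auto simp: the_inv_into_f_f)
  qed
qed

text \<open>Ties the rank in \<open>rcr_regular\<close>, the dimension of an image, to the indexed
  family: rank \<open>card J\<close> excludes repetitions as well as linear relations.\<close>

lemma lin_indep_family_iff_dim:
  fixes a :: "'i \<Rightarrow> 'a::euclidean_space"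
  assumes "finite J"
  shows "lin_indep_family a J \<longleftrightarrow> dim (a ` J) = card J"
proof
  assume "lin_indep_family a J"
  then show "dim (a ` J) = card J"
    using lin_indep_family_iff[OF assms] by (metis card_image dim_eq_card_independent)
next
  assume d: "dim (a ` J) = card J"
  have "card J \<le> card (a ` J)"
    using d dim_le_card'[of "a ` J"] assms by simp
  then have c: "card (a ` J) = card J"
    using card_image_le[OF assms, of a] by simp
  then have "inj_on a J" using assms eq_card_imp_inj_on by blast
  moreover have "independent (a ` J)"
    by (rule card_le_dim_spanning[of _ "a ` J"]) (use d c assms in \<open>auto simp: span_superset\<close>)
  ultimately show "lin_indep_family a J" using lin_indep_family_iff[OF assms] by blast
qed

lemma sign_preserving_Caratheodory:
  fixes a :: "'i \<Rightarrow> 'a::real_vector" and \<mu> :: "'i \<Rightarrow> real"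
  assumes "finite S"
  obtains J \<nu> where "J \<subseteq> S" "lin_indep_family a J" "(\<Sum>i\<in>J. \<nu> i *\<^sub>R a i) = (\<Sum>i\<in>S. \<mu> i *\<^sub>R a i)"
    "\<forall>i\<in>J. \<nu> i * \<mu> i > 0"
proof -
  have "\<exists>J \<nu>. J \<subseteq> S \<and> lin_indep_family a J \<and> (\<Sum>i\<in>J. \<nu> i *\<^sub>R a i) = (\<Sum>i\<in>S. \<mu> i *\<^sub>R a i)
          \<and> (\<forall>i\<in>J. \<nu> i * \<mu> i > 0)"
    using assms
  proof (induction "card S" arbitrary: S \<mu> rule: less_induct)
    case less
    note IH = less(1) and fin = less(2)
    show ?case
    proof (cases "\<exists>i\<in>S. \<mu> i = 0")
      case True
      then obtain i where i: "i \<in> S" "\<mu> i = 0" by blast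
      have "card (S - {i}) < card S" using i fin by (meson card_Diff1_less)
      from IH[OF this, of \<mu>] fin obtain J \<nu> where J: "J \<subseteq> S - {i}" "lin_indep_family a J"
        "(\<Sum>i\<in>J. \<nu> i *\<^sub>R a i) = (\<Sum>i\<in>S - {i}. \<mu> i *\<^sub>R a i)" "\<forall>i\<in>J. \<nu> i * \<mu> i > 0" by auto
      moreover have "(\<Sum>i\<in>S - {i}. \<mu> i *\<^sub>R a i) = (\<Sum>i\<in>S. \<mu> i *\<^sub>R a i)"
        using i fin by (simp add: sum.remove[OF fin i(1)])
      ultimately show ?thesis by (metis Diff_subset subset_trans)
    next
      case nz: False
      show ?thesis
      proof (cases "lin_indep_family a S")
        case True
        then show ?thesis using nz by (intro exI[of _ S] exI[of _ \<mu>])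
            (auto simp: zero_less_mult_iff neq_iff)
      next
        case False
        then obtain c i where c: "(\<Sum>i\<in>S. c i *\<^sub>R a i) = 0" and i: "i \<in> S" "c i \<noteq> 0"
          unfolding lin_indep_family_def by blast
        define C where "C = {i\<in>S. c i \<noteq> 0}"
        have C: "finite C" "C \<noteq> {}" using fin i by (auto simp: C_def)
        \<comment> \<open>The smallest ratio in absolute value gives the step \<open>t\<close> that
          annihilates the coefficient of \<open>i0\<close> without letting any other one cross
          zero.\<close>
        obtain i0 where i0: "i0 \<in> C" "\<And>j. j \<in> C \<Longrightarrow> \<bar>\<mu> i0 / c i0\<bar> \<le> \<bar>\<mu> j / c j\<bar>"
          using arg_min_if_finite(1)[OF C, of "\<lambda>j. \<bar>\<mu> j / c j\<bar>"]
            arg_min_least[OF C, of _ "\<lambda>j. \<bar>\<mu> j / c j\<bar>"] by blast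
        define t where "t = \<mu> i0 / c i0"
        define \<mu>' where "\<mu>' = (\<lambda>i. \<mu> i - t * c i)"
        have le: "\<bar>t * c j\<bar> \<le> \<bar>\<mu> j\<bar>" if "j \<in> S" for j
        proof (cases "c j = 0")
          case False
          then have "\<bar>t\<bar> \<le> \<bar>\<mu> j / c j\<bar>" using i0(2)[of j] that by (simp add: C_def t_def)
          then show ?thesis using False by (simp add: abs_mult field_simps)
        qed simp
        have sum': "(\<Sum>i\<in>S. \<mu>' i *\<^sub>R a i) = (\<Sum>i\<in>S. \<mu> i *\<^sub>R a i)"
          using c by (simp add: \<mu>'_def scaleR_diff_left sum_subtractf flip: scaleR_scaleR scaleR_sum_right)
        have i0S: "i0 \<in> S" "\<mu>' i0 = 0" using i0(1) by (auto simp: C_def \<mu>'_def t_def)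
        have "card (S - {i0}) < card S" using i0S fin by (meson card_Diff1_less)
        from IH[OF this, of \<mu>'] fin obtain J \<nu> where J: "J \<subseteq> S - {i0}" "lin_indep_family a J"
          "(\<Sum>i\<in>J. \<nu> i *\<^sub>R a i) = (\<Sum>i\<in>S - {i0}. \<mu>' i *\<^sub>R a i)" "\<forall>i\<in>J. \<nu> i * \<mu>' i > 0" by auto
        have "(\<Sum>i\<in>S - {i0}. \<mu>' i *\<^sub>R a i) = (\<Sum>i\<in>S. \<mu>' i *\<^sub>R a i)"
          using i0S fin by (simp add: sum.remove[OF fin i0S(1)])
        moreover have "\<nu> j * \<mu> j > 0" if "j \<in> J" for j
        proof -
          \<comment> \<open>\<open>\<mu>' j = \<mu> j - z\<close>, with \<open>z\<close> no larger
            than \<open>\<mu> j\<close> in absolute value, cannot have the sign opposite to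
            \<open>\<mu> j\<close>, and it is nonzero because
            \<open>\<nu> j * \<mu>' j > 0\<close>.\<close>
          define z where "z = t * c j"
          have "\<nu> j * (\<mu> j - z) > 0" "\<bar>z\<bar> \<le> \<bar>\<mu> j\<bar>"
            using that J le[of j] by (auto simp: \<mu>'_def z_def)
          then show ?thesis
            unfolding zero_less_mult_iff by (auto simp: abs_if split: if_splits)
        qed
        ultimately show ?thesis using J sum' by (metis Diff_subset subset_trans)
      qed
    qed
  qed
  then show thesis using that by blast
qed

section \<open>Penalisation and uniform independence\<close>

lemma has_derivative_pos_part_square:
  "((\<lambda>s::real. (max 0 s)\<^sup>2) has_real_derivative 2 * max 0 s) (at s)"
proof -
  consider "s > 0" | "s < 0" | "s = 0" by linarith
  then show ?thesis
  proof cases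
    case 1
    have "((\<lambda>s::real. s\<^sup>2) has_real_derivative 2 * s) (at s)"
      by (auto intro!: derivative_eq_intros)
    then have "((\<lambda>s::real. (max 0 s)\<^sup>2) has_real_derivative 2 * s) (at s)"
      by (rule has_field_derivative_transform_within_open[where S = "{0<..}"]) (use 1 in auto)
    then show ?thesis using 1 by simp
  next
    case 2
    have "((\<lambda>s::real. 0) has_real_derivative 0) (at s)" by simp
    then have "((\<lambda>s::real. (max 0 s)\<^sup>2) has_real_derivative 0) (at s)"
      by (rule has_field_derivative_transform_within_open[where S = "{..<0}"]) (use 2 in auto)
    then show ?thesis using 2 by simp
  next
    case 3
    have "((\<lambda>h::real. (max 0 h)\<^sup>2 / h) \<longlongrightarrow> 0) (at 0)"
    proof (rule Lim_null_comparison[where g = "\<lambda>h. \<bar>h\<bar>"])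
      show "\<forall>\<^sub>F h in at 0. norm ((max 0 h)\<^sup>2 / h) \<le> \<bar>h::real\<bar>"
        by (rule always_eventually) (auto simp: max_def power2_eq_square)
      show "((\<lambda>h::real. \<bar>h\<bar>) \<longlongrightarrow> 0) (at 0)"
        by (auto intro!: tendsto_eq_intros)
    qed
    then show ?thesis using 3 by (simp add: DERIV_def)
  qed
qed

text \<open>Quadratic penalisation; the extra term \<open>\<parallel>w - yh\<parallel>\<^sup>2\<close> forces the penalised minimisers to
  converge to \<open>yh\<close>, which need not be the only nearest point.\<close>

lemma approximate_KKT_nearest_point:
  fixes h :: "'p::finite \<Rightarrow> 'b::euclidean_space \<Rightarrow> real" and G :: "'p \<Rightarrow> 'b \<Rightarrow> 'b"
  assumes D: "\<And>i w. (h i has_derivative (\<lambda>d. G i w \<bullet> d)) (at w)"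
    and feas: "\<And>i. h i yh \<le> 0" "\<And>i. i \<in> J \<Longrightarrow> h i yh = 0"
    and nearest: "\<And>z. (\<And>i. h i z \<le> 0) \<Longrightarrow> (\<And>i. i \<in> J \<Longrightarrow> h i z = 0) \<Longrightarrow> norm (yh - y) \<le> norm (z - y)"
    and e: "e > 0"
  obtains w \<mu> where "norm (w - yh) < e"
    "(w - y) + (w - yh) + (\<Sum>i\<in>UNIV. \<mu> i *\<^sub>R G i w) = 0"
    "\<And>i. i \<notin> J \<Longrightarrow> \<mu> i \<ge> 0" "\<And>i. i \<notin> J \<Longrightarrow> \<mu> i > 0 \<Longrightarrow> h i w > 0"
proof -
  \<comment> \<open>Signed violation for equalities, positive part for inequalities:
    \<open>real k * m i (h i w)\<close> becomes the multiplier, and off \<open>J\<close> it is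
    positive only at violated constraints.\<close>
  define m where "m = (\<lambda>i s. if i \<in> J then s else max 0 (s::real))"
  define P where "P = (\<lambda>w. \<Sum>i\<in>UNIV. (m i (h i w))\<^sup>2)"
  define \<phi> where "\<phi> = (\<lambda>k w. (norm (w - y))\<^sup>2 / 2 + (norm (w - yh))\<^sup>2 / 2 + real k / 2 * P w)"
  have m_deriv: "((\<lambda>s. (m i s)\<^sup>2) has_real_derivative 2 * m i s) (at s)" for i s
  proof (cases "i \<in> J")
    case True
    then show ?thesis by (auto simp: m_def intro!: derivative_eq_intros)
  next
    case False
    then show ?thesis using has_derivative_pos_part_square by (simp add: m_def)
  qed
  have P_deriv: "(P has_derivative (\<lambda>d. \<Sum>i\<in>UNIV. 2 * m i (h i w) * (G i w \<bullet> d))) (at w)" for w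
    unfolding P_def
  proof (rule has_derivative_sum)
    fix i
    show "((\<lambda>w. (m i (h i w))\<^sup>2) has_derivative (\<lambda>d. 2 * m i (h i w) * (G i w \<bullet> d))) (at w)"
      using has_derivative_compose[OF D[of i w] m_deriv[of i "h i w", unfolded has_field_derivative_def]]
      by (simp add: mult.commute)
  qed
  have \<phi>_deriv: "(\<phi> k has_derivative (\<lambda>d. ((w - y) + (w - yh) +
      (\<Sum>i\<in>UNIV. (real k * m i (h i w)) *\<^sub>R G i w)) \<bullet> d)) (at w)" for k w
  proof -
    have sq: "((\<lambda>w. (norm (w - c))\<^sup>2 / 2) has_derivative (\<lambda>d. (w - c) \<bullet> d)) (at w)" for c
      unfolding power2_norm_eq_inner
      by (rule has_derivative_eq_rhs, (rule derivative_intros)+)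
         (auto simp: fun_eq_iff inner_diff_left inner_diff_right inner_commute)
    show ?thesis
      unfolding \<phi>_def
      by (rule has_derivative_eq_rhs[OF has_derivative_add[OF has_derivative_add[OF sq sq]
            has_derivative_mult_right[OF P_deriv]]])
         (simp add: fun_eq_iff inner_add_left inner_sum_left sum_distrib_left mult.assoc)
  qed
  have P_cont: "isCont P w" for w
    using P_deriv has_derivative_continuous by blast
  have \<phi>_cont: "continuous_on S (\<phi> k)" for S k
    by (rule has_derivative_continuous_on[OF has_derivative_at_withinI[OF \<phi>_deriv]])
  have P_nonneg: "P w \<ge> 0" for w by (simp add: P_def sum_nonneg)
  have P_yh: "P yh = 0" using feas by (auto simp: P_def m_def intro!: sum.neutral)
  have "\<exists>w\<in>cball yh e. \<forall>z\<in>cball yh e. \<phi> k w \<le> \<phi> k z" for k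
    by (rule continuous_attains_inf) (use e \<phi>_cont in auto)
  then obtain w where w: "\<And>k. w k \<in> cball yh e" "\<And>k z. z \<in> cball yh e \<Longrightarrow> \<phi> k (w k) \<le> \<phi> k z"
    by metis
  obtain l r where lr: "strict_mono (r :: nat \<Rightarrow> nat)" "(w \<circ> r) \<longlonglongrightarrow> l"
    using compact_cball[of yh e] w(1) unfolding compact_def by metis
  \<comment> \<open>Comparison with \<open>yh\<close>, where the penalty and the extra term vanish;
    doubled to clear the halves.\<close>
  have upper: "(norm (w k - y))\<^sup>2 + (norm (w k - yh))\<^sup>2 + real k * P (w k) \<le> (norm (yh - y))\<^sup>2" for k
    using w(2)[of yh k] e P_yh by (simp add: \<phi>_def)
  have "P l \<le> 0"
  proof (rule tendsto_le[of sequentially])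
    show "(\<lambda>n. P (w (r n))) \<longlonglongrightarrow> P l"
      using isCont_tendsto_compose[OF P_cont lr(2)] by (simp add: o_def)
    have "filterlim (\<lambda>n. real (r n)) at_top sequentially"
      using filterlim_compose[OF filterlim_real_sequentially filterlim_subseq[OF lr(1)]] .
    then show "(\<lambda>n. (norm (yh - y))\<^sup>2 / real (r n)) \<longlonglongrightarrow> 0"
      by (intro tendsto_divide_0[OF tendsto_const] filterlim_at_top_imp_at_infinity)
    show "eventually (\<lambda>n. P (w (r n)) \<le> (norm (yh - y))\<^sup>2 / real (r n)) sequentially"
    proof (rule eventually_sequentiallyI[of 1])
      fix n :: nat assume "1 \<le> n"
      then have "r n > 0" using seq_suble[OF lr(1), of n] by simp
      moreover have "real (r n) * P (w (r n)) \<le> (norm (yh - y))\<^sup>2"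
        using upper[of "r n"] by (smt (verit) zero_le_power2)
      ultimately show "P (w (r n)) \<le> (norm (yh - y))\<^sup>2 / real (r n)"
        by (simp add: pos_le_divide_eq mult.commute)
    qed
  qed simp
  then have "P l = 0" using P_nonneg[of l] by simp
  then have m0: "m i (h i l) = 0" for i
    by (simp add: P_def sum_nonneg_eq_0_iff)
  have "h i l \<le> 0" for i using m0[of i] by (auto simp: m_def max_def split: if_splits)
  moreover have "h i l = 0" if "i \<in> J" for i using m0[of i] that by (simp add: m_def)
  \<comment> \<open>\<open>l\<close> satisfies the constraints and so is no closer to
    \<open>y\<close> than \<open>yh\<close>; the limit of \<open>upper\<close> then leaves nothing
    for \<open>norm (l - yh)\<close>.\<close>
  ultimately have "norm (yh - y) \<le> norm (l - y)" by (rule nearest)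
  moreover have "(norm (l - y))\<^sup>2 + (norm (l - yh))\<^sup>2 \<le> (norm (yh - y))\<^sup>2"
  proof (rule tendsto_upperbound)
    show "(\<lambda>n. (norm (w (r n) - y))\<^sup>2 + (norm (w (r n) - yh))\<^sup>2)
        \<longlonglongrightarrow> (norm (l - y))\<^sup>2 + (norm (l - yh))\<^sup>2"
      using lr(2) by (auto intro!: tendsto_intros simp: o_def)
    show "eventually (\<lambda>n. (norm (w (r n) - y))\<^sup>2 + (norm (w (r n) - yh))\<^sup>2 \<le> (norm (yh - y))\<^sup>2) sequentially"
    proof (rule always_eventually, rule allI)
      fix n
      have "real (r n) * P (w (r n)) \<ge> 0" using P_nonneg by simp
      then show "(norm (w (r n) - y))\<^sup>2 + (norm (w (r n) - yh))\<^sup>2 \<le> (norm (yh - y))\<^sup>2"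
        using upper[of "r n"] by linarith
    qed
  qed simp
  ultimately have "(norm (l - yh))\<^sup>2 \<le> 0"
    by (smt (verit) power_mono norm_ge_zero)
  then have "l = yh" by simp
  then have "eventually (\<lambda>n. dist (w (r n)) yh < e) sequentially"
    using lr(2) e by (simp add: tendsto_iff o_def)
  then obtain n where n: "dist (w (r n)) yh < e"
    using eventually_happens by force
  define k where "k = r n"
  \<comment> \<open>\<open>w k\<close> lies in the open ball by the choice of \<open>n\<close>, so
    it is a free local minimiser of \<open>\<phi> k\<close>.\<close>
  have "(\<lambda>d. ((w k - y) + (w k - yh) + (\<Sum>i\<in>UNIV. (real k * m i (h i (w k))) *\<^sub>R G i (w k))) \<bullet> d)
      = (\<lambda>d. 0)"
    by (rule differential_zero_maxmin[OF _ open_ball \<phi>_deriv, of _ yh e k])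
       (use n w(2)[of _ k] in \<open>auto simp: k_def dist_commute less_imp_le\<close>)
  then have "(w k - y) + (w k - yh) + (\<Sum>i\<in>UNIV. (real k * m i (h i (w k))) *\<^sub>R G i (w k)) = 0"
    by (metis inner_eq_zero_iff)
  then show thesis
    using n by (intro that[of "w k" "\<lambda>i. real k * m i (h i (w k))"])
      (auto simp: m_def k_def dist_norm zero_less_mult_iff)
qed

text \<open>Injectivity on the vectors supported on \<open>J\<close> gives a lower bound
  \<open>e\<close>; while the perturbations of the vectors sum to less than \<open>e / 2\<close>,
  half of it survives. \<open>CARD('i)\<close> passes from the Euclidean norm to the sum of absolute
  values.\<close>

lemma lin_indep_family_lower_bound:
  fixes a :: "'i::finite \<Rightarrow> 'c::t2_space \<Rightarrow> 'b::euclidean_space"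
  assumes indep: "lin_indep_family (\<lambda>i. a i z) J" and cont: "\<And>i. isCont (a i) z"
  obtains c where "c > 0"
    "\<forall>\<^sub>F x in nhds z. \<forall>\<nu>. (\<Sum>i\<in>J. \<bar>\<nu> i\<bar>) \<le> c * norm (\<Sum>i\<in>J. \<nu> i *\<^sub>R a i x)"
proof -
  define T where "T = (\<lambda>\<nu>::real^'i. \<Sum>i\<in>J. (\<nu>$i) *\<^sub>R a i z)"
  define S where "S = {\<nu>::real^'i. \<forall>i. i \<notin> J \<longrightarrow> \<nu>$i = 0}"
  have "bounded_linear T"
    unfolding T_def by (intro bounded_linear_sum bounded_linear_scaleR_const bounded_linear_vec_nth)
  moreover have "subspace S" unfolding S_def subspace_def by auto
  moreover have "\<forall>\<nu>\<in>S. T \<nu> = 0 \<longrightarrow> \<nu> = 0"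
  proof (intro ballI impI)
    fix \<nu> assume "\<nu> \<in> S" "T \<nu> = 0"
    then have "\<forall>i\<in>J. \<nu>$i = 0" "\<forall>i. i \<notin> J \<longrightarrow> \<nu>$i = 0"
      using indep unfolding lin_indep_family_def T_def S_def by auto
    then show "\<nu> = 0" unfolding vec_eq_iff by auto
  qed
  ultimately obtain e where e: "e > 0" "\<And>\<nu>. \<nu> \<in> S \<Longrightarrow> e * norm \<nu> \<le> norm (T \<nu>)"
    using injective_imp_isometric[of S T] closed_subspace by metis
  have "((\<lambda>x. \<Sum>i\<in>UNIV. norm (a i x - a i z)) \<longlongrightarrow> (\<Sum>i\<in>(UNIV::'i set). norm (a i z - a i z))) (nhds z)"
    using cont by (intro tendsto_intros) (simp add: continuous_at tendsto_at_iff_tendsto_nhds)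
  then have ev: "\<forall>\<^sub>F x in nhds z. (\<Sum>i\<in>(UNIV::'i set). norm (a i x - a i z)) < e / 2"
    using e by (intro order_tendstoD(2)) auto
  show thesis
  proof (rule that)
    show "2 * real CARD('i) / e > 0" using e by simp
    show "\<forall>\<^sub>F x in nhds z. \<forall>\<nu>. (\<Sum>i\<in>J. \<bar>\<nu> i\<bar>) \<le> (2 * real CARD('i) / e) * norm (\<Sum>i\<in>J. \<nu> i *\<^sub>R a i x)"
      using ev
    proof eventually_elim
      case (elim x)
      show ?case
      proof
        fix \<nu> :: "'i \<Rightarrow> real"
        define v where "v = (\<chi> i. if i \<in> J then \<nu> i else 0)"
        have vi: "v $ i = \<nu> i" if "i \<in> J" for i using that by (simp add: v_def)
        have "norm ((\<Sum>i\<in>J. \<nu> i *\<^sub>R a i x) - T v) = norm (\<Sum>i\<in>J. v$i *\<^sub>R (a i x - a i z))"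
          by (simp add: T_def vi scaleR_diff_right sum_subtractf)
        also have "\<dots> \<le> (\<Sum>i\<in>J. norm v * norm (a i x - a i z))"
          by (rule sum_norm_le) (simp add: mult_right_mono component_le_norm_cart)
        also have "\<dots> \<le> (\<Sum>i\<in>UNIV. norm v * norm (a i x - a i z))"
          by (rule sum_mono2) auto
        also have "\<dots> = norm v * (\<Sum>i\<in>UNIV. norm (a i x - a i z))"
          by (simp add: sum_distrib_left)
        also have "\<dots> \<le> norm v * (e / 2)"
          using elim by (intro mult_left_mono) auto
        finally have "norm ((\<Sum>i\<in>J. \<nu> i *\<^sub>R a i x) - T v) \<le> norm v * (e / 2)" .
        moreover have "e * norm v \<le> norm (T v)" by (rule e(2)) (simp add: S_def v_def)
        moreover have "norm (T v) \<le> norm (\<Sum>i\<in>J. \<nu> i *\<^sub>R a i x) + norm ((\<Sum>i\<in>J. \<nu> i *\<^sub>R a i x) - T v)"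
          by (metis norm_minus_commute norm_triangle_sub)
        ultimately have "e / 2 * norm v \<le> norm (\<Sum>i\<in>J. \<nu> i *\<^sub>R a i x)" by (simp add: field_simps)
        moreover have "(\<Sum>i\<in>J. \<bar>\<nu> i\<bar>) \<le> real CARD('i) * norm v"
        proof -
          have "(\<Sum>i\<in>J. \<bar>\<nu> i\<bar>) \<le> (\<Sum>i\<in>J. norm v)"
            by (rule sum_mono) (metis component_le_norm_cart vi)
          also have "\<dots> \<le> real CARD('i) * norm v"
            by (simp add: mult_right_mono card_mono)
          finally show ?thesis .
        qed
        ultimately have "(\<Sum>i\<in>J. \<bar>\<nu> i\<bar>) * (e / 2) \<le> real CARD('i) * norm (\<Sum>i\<in>J. \<nu> i *\<^sub>R a i x)"
          using e(1) by (smt (verit, ccfv_SIG) mult.assoc mult.commute mult_left_mono of_nat_0_le_iff half_gt_zero mult_right_mono)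
        then show "(\<Sum>i\<in>J. \<bar>\<nu> i\<bar>) \<le> (2 * real CARD('i) / e) * norm (\<Sum>i\<in>J. \<nu> i *\<^sub>R a i x)"
          using e(1) by (simp add: field_simps)
      qed
    qed
  qed
qed

section \<open>Error bounds from constant rank\<close>

locale C1_program =
  fixes f :: "(real^'n) \<times> (real^'m) \<Rightarrow> real" and g :: "(real^'n) \<times> (real^'m) \<Rightarrow> real^'p"
    and f' :: "(real^'n) \<times> (real^'m) \<Rightarrow> ((real^'n) \<times> (real^'m)) \<Rightarrow>\<^sub>L real"
    and g' :: "(real^'n) \<times> (real^'m) \<Rightarrow> ((real^'n) \<times> (real^'m)) \<Rightarrow>\<^sub>L (real^'p)"
  assumes f_deriv: "\<And>z. (f has_derivative blinfun_apply (f' z)) (at z)"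
    and f'_cont: "continuous_on UNIV f'"
    and g_deriv: "\<And>z. (g has_derivative blinfun_apply (g' z)) (at z)"
    and g'_cont: "continuous_on UNIV g'"
begin

lemma isCont_f: "isCont f z"
  using f_deriv has_derivative_continuous by blast

lemma isCont_g: "isCont g z"
  using g_deriv has_derivative_continuous by blast

lemma tendsto_f: "(h \<longlongrightarrow> z) F \<Longrightarrow> ((\<lambda>k. f (h k)) \<longlongrightarrow> f z) F"
  by (rule isCont_tendsto_compose[OF isCont_f])

lemma tendsto_g: "(h \<longlongrightarrow> z) F \<Longrightarrow> ((\<lambda>k. g (h k) $ i) \<longlongrightarrow> g z $ i) F"
  by (intro tendsto_vec_nth isCont_tendsto_compose[OF isCont_g])

section \<open>Constraint gradients in the decision variable\<close>

definition grad_yg :: "'p \<Rightarrow> (real^'n) \<times> (real^'m) \<Rightarrow> real^'m" where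
  "grad_yg i z = (\<chi> j. g' z (0, axis j 1) $ i)"

lemma partial_y_linear: "linear (\<lambda>d. g' z (0, d))"
proof
  fix c :: real and b1 b2 b :: "real^'m"
  show "g' z (0, b1 + b2) = g' z (0, b1) + g' z (0, b2)"
    by (simp flip: blinfun.add_right)
  show "g' z (0, c *\<^sub>R b) = c *\<^sub>R g' z (0, b)"
    by (simp flip: blinfun.scaleR_right)
qed

lemma grad_yg_matrix: "grad_yg i z = matrix (\<lambda>d. g' z (0, d)) $ i"
  by (simp add: grad_yg_def matrix_def vec_eq_iff)

lemma grad_yg_inner: "grad_yg i z \<bullet> d = g' z (0, d) $ i"
  by (metis grad_yg_matrix matrix_vector_mul_component matrix_works partial_y_linear
      linear_matrix_vector_mul_eq)

lemma partial_y_deriv: "((\<lambda>y. g (x, y)) has_derivative (\<lambda>d. g' (x, y) (0, d))) (at y)"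
  using has_derivative_compose[OF has_derivative_Pair[OF has_derivative_const has_derivative_ident]
      g_deriv] .

lemma partial_y_deriv_component:
  "((\<lambda>y. g (x, y) $ i) has_derivative (\<lambda>d. grad_yg i (x, y) \<bullet> d)) (at y)"
  unfolding grad_yg_inner
  by (rule bounded_linear.has_derivative[OF bounded_linear_vec_nth partial_y_deriv])

lemma row_jac_y: "row i (jac_y g x y) = grad_yg i (x, y)"
proof -
  have "frechet_derivative (\<lambda>y. g (x, y)) (at y) = (\<lambda>d. g' (x, y) (0, d))"
    using frechet_derivative_at[OF partial_y_deriv] by simp
  then show ?thesis
    by (simp add: jac_y_def jacobian_def grad_yg_matrix row_def)
qed

lemma isCont_grad_yg: "isCont (grad_yg i) z"
proof -
  have c: "isCont g' z" using g'_cont by (metis UNIV_I continuous_on_eq_continuous_at open_UNIV)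
  have "((\<lambda>z. g' z (0, axis j 1) $ i) \<longlongrightarrow> g' z (0, axis j 1) $ i) (at z)" for j
    by (intro tendsto_intros) (use c in \<open>simp add: continuous_at\<close>)
  then show ?thesis unfolding grad_yg_def continuous_at by (intro tendsto_vec_lambda)
qed

text \<open>In general a family independent at a point \<open>z\<close> near \<open>z0\<close> may
  degenerate at \<open>z0\<close>, and its constant may blow up as \<open>z\<close> tends to
  \<open>z0\<close>. Constant rank forces independence at \<open>z0\<close> itself, so finitely many
  index sets, each with its own constant, cover all cases.\<close>

lemma RCR_uniform_bound:
  assumes "rcr_regular g x0 y0"
  obtains C \<rho> where "C > 0" "\<rho> > 0"
    "\<And>z K \<nu>. z \<in> ball (x0, y0) \<rho> \<Longrightarrow> K \<subseteq> active g x0 y0 \<Longrightarrow> lin_indep_family (\<lambda>i. grad_yg i z) K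
       \<Longrightarrow> (\<Sum>i\<in>K. \<bar>\<nu> i\<bar>) \<le> C * norm (\<Sum>i\<in>K. \<nu> i *\<^sub>R grad_yg i z)"
proof -
  define z0 where "z0 = (x0, y0)"
  obtain \<delta> where \<delta>: "\<delta> > 0"
    and rank: "\<forall>K \<subseteq> active g x0 y0. \<exists>r. \<forall>(x, y) \<in> ball z0 \<delta>. dim ((\<lambda>j. row j (jac_y g x y)) ` K) = r"
    using assms unfolding rcr_regular_def z0_def by blast
  have indep0: "lin_indep_family (\<lambda>i. grad_yg i z0) K"
    if z: "z \<in> ball z0 \<delta>" and K: "K \<subseteq> active g x0 y0" and ind: "lin_indep_family (\<lambda>i. grad_yg i z) K" for z K
  proof -
    obtain r where r: "\<forall>(x, y) \<in> ball z0 \<delta>. dim ((\<lambda>j. row j (jac_y g x y)) ` K) = r"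
      using rank K by blast
    have "dim ((\<lambda>i. grad_yg i z) ` K) = r" if "z \<in> ball z0 \<delta>" for z
      using bspec[OF r that] by (cases z) (simp add: row_jac_y)
    moreover have "z0 \<in> ball z0 \<delta>" using \<delta> by simp
    ultimately have "dim ((\<lambda>i. grad_yg i z0) ` K) = dim ((\<lambda>i. grad_yg i z) ` K)" using z by metis
    then show ?thesis using ind by (simp add: lin_indep_family_iff_dim)
  qed
  define I where "I = {K. lin_indep_family (\<lambda>i. grad_yg i z0) K}"
  have "\<forall>K\<in>I. \<exists>c>0. \<forall>\<^sub>F z in nhds z0. \<forall>\<nu>. (\<Sum>i\<in>K. \<bar>\<nu> i\<bar>) \<le> c * norm (\<Sum>i\<in>K. \<nu> i *\<^sub>R grad_yg i z)"
    using lin_indep_family_lower_bound[of grad_yg z0] isCont_grad_yg unfolding I_def by blast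
  from bchoice[OF this] obtain c where "\<forall>K\<in>I. c K > 0 \<and>
    (\<forall>\<^sub>F z in nhds z0. \<forall>\<nu>. (\<Sum>i\<in>K. \<bar>\<nu> i\<bar>) \<le> c K * norm (\<Sum>i\<in>K. \<nu> i *\<^sub>R grad_yg i z))" ..
  then have c: "\<And>K. K \<in> I \<Longrightarrow> c K > 0"
    "\<And>K. K \<in> I \<Longrightarrow> \<forall>\<^sub>F z in nhds z0. \<forall>\<nu>. (\<Sum>i\<in>K. \<bar>\<nu> i\<bar>) \<le> c K * norm (\<Sum>i\<in>K. \<nu> i *\<^sub>R grad_yg i z)"
    by blast+
  define C where "C = (\<Sum>K\<in>I. c K) + 1"
  have CI: "c K \<le> C" if "K \<in> I" for K
  proof -
    have "c K \<le> sum c I"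
      by (rule member_le_sum[OF that]) (use c(1) in \<open>auto intro: less_imp_le\<close>)
    then show ?thesis by (simp add: C_def)
  qed
  have "\<forall>\<^sub>F z in nhds z0. \<forall>K\<in>I. \<forall>\<nu>. (\<Sum>i\<in>K. \<bar>\<nu> i\<bar>) \<le> c K * norm (\<Sum>i\<in>K. \<nu> i *\<^sub>R grad_yg i z)"
    using c(2) by (intro eventually_ball_finite) auto
  then obtain \<rho> where \<rho>: "\<rho> > 0" and bd: "\<And>z K \<nu>. dist z z0 < \<rho> \<Longrightarrow> K \<in> I
      \<Longrightarrow> (\<Sum>i\<in>K. \<bar>\<nu> i\<bar>) \<le> c K * norm (\<Sum>i\<in>K. \<nu> i *\<^sub>R grad_yg i z)"
    unfolding eventually_nhds_metric by blast
  show thesis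
  proof (rule that)
    show "C > 0" unfolding C_def using c(1) by (intro add_nonneg_pos sum_nonneg) (auto intro: less_imp_le)
    show "min \<delta> \<rho> > 0" using \<delta> \<rho> by simp
    fix z K \<nu> assume *: "z \<in> ball (x0, y0) (min \<delta> \<rho>)" "K \<subseteq> active g x0 y0" "lin_indep_family (\<lambda>i. grad_yg i z) K"
    then have K: "K \<in> I" using indep0[of z K] by (simp add: I_def z0_def)
    have "(\<Sum>i\<in>K. \<bar>\<nu> i\<bar>) \<le> c K * norm (\<Sum>i\<in>K. \<nu> i *\<^sub>R grad_yg i z)"
      using bd[OF _ K] * by (simp add: z0_def dist_commute)
    also have "\<dots> \<le> C * norm (\<Sum>i\<in>K. \<nu> i *\<^sub>R grad_yg i z)"
      using CI[OF K] by (simp add: mult_right_mono)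
    finally show "(\<Sum>i\<in>K. \<bar>\<nu> i\<bar>) \<le> C * norm (\<Sum>i\<in>K. \<nu> i *\<^sub>R grad_yg i z)" .
  qed
qed

definition feasible_eq :: "'p set \<Rightarrow> real^'n \<Rightarrow> (real^'m) set" where
  "feasible_eq J x = {y \<in> feasible g x. \<forall>i\<in>J. g (x, y) $ i = 0}"

definition residual :: "'p set \<Rightarrow> (real^'n) \<times> (real^'m) \<Rightarrow> real" where
  "residual J z = (\<Sum>i\<in>UNIV. if i \<in> J then \<bar>g z $ i\<bar> else max 0 (g z $ i))"

lemma feasible_iff: "y \<in> feasible g x \<longleftrightarrow> (\<forall>i. g (x, y) $ i \<le> 0)"
  by (simp add: feasible_def less_eq_vec_def)

lemma closed_feasible_eq: "closed (feasible_eq J x)"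
proof -
  have c: "continuous_on UNIV (\<lambda>y. g (x, y) $ i)" for i
    by (rule has_derivative_continuous_on[OF has_derivative_at_withinI[OF partial_y_deriv_component]])
  have "feasible_eq J x = (\<Inter>i. {y. g (x, y) $ i \<le> 0}) \<inter> (\<Inter>i\<in>J. {y. g (x, y) $ i = 0})"
    by (auto simp: feasible_eq_def feasible_iff)
  then show ?thesis
    by (auto intro!: closed_Int closed_INT closed_Collect_le closed_Collect_eq c)
qed

lemma residual_component:
  "i \<in> J \<Longrightarrow> \<bar>g z $ i\<bar> \<le> residual J z" "g z $ i \<le> residual J z" "0 \<le> residual J z"
proof -
  let ?r = "\<lambda>i. if i \<in> J then \<bar>g z $ i\<bar> else max 0 (g z $ i)"
  have *: "?r i \<le> residual J z" for i
    unfolding residual_def by (rule member_le_sum) auto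
  show "i \<in> J \<Longrightarrow> \<bar>g z $ i\<bar> \<le> residual J z" using *[of i] by simp
  show "g z $ i \<le> residual J z" using *[of i] by (simp split: if_splits)
  show "0 \<le> residual J z" unfolding residual_def by (rule sum_nonneg) auto
qed

text \<open>With \<open>yh\<close> nearest to \<open>y\<close> and \<open>w\<close> an approximate KKT point near \<open>yh\<close>, pairing the KKT equation
  with \<open>y - yh\<close> gives \<open>\<parallel>y - yh\<parallel>\<^sup>2 \<le> C \<parallel>y - yh\<parallel> (residual + \<parallel>y - yh\<parallel> / (2 C))\<close>: the constant rank keeps
  the multipliers bounded by \<open>C \<parallel>y - yh\<parallel>\<close>.\<close>

lemma RCR_error_bound:
  assumes rcr: "rcr_regular g x0 y0" and feas0: "y0 \<in> feasible g x0"
  obtains \<kappa> \<rho> where "\<kappa> > 0" "\<rho> > 0"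
    "\<And>J x y. J \<subseteq> active g x0 y0 \<Longrightarrow> x \<in> ball x0 \<rho> \<Longrightarrow> y \<in> ball y0 \<rho>
       \<Longrightarrow> feasible_eq J x \<inter> ball y0 \<rho> \<noteq> {}
       \<Longrightarrow> \<exists>y'\<in>feasible_eq J x. norm (y - y') \<le> \<kappa> * residual J (x, y)"
proof -
  define z0 where "z0 = (x0, y0)"
  obtain C \<rho>1 where C: "C > 0" "\<rho>1 > 0"
    and mult_bound: "\<And>z K \<nu>. z \<in> ball z0 \<rho>1 \<Longrightarrow> K \<subseteq> active g x0 y0 \<Longrightarrow> lin_indep_family (\<lambda>i. grad_yg i z) K
       \<Longrightarrow> (\<Sum>i\<in>K. \<bar>\<nu> i\<bar>) \<le> C * norm (\<Sum>i\<in>K. \<nu> i *\<^sub>R grad_yg i z)"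
    using RCR_uniform_bound[OF rcr] unfolding z0_def by blast
  \<comment> \<open>Makes the linearisation error \<open>C * d * (2 * \<omega> * d)\<close> equal to
    \<open>d\<^sup>2 / 2\<close>, half of the left-hand side of the final estimate.\<close>
  define \<omega> where "\<omega> = 1 / (4 * C)"
  have \<omega>: "\<omega> > 0" using C by (simp add: \<omega>_def)
  obtain \<rho>2 where \<rho>2: "\<rho>2 > 0" and strict: "\<And>p q. p \<in> ball z0 \<rho>2 \<Longrightarrow> q \<in> ball z0 \<rho>2 \<Longrightarrow>
       norm (g p - g q - g' z0 (p - q)) \<le> \<omega> * norm (p - q)"
    using C1_strict_derivative[OF g_deriv g'_cont \<omega>, where z = z0] by blast
  obtain \<rho>3 L where \<rho>3: "\<rho>3 > 0" "L > 0" and lip: "\<And>p q. p \<in> ball z0 \<rho>3 \<Longrightarrow> q \<in> ball z0 \<rho>3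
       \<Longrightarrow> norm (g p - g q) \<le> L * norm (p - q)"
    using C1_local_Lipschitz[OF g_deriv g'_cont, where z = z0] by blast
  have "\<forall>\<^sub>F z in nhds z0. \<forall>i\<in>UNIV. norm (grad_yg i z - grad_yg i z0) < \<omega>"
  proof (intro eventually_ball_finite ballI)
    fix i
    have "((\<lambda>z. grad_yg i z) \<longlongrightarrow> grad_yg i z0) (nhds z0)"
      using isCont_grad_yg[of z0 i] by (simp add: continuous_at tendsto_at_iff_tendsto_nhds)
    then show "\<forall>\<^sub>F z in nhds z0. norm (grad_yg i z - grad_yg i z0) < \<omega>"
      using \<omega> by (auto simp: tendsto_iff dist_norm)
  qed simp
  moreover have "\<forall>\<^sub>F z in nhds z0. \<forall>i\<in>-active g x0 y0. g z $ i < 0"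
  proof (intro eventually_ball_finite ballI)
    fix i assume "i \<in> - active g x0 y0"
    then have "g z0 $ i < 0" using feas0 by (simp add: active_def z0_def feasible_iff order_less_le)
    moreover have "((\<lambda>z. g z $ i) \<longlongrightarrow> g z0 $ i) (nhds z0)"
      by (rule tendsto_g) (simp add: filterlim_def)
    ultimately show "\<forall>\<^sub>F z in nhds z0. g z $ i < 0" by (simp add: order_tendstoD(2))
  qed simp
  ultimately have "\<forall>\<^sub>F z in nhds z0. (\<forall>i. norm (grad_yg i z - grad_yg i z0) < \<omega>)
      \<and> (\<forall>i\<in>-active g x0 y0. g z $ i < 0)"
    by eventually_elim simp
  then obtain \<rho>4 where \<rho>4: "\<rho>4 > 0" and grad_close: "\<And>z i. z \<in> ball z0 \<rho>4 \<Longrightarrow> norm (grad_yg i z - grad_yg i z0) < \<omega>"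
    and inactive: "\<And>z i. z \<in> ball z0 \<rho>4 \<Longrightarrow> i \<notin> active g x0 y0 \<Longrightarrow> g z $ i < 0"
    unfolding eventually_nhds_metric by (auto simp: dist_commute)
  define R where "R = min (min \<rho>1 \<rho>2) (min \<rho>3 \<rho>4)"
  \<comment> \<open>\<open>yh\<close> lies within \<open>3 * \<rho>\<close> and \<open>w\<close>
    within \<open>4 * \<rho>\<close> of \<open>y0\<close>; the parameter \<open>x\<close> adds one
    more \<open>\<rho>\<close>.\<close>
  define \<rho> where "\<rho> = R / 5"
  have R: "R > 0" "R \<le> \<rho>1" "R \<le> \<rho>2" "R \<le> \<rho>3" "R \<le> \<rho>4" using C \<rho>2 \<rho>3 \<rho>4 by (auto simp: R_def)
  then have \<rho>: "\<rho> > 0" by (simp add: \<rho>_def)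
  show thesis
  proof (rule that[of "2 * C" \<rho>])
    fix J x y
    assume J: "J \<subseteq> active g x0 y0" and x: "x \<in> ball x0 \<rho>" and y: "y \<in> ball y0 \<rho>"
      and ne: "feasible_eq J x \<inter> ball y0 \<rho> \<noteq> {}"
    obtain yh where yh: "yh \<in> feasible_eq J x" "\<And>z. z \<in> feasible_eq J x \<Longrightarrow> dist y yh \<le> dist y z"
      using distance_attains_inf[OF closed_feasible_eq, of J x y] ne by blast
    obtain z where z: "z \<in> feasible_eq J x" "dist y0 z < \<rho>" using ne by auto
    have "dist y yh < 2 * \<rho>"
      using yh(2)[OF z(1)] z(2) y dist_triangle[of y z y0] by (simp add: dist_commute)
    then have yh0: "dist y0 yh < 3 * \<rho>"
      using y dist_triangle[of y0 yh y] by (simp add: dist_commute)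
    have pair: "(x, w) \<in> ball z0 R" if "dist y0 w < 4 * \<rho>" for w
    proof -
      have "dist z0 (x, w) \<le> dist x0 x + dist y0 w"
        by (simp add: z0_def dist_Pair_Pair sqrt_sum_squares_le_sum)
      then show ?thesis using that x by (simp add: \<rho>_def)
    qed
    define d where "d = norm (y - yh)"
    define r where "r = residual J (x, y)"
    have r0: "r \<ge> 0" by (simp add: r_def residual_component)
    \<comment> \<open>No exact multipliers at \<open>yh\<close> are presupposed: \<open>w\<close>
      lies within \<open>e\<close> of \<open>yh\<close>, and \<open>e\<close> tends to 0 once the
      multipliers are gone from the inequality.\<close>
    have key: "d\<^sup>2 - 2 * e * d \<le> C * (d + 2 * e) * (r + 2 * \<omega> * d + L * e)"
      if e: "0 < e" "e < \<rho>" for e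
    proof -
      obtain w \<mu> where w: "norm (w - yh) < e"
        and kkt: "(w - y) + (w - yh) + (\<Sum>i\<in>UNIV. \<mu> i *\<^sub>R grad_yg i (x, w)) = 0"
        and \<mu>: "\<And>i. i \<notin> J \<Longrightarrow> \<mu> i \<ge> 0" "\<And>i. i \<notin> J \<Longrightarrow> \<mu> i > 0 \<Longrightarrow> g (x, w) $ i > 0"
      proof (rule approximate_KKT_nearest_point[where h = "\<lambda>i w. g (x, w) $ i" and G = "\<lambda>i w. grad_yg i (x, w)"
            and yh = yh and J = J and y = y and e = e])
        show "norm (yh - y) \<le> norm (z - y)" if "\<And>i. g (x, z) $ i \<le> 0" "\<And>i. i \<in> J \<Longrightarrow> g (x, z) $ i = 0" for z
          using yh(2)[of z] that by (simp add: feasible_eq_def feasible_iff dist_norm norm_minus_commute)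
      qed (use yh(1) e partial_y_deriv_component in \<open>auto simp: feasible_eq_def feasible_iff\<close>)
      have w0: "dist y0 w < 4 * \<rho>"
        using w e yh0 dist_triangle[of y0 w yh] by (simp add: dist_norm norm_minus_commute)
      have wB: "(x, w) \<in> ball z0 R" and yhB: "(x, yh) \<in> ball z0 R" and yB: "(x, y) \<in> ball z0 R"
        using pair[OF w0] pair[of yh] pair[of y] yh0 y \<rho> by auto
      obtain K \<nu> where K: "lin_indep_family (\<lambda>i. grad_yg i (x, w)) K"
        and sumK: "(\<Sum>i\<in>K. \<nu> i *\<^sub>R grad_yg i (x, w)) = (\<Sum>i\<in>UNIV. \<mu> i *\<^sub>R grad_yg i (x, w))"
        and sgn: "\<forall>i\<in>K. \<nu> i * \<mu> i > 0"
        by (rule sign_preserving_Caratheodory[OF finite, of UNIV "\<lambda>i. grad_yg i (x, w)" \<mu>]) (rule that)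
      have pos: "\<nu> i > 0" "g (x, w) $ i > 0" if "i \<in> K" "i \<notin> J" for i
        using bspec[OF sgn that(1)] \<mu>[OF that(2)] by (auto simp: zero_less_mult_iff)
      \<comment> \<open>An index of \<open>K\<close> outside \<open>J\<close> belongs to a
        constraint violated at \<open>(x, w)\<close>, whereas inactive constraints stay negative
        near \<open>z0\<close>; hence \<open>mult_bound\<close> applies to \<open>K\<close>.\<close>
      have KA: "K \<subseteq> active g x0 y0"
      proof
        fix i assume "i \<in> K"
        then show "i \<in> active g x0 y0"
          using J pos(2)[of i] inactive[of "(x, w)" i] wB R by fastforce
      qed
      define v where "v = (y - w) - (w - yh)"
      have v: "v = (\<Sum>i\<in>K. \<nu> i *\<^sub>R grad_yg i (x, w))"
        using kkt unfolding sumK v_def by (simp add: algebra_simps add_eq_0_iff)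
      have v2: "v = (y - yh) - 2 *\<^sub>R (w - yh)" by (simp add: v_def algebra_simps scaleR_2)
      have nv: "norm v \<le> d + 2 * e"
      proof -
        from v2 have "norm v \<le> d + norm (2 *\<^sub>R (w - yh))" unfolding d_def by (metis norm_triangle_ineq4)
        then show ?thesis using w by simp
      qed
      have sum\<nu>: "(\<Sum>i\<in>K. \<bar>\<nu> i\<bar>) \<le> C * (d + 2 * e)"
      proof -
        have "(\<Sum>i\<in>K. \<bar>\<nu> i\<bar>) \<le> C * norm v"
          unfolding v using wB R KA K by (intro mult_bound) auto
        also have "\<dots> \<le> C * (d + 2 * e)" using nv C by simp
        finally show ?thesis .
      qed
      \<comment> \<open>Strict differentiability at \<open>z0\<close> and the change of the gradient
        from \<open>z0\<close> to \<open>(x, w)\<close> cost \<open>\<omega> * d\<close>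
        each.\<close>
      have lin: "\<bar>grad_yg i (x, w) \<bullet> (y - yh) - (g (x, y) $ i - g (x, yh) $ i)\<bar> \<le> 2 * \<omega> * d" for i
      proof -
        have "\<bar>(g (x, y) - g (x, yh) - g' z0 ((x, y) - (x, yh))) $ i\<bar> \<le> \<omega> * norm ((x, y) - (x, yh))"
          using strict[of "(x, y)" "(x, yh)"] yB yhB R component_le_norm_cart order_trans by fastforce
        then have "\<bar>grad_yg i z0 \<bullet> (y - yh) - (g (x, y) $ i - g (x, yh) $ i)\<bar> \<le> \<omega> * d"
          by (simp add: grad_yg_inner norm_Pair d_def abs_minus_commute)
        moreover have "\<bar>(grad_yg i (x, w) - grad_yg i z0) \<bullet> (y - yh)\<bar> \<le> \<omega> * d"
        proof -
          have "\<bar>(grad_yg i (x, w) - grad_yg i z0) \<bullet> (y - yh)\<bar> \<le> norm (grad_yg i (x, w) - grad_yg i z0) * d"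
            unfolding d_def by (rule Cauchy_Schwarz_ineq2)
          also have "\<dots> \<le> \<omega> * d"
            using grad_close[of "(x, w)" i] wB R by (intro mult_right_mono) (auto simp: d_def)
          finally show ?thesis .
        qed
        ultimately show ?thesis by (simp add: inner_diff_left)
      qed
      \<comment> \<open>On \<open>J\<close> the sign of \<open>\<nu> i\<close> is free, but
        \<open>g (x, yh) $ i = 0\<close>. Off \<open>J\<close> an upper bound suffices, and the
        violation at \<open>w\<close> keeps \<open>g (x, yh) $ i\<close> above
        \<open>- (L * e)\<close>.\<close>
      have summand: "\<nu> i * (grad_yg i (x, w) \<bullet> (y - yh)) \<le> \<bar>\<nu> i\<bar> * (r + 2 * \<omega> * d + L * e)" if i: "i \<in> K" for i
      proof (cases "i \<in> J")
        case True
        then have "g (x, yh) $ i = 0" using yh(1) by (simp add: feasible_eq_def)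
        moreover have "\<bar>g (x, y) $ i\<bar> \<le> r" using True by (simp add: r_def residual_component)
        ultimately have "\<bar>grad_yg i (x, w) \<bullet> (y - yh)\<bar> \<le> r + 2 * \<omega> * d + L * e"
          using lin[of i] e \<rho>3 by (simp add: abs_le_iff) (smt (verit) mult_pos_pos)
        then have "\<bar>\<nu> i\<bar> * \<bar>grad_yg i (x, w) \<bullet> (y - yh)\<bar> \<le> \<bar>\<nu> i\<bar> * (r + 2 * \<omega> * d + L * e)"
          by (rule mult_left_mono) simp
        then show ?thesis
          using abs_ge_self[of "\<nu> i * (grad_yg i (x, w) \<bullet> (y - yh))"] by (simp add: abs_mult)
      next
        case False
        have "\<bar>(g (x, w) - g (x, yh)) $ i\<bar> \<le> L * norm ((x, w) - (x, yh))"
          using lip[of "(x, w)" "(x, yh)"] wB yhB R component_le_norm_cart order_trans by fastforce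
        also have "\<dots> \<le> L * e" using w \<rho>3 by (simp add: norm_Pair)
        finally have "g (x, yh) $ i \<ge> - (L * e)" using pos(2)[OF i False] by simp
        moreover have "g (x, y) $ i \<le> r" by (simp add: r_def residual_component)
        ultimately have "grad_yg i (x, w) \<bullet> (y - yh) \<le> r + 2 * \<omega> * d + L * e"
          using lin[of i] by (simp add: abs_le_iff)
        then show ?thesis using pos(1)[OF i False] by simp
      qed
      have "v \<bullet> (y - yh) = (\<Sum>i\<in>K. \<nu> i * (grad_yg i (x, w) \<bullet> (y - yh)))"
        unfolding v by (simp add: inner_sum_left)
      also have "\<dots> \<le> (\<Sum>i\<in>K. \<bar>\<nu> i\<bar> * (r + 2 * \<omega> * d + L * e))"
        by (rule sum_mono) (rule summand)
      also have "\<dots> = (\<Sum>i\<in>K. \<bar>\<nu> i\<bar>) * (r + 2 * \<omega> * d + L * e)" by (simp add: sum_distrib_right)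
      also have "\<dots> \<le> C * (d + 2 * e) * (r + 2 * \<omega> * d + L * e)"
        using sum\<nu> r0 \<omega> e \<rho>3 by (intro mult_right_mono) (auto simp: d_def)
      finally have upper: "v \<bullet> (y - yh) \<le> C * (d + 2 * e) * (r + 2 * \<omega> * d + L * e)" .
      have "v \<bullet> (y - yh) = d\<^sup>2 - 2 * ((w - yh) \<bullet> (y - yh))"
        unfolding v2 d_def power2_norm_eq_inner inner_diff_left inner_scaleR_left ..
      moreover have "(w - yh) \<bullet> (y - yh) \<le> e * d"
        using norm_cauchy_schwarz[of "w - yh" "y - yh"] w unfolding d_def
        by (smt (verit) mult_right_mono norm_ge_zero)
      ultimately show ?thesis using upper by linarith
    qed
    have "d\<^sup>2 - 2 * 0 * d \<le> C * (d + 2 * 0) * (r + 2 * \<omega> * d + L * 0)"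
    proof (rule tendsto_le[of "at_right (0::real)"])
      show "((\<lambda>e. C * (d + 2 * e) * (r + 2 * \<omega> * d + L * e)) \<longlongrightarrow> C * (d + 2 * 0) * (r + 2 * \<omega> * d + L * 0)) (at_right 0)"
        by (intro tendsto_intros)
      show "((\<lambda>e. d\<^sup>2 - 2 * e * d) \<longlongrightarrow> d\<^sup>2 - 2 * 0 * d) (at_right 0)"
        by (intro tendsto_intros)
      show "\<forall>\<^sub>F e in at_right 0. d\<^sup>2 - 2 * e * d \<le> C * (d + 2 * e) * (r + 2 * \<omega> * d + L * e)"
        using eventually_at_right_less \<rho> key by (auto simp: eventually_at_right_field)
    qed simp
    then have "d * d \<le> d * (C * r + d / 2)"
      using C by (simp add: \<omega>_def power2_eq_square algebra_simps)
    then have "d \<le> 2 * C * r"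
      using C r0 by (cases "d = 0") (auto simp: d_def)
    then show "\<exists>y'\<in>feasible_eq J x. norm (y - y') \<le> 2 * C * residual J (x, y)"
      using yh(1) by (auto simp: d_def r_def)
  qed (use C \<rho> in auto)
qed

end

section \<open>Directional Lipschitz continuity of the value function\<close>

lemma scaleR_mem_dir_nbhd:
  fixes u :: "'a::real_normed_vector"
  assumes "\<epsilon> > 0" "\<delta> > 0"
  obtains \<rho> \<sigma> where "\<rho> > 0" "\<sigma> > 0"
    "\<forall>s w. 0 < s \<longrightarrow> s < \<sigma> \<longrightarrow> w \<in> ball u \<rho> \<longrightarrow> s *\<^sub>R w \<in> dir_nbhd \<epsilon> \<delta> u"
proof (cases "u = 0")
  case True
  \<comment> \<open>For \<open>u = 0\<close> the angular inequality is trivial and the neighbourhood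
    is a full ball.\<close>
  have "s *\<^sub>R w \<in> dir_nbhd \<epsilon> \<delta> u" if "0 < s" "s < \<epsilon>" "w \<in> ball u 1" for s w
  proof -
    have "s * norm w < \<epsilon> * 1" using that True assms by (intro mult_strict_mono) auto
    then show ?thesis using True that by (simp add: dir_nbhd_def)
  qed
  then show thesis using assms that[of 1 \<epsilon>] by simp
next
  case False
  \<comment> \<open>Solves \<open>2 * \<rho> = \<delta> * (norm u - \<rho>)\<close>, so that
    \<open>norm (w - u) < \<rho>\<close> implies
    \<open>2 * norm (w - u) \<le> \<delta> * norm w\<close>.\<close>
  define \<rho> where "\<rho> = \<delta> * norm u / (2 + \<delta>)"
  have \<rho>: "\<rho> > 0" "\<rho> * (2 + \<delta>) = \<delta> * norm u" using assms False by (auto simp: \<rho>_def)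
  define \<sigma> where "\<sigma> = \<epsilon> / (norm u + \<rho>)"
  have n: "norm u + \<rho> > 0" using \<rho> by (simp add: add_nonneg_pos)
  then have \<sigma>: "\<sigma> > 0" using assms by (simp add: \<sigma>_def)
  have "s *\<^sub>R w \<in> dir_nbhd \<epsilon> \<delta> u" if s: "0 < s" "s < \<sigma>" and w: "w \<in> ball u \<rho>" for s w
  proof -
    have d: "norm (w - u) < \<rho>" using w by (simp add: dist_norm norm_minus_commute)
    have nw: "norm w < norm u + \<rho>" "norm w > norm u - \<rho>"
      using d norm_triangle_ineq2[of w u] norm_triangle_ineq3[of w u] by linarith+
    have "s * norm w \<le> s * (norm u + \<rho>)" using nw s by simp
    also have "\<dots> < \<sigma> * (norm u + \<rho>)" using s n by simp
    also have "\<dots> = \<epsilon>" using n by (simp add: \<sigma>_def)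
    finally have "norm (s *\<^sub>R w) < \<epsilon>" using s by simp
    moreover have "norm (norm u *\<^sub>R (s *\<^sub>R w) - norm (s *\<^sub>R w) *\<^sub>R u) \<le> \<delta> * norm (s *\<^sub>R w) * norm u"
    proof -
      have "norm (norm u *\<^sub>R w - norm w *\<^sub>R u) = norm (norm u *\<^sub>R (w - u) + (norm u - norm w) *\<^sub>R u)"
        by (simp add: algebra_simps)
      also have "\<dots> \<le> norm u * norm (w - u) + \<bar>norm u - norm w\<bar> * norm u"
        by (rule norm_triangle_le) simp
      also have "\<dots> \<le> norm u * norm (w - u) + norm (w - u) * norm u"
        using norm_triangle_ineq3[of u w] by (intro add_left_mono mult_right_mono) (auto simp: norm_minus_commute)
      also have "\<dots> = norm u * (2 * norm (w - u))" by simp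
      also have "\<dots> \<le> norm u * (\<delta> * norm w)"
      proof (rule mult_left_mono)
        have "\<delta> * (norm u - \<rho>) \<le> \<delta> * norm w" using nw assms by simp
        then show "2 * norm (w - u) \<le> \<delta> * norm w" using d \<rho>(2) by (simp add: algebra_simps)
      qed simp
      finally have "s * norm (norm u *\<^sub>R w - norm w *\<^sub>R u) \<le> s * (norm u * (\<delta> * norm w))"
        using s by simp
      moreover have "norm u *\<^sub>R (s *\<^sub>R w) - norm (s *\<^sub>R w) *\<^sub>R u = s *\<^sub>R (norm u *\<^sub>R w - norm w *\<^sub>R u)"
        using s by (simp add: algebra_simps)
      ultimately show ?thesis using s by (simp add: mult_ac)
    qed
    ultimately show ?thesis by (simp add: dir_nbhd_def)
  qed
  then show thesis using that \<rho>(1) \<sigma> by blast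
qed

lemma dir_nbhd_mono:
  assumes "\<epsilon> \<le> \<epsilon>'" "\<delta> \<le> \<delta>'"
  shows "dir_nbhd \<epsilon> \<delta> u \<subseteq> dir_nbhd \<epsilon>' \<delta>' u"
proof
  fix z assume "z \<in> dir_nbhd \<epsilon> \<delta> u"
  moreover have "\<delta> * norm z * norm u \<le> \<delta>' * norm z * norm u"
    using assms by (intro mult_right_mono) auto
  ultimately show "z \<in> dir_nbhd \<epsilon>' \<delta>' u"
    using assms unfolding dir_nbhd_def by auto
qed

text \<open>Convergence with respect to directional neighbourhoods, the form that arguments by
  contradiction over shrinking neighbourhoods produce. Unlike \<open>x0 + t k *\<^sub>R us k\<close>
  with \<open>us\<close> tending to \<open>u\<close>, it admits infinitely many terms equal to
  \<open>x0\<close> even for nonzero \<open>u\<close>.\<close>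

definition approaches_along :: "'a::real_normed_vector \<Rightarrow> 'a \<Rightarrow> (nat \<Rightarrow> 'a) \<Rightarrow> bool" where
  "approaches_along x0 u xs \<longleftrightarrow>
     (\<forall>\<epsilon>>0. \<forall>\<delta>>0. \<forall>\<^sub>F k in sequentially. xs k \<in> (+) x0 ` dir_nbhd \<epsilon> \<delta> u)"

lemma approaches_along_scaled:
  assumes t: "\<And>k. t k > 0" "t \<longlonglongrightarrow> 0" and us: "us \<longlonglongrightarrow> u"
  shows "approaches_along x0 u (\<lambda>k. x0 + t k *\<^sub>R us k)"
  unfolding approaches_along_def
proof (intro allI impI)
  fix \<epsilon> \<delta> :: real assume "\<epsilon> > 0" "\<delta> > 0"
  then obtain \<rho> \<sigma> where \<rho>: "\<rho> > 0" "\<sigma> > 0"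
    "\<forall>s w. 0 < s \<longrightarrow> s < \<sigma> \<longrightarrow> w \<in> ball u \<rho> \<longrightarrow> s *\<^sub>R w \<in> dir_nbhd \<epsilon> \<delta> u"
    using scaleR_mem_dir_nbhd by metis
  have "\<forall>\<^sub>F k in sequentially. t k < \<sigma>" using t(2) \<rho>(2) by (simp add: order_tendstoD(2))
  moreover have "\<forall>\<^sub>F k in sequentially. us k \<in> ball u \<rho>"
    using us \<rho>(1) by (auto simp: tendsto_iff dist_commute)
  ultimately show "\<forall>\<^sub>F k in sequentially. x0 + t k *\<^sub>R us k \<in> (+) x0 ` dir_nbhd \<epsilon> \<delta> u"
    by eventually_elim (use t(1) \<rho>(3) in auto)
qed

lemma approaches_along_inverse:
  assumes "\<And>k. xs k \<in> (+) x0 ` dir_nbhd (inverse (Suc k)) (inverse (Suc k)) u"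
  shows "approaches_along x0 u xs"
  unfolding approaches_along_def
proof (intro allI impI)
  fix \<epsilon> \<delta> :: real assume *: "\<epsilon> > 0" "\<delta> > 0"
  have "\<forall>\<^sub>F k in sequentially. inverse (real (Suc k)) < min \<epsilon> \<delta>"
    by (rule order_tendstoD(2)[OF LIMSEQ_inverse_real_of_nat]) (use * in simp)
  then show "\<forall>\<^sub>F k in sequentially. xs k \<in> (+) x0 ` dir_nbhd \<epsilon> \<delta> u"
  proof eventually_elim
    case (elim k)
    then show ?case
      using assms[of k] dir_nbhd_mono[of "inverse (real (Suc k))" \<epsilon> "inverse (real (Suc k))" \<delta> u] by auto
  qed
qed

lemma approaches_along_tendsto:
  assumes "approaches_along x0 u xs"
  shows "xs \<longlonglongrightarrow> x0"
proof (rule tendstoI)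
  fix e :: real assume e: "e > 0"
  have "\<forall>\<^sub>F k in sequentially. xs k \<in> (+) x0 ` dir_nbhd e 1 u"
    using assms e zero_less_one unfolding approaches_along_def by blast
  then show "\<forall>\<^sub>F k in sequentially. dist (xs k) x0 < e"
    by eventually_elim (auto simp: dir_nbhd_def dist_norm)
qed

lemma approaches_along_subseq:
  assumes "approaches_along x0 u xs" "strict_mono r"
  shows "approaches_along x0 u (xs \<circ> r)"
  using assms unfolding approaches_along_def o_def
  using eventually_subseq by blast

text \<open>A finite bound forces \<open>C\<close> to be nonempty, because the infimum over the
  empty set is infinite, and closedness makes the distance attained. Robinson stability thus yields
  feasible points.\<close>

lemma edist_to_le_ereal_iff:
  fixes y :: "'a::heine_borel"
  assumes "closed C"
  shows "edist_to y C \<le> ereal r \<longleftrightarrow> (\<exists>c\<in>C. dist y c \<le> r)"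
proof
  assume le: "edist_to y C \<le> ereal r"
  have "C \<noteq> {}" using le by (auto simp: edist_to_def top_ereal_def)
  then obtain c where c: "c \<in> C" "\<And>z. z \<in> C \<Longrightarrow> dist y c \<le> dist y z"
    using distance_attains_inf[OF assms] by metis
  have "ereal (dist y c) \<le> edist_to y C"
    unfolding edist_to_def by (rule INF_greatest) (use c in simp)
  then have "dist y c \<le> r" using le order_trans by fastforce
  then show "\<exists>c\<in>C. dist y c \<le> r" using c by blast
next
  assume "\<exists>c\<in>C. dist y c \<le> r"
  then obtain c where "c \<in> C" "dist y c \<le> r" by blast
  then have "edist_to y C \<le> ereal (dist y c)"
    unfolding edist_to_def by (intro INF_lower)
  also have "\<dots> \<le> ereal r" using \<open>dist y c \<le> r\<close> by simp
  finally show "edist_to y C \<le> ereal r" .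
qed

text \<open>The positive part is the displacement of \<open>v\<close> from its projection on the
  nonpositive orthant, and \<open>w\<close> is another point of that orthant.\<close>

lemma norm_pos_part_le:
  assumes "w \<le> 0"
  shows "norm (pos_part v) \<le> norm (v - w)"
proof (rule norm_le_componentwise_cart)
  fix i
  have "w $ i \<le> 0" using assms by (simp add: less_eq_vec_def)
  then show "norm (pos_part v $ i) \<le> norm ((v - w) $ i)" by (simp add: pos_part_def max_def)
qed

lemma value_fun_solution:
  assumes "y \<in> solutions f g x"
  shows "value_fun f g x = ereal (f (x, y))"
  unfolding value_fun_def using assms
  by (intro antisym INF_lower INF_greatest) (auto simp: solutions_def)

lemma value_fun_le: "y \<in> feasible g x \<Longrightarrow> value_fun f g x \<le> ereal (f (x, y))"
  unfolding value_fun_def by (rule INF_lower)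

context C1_program
begin

lemma closed_feasible: "closed (feasible g x)"
  using closed_feasible_eq[of "{}" x] by (simp add: feasible_eq_def)

lemma robinson_stableD:
  assumes "robinson_stable g x0 y0 u"
  obtains \<kappa> \<epsilon> \<delta> where "\<kappa> > 0" "\<epsilon> > 0" "\<delta> > 0"
    "\<forall>x \<in> (+) x0 ` dir_nbhd \<epsilon> \<delta> u. \<forall>y \<in> ball y0 \<epsilon>.
       \<exists>y'\<in>feasible g x. norm (y - y') \<le> \<kappa> * norm (pos_part (g (x, y)))"
  using assms unfolding robinson_stable_def edist_to_le_ereal_iff[OF closed_feasible] dist_norm
  by metis

lemma residual_le_pos_part: "residual {} z \<le> real CARD('p) * norm (pos_part (g z))"
proof -
  have "residual {} z = (\<Sum>i\<in>UNIV. pos_part (g z) $ i)"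
    by (simp add: residual_def pos_part_def)
  also have "\<dots> \<le> (\<Sum>i\<in>(UNIV::'p set). norm (pos_part (g z)))"
    by (rule sum_mono) (meson abs_ge_self component_le_norm_cart order_trans)
  finally show ?thesis by simp
qed

text \<open>The point \<open>(x, y)\<close> has no violation, so the residual is controlled by the
  variation of \<open>g\<close>; this turns the error bound into an estimate linear in the change of
  the parameter.\<close>

lemma residual_le_diff:
  assumes "y \<in> feasible_eq J x"
  shows "residual J z \<le> real CARD('p) * norm (g z - g (x, y))"
proof -
  have "residual J z \<le> (\<Sum>i\<in>(UNIV::'p set). norm (g z - g (x, y)))"
    unfolding residual_def
  proof (rule sum_mono)
    fix i
    have "g (x, y) $ i \<le> 0" "i \<in> J \<Longrightarrow> g (x, y) $ i = 0"
      using assms by (auto simp: feasible_eq_def feasible_iff)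
    then have "(if i \<in> J then \<bar>g z $ i\<bar> else max 0 (g z $ i)) \<le> \<bar>(g z - g (x, y)) $ i\<bar>"
      by (auto simp: max_def)
    also have "\<dots> \<le> norm (g z - g (x, y))" by (rule component_le_norm_cart)
    finally show "(if i \<in> J then \<bar>g z $ i\<bar> else max 0 (g z $ i)) \<le> norm (g z - g (x, y))" .
  qed
  then show ?thesis by simp
qed

text \<open>The case \<open>J = {}\<close> of the error bound; \<open>near\<close> supplies the
  solvability that the bound presupposes.\<close>

lemma robinson_stable_from_RCR:
  assumes rcr: "rcr_regular g x0 y0" and feas: "y0 \<in> feasible g x0"
    and near: "\<And>\<eta>. \<eta> > 0 \<Longrightarrow> \<exists>\<epsilon>>0. \<exists>\<delta>>0. \<forall>x \<in> (+) x0 ` dir_nbhd \<epsilon> \<delta> u. feasible g x \<inter> ball y0 \<eta> \<noteq> {}"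
  shows "robinson_stable g x0 y0 u"
proof -
  obtain \<kappa> \<rho> where \<kappa>: "\<kappa> > 0" "\<rho> > 0"
    and eb: "\<And>J x y. J \<subseteq> active g x0 y0 \<Longrightarrow> x \<in> ball x0 \<rho> \<Longrightarrow> y \<in> ball y0 \<rho>
       \<Longrightarrow> feasible_eq J x \<inter> ball y0 \<rho> \<noteq> {}
       \<Longrightarrow> \<exists>y'\<in>feasible_eq J x. norm (y - y') \<le> \<kappa> * residual J (x, y)"
    using RCR_error_bound[OF rcr feas] by blast
  obtain \<epsilon> \<delta> where \<epsilon>: "\<epsilon> > 0" "\<delta> > 0"
    and ne: "\<forall>x \<in> (+) x0 ` dir_nbhd \<epsilon> \<delta> u. feasible g x \<inter> ball y0 \<rho> \<noteq> {}"
    using near[OF \<kappa>(2)] by blast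
  define \<epsilon>' where "\<epsilon>' = min \<epsilon> \<rho>"
  have "edist_to y (feasible g x) \<le> ereal ((\<kappa> * real CARD('p)) * norm (pos_part (g (x, y))))"
    if x: "x \<in> (+) x0 ` dir_nbhd \<epsilon>' \<delta> u" and y: "y \<in> ball y0 \<epsilon>'" for x y
  proof -
    have "x \<in> (+) x0 ` dir_nbhd \<epsilon> \<delta> u"
      using x dir_nbhd_mono[of \<epsilon>' \<epsilon> \<delta> \<delta> u] by (auto simp: \<epsilon>'_def)
    then have "feasible_eq {} x \<inter> ball y0 \<rho> \<noteq> {}" using ne by (auto simp: feasible_eq_def)
    moreover have "x \<in> ball x0 \<rho>" using x by (auto simp: dir_nbhd_def \<epsilon>'_def dist_norm)
    ultimately obtain y' where "y' \<in> feasible_eq {} x" "norm (y - y') \<le> \<kappa> * residual {} (x, y)"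
      using eb[of "{}" x y] y by (auto simp: \<epsilon>'_def)
    moreover have "\<kappa> * residual {} (x, y) \<le> \<kappa> * (real CARD('p) * norm (pos_part (g (x, y))))"
      using residual_le_pos_part \<kappa> by (intro mult_left_mono) auto
    ultimately show ?thesis
      unfolding edist_to_le_ereal_iff[OF closed_feasible]
      by (intro bexI[of _ y']) (auto simp: feasible_eq_def dist_norm)
  qed
  moreover have "\<epsilon>' > 0" "\<kappa> * real CARD('p) > 0" using \<epsilon> \<kappa> by (auto simp: \<epsilon>'_def)
  ultimately show ?thesis unfolding robinson_stable_def using \<epsilon>(2) by blast
qed

end

text \<open>The set \<open>T\<close> collects the limits of solutions along the direction \<open>u\<close>: it is
  \<open>S(x0) \<inter> \<Omega>\<close> under restricted inf-compactness and \<open>{y0}\<close> under inner semi-continuity.\<close>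

locale directional_program = C1_program f g f' g'
  for f :: "(real^'n) \<times> (real^'m) \<Rightarrow> real" and g :: "(real^'n) \<times> (real^'m) \<Rightarrow> real^'p"
    and f' g' +
  fixes x0 u :: "real^'n" and T :: "(real^'m) set"
  assumes T_solutions: "T \<subseteq> solutions f g x0"
    and T_RCR: "y \<in> T \<Longrightarrow> rcr_regular g x0 y"
    and T_RS: "y \<in> T \<Longrightarrow> robinson_stable g x0 y u"
    and solutions_accumulate: "approaches_along x0 u xs \<Longrightarrow>
      \<exists>r ys y. strict_mono (r :: nat \<Rightarrow> nat) \<and> y \<in> T \<and> (\<forall>k. ys k \<in> solutions f g (xs (r k))) \<and> ys \<longlonglongrightarrow> y"
begin

abbreviation "V \<equiv> value_fun f g"
abbreviation "Vr x \<equiv> real_of_ereal (V x)"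

lemma Vr_solution: "y \<in> solutions f g x \<Longrightarrow> Vr x = f (x, y)"
  by (simp add: value_fun_solution)

lemma Vr_le: "y \<in> solutions f g x \<Longrightarrow> y' \<in> feasible g x \<Longrightarrow> Vr x \<le> f (x, y')"
  by (simp add: Vr_solution solutions_def)

lemma solvable_nearby:
  obtains \<epsilon> \<delta> where "\<epsilon> > 0" "\<delta> > 0" "\<forall>x \<in> (+) x0 ` dir_nbhd \<epsilon> \<delta> u. solutions f g x \<noteq> {}"
proof (rule ccontr)
  assume "\<not> thesis"
  with that have "\<forall>\<epsilon>>0. \<forall>\<delta>>0. \<exists>x \<in> (+) x0 ` dir_nbhd \<epsilon> \<delta> u. solutions f g x = {}" by blast
  then have "\<forall>k. \<exists>x \<in> (+) x0 ` dir_nbhd (inverse (Suc k)) (inverse (Suc k)) u. solutions f g x = {}"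
    by simp
  then obtain xs where xs: "\<And>k. xs k \<in> (+) x0 ` dir_nbhd (inverse (Suc k)) (inverse (Suc k)) u"
    "\<And>k. solutions f g (xs k) = {}" by metis
  show False
    using solutions_accumulate[OF approaches_along_inverse[OF xs(1)]] xs(2) by blast
qed

text \<open>The stability constants depend on the limit solution. In the argument by contradiction,
  pairs of parameters with unbounded quotients single out one \<open>yt\<close>, and its constants
  bound those quotients after all.\<close>

lemma value_Lipschitz:
  obtains L \<epsilon> \<delta> where "L > 0" "\<epsilon> > 0" "\<delta> > 0"
    "\<forall>x \<in> (+) x0 ` dir_nbhd \<epsilon> \<delta> u. solutions f g x \<noteq> {}"
    "\<forall>x \<in> (+) x0 ` dir_nbhd \<epsilon> \<delta> u. \<forall>x' \<in> (+) x0 ` dir_nbhd \<epsilon> \<delta> u. \<bar>Vr x - Vr x'\<bar> \<le> L * norm (x - x')"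
proof -
  obtain \<epsilon>0 \<delta>0 where e0: "\<epsilon>0 > 0" "\<delta>0 > 0"
    and solvable: "\<forall>x \<in> (+) x0 ` dir_nbhd \<epsilon>0 \<delta>0 u. solutions f g x \<noteq> {}"
    by (rule solvable_nearby)
  have "\<exists>L>0. \<exists>\<epsilon>>0. \<exists>\<delta>>0. \<forall>x \<in> (+) x0 ` dir_nbhd \<epsilon> \<delta> u. \<forall>x' \<in> (+) x0 ` dir_nbhd \<epsilon> \<delta> u.
      Vr x' - Vr x \<le> L * norm (x - x')"
  proof (rule ccontr)
    assume "\<not> ?thesis"
    then have no: "\<exists>x \<in> (+) x0 ` dir_nbhd \<epsilon> \<delta> u. \<exists>x' \<in> (+) x0 ` dir_nbhd \<epsilon> \<delta> u. Vr x' - Vr x > L * norm (x - x')"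
      if "L > 0" "\<epsilon> > 0" "\<delta> > 0" for L \<epsilon> \<delta>
      using that by (meson not_le)
    have "\<forall>k. \<exists>x x'. x \<in> (+) x0 ` dir_nbhd (inverse (Suc k)) (inverse (Suc k)) u
       \<and> x' \<in> (+) x0 ` dir_nbhd (inverse (Suc k)) (inverse (Suc k)) u
       \<and> Vr x' - Vr x > real (Suc k) * norm (x - x')"
    proof
      fix k
      show "\<exists>x x'. x \<in> (+) x0 ` dir_nbhd (inverse (Suc k)) (inverse (Suc k)) u
       \<and> x' \<in> (+) x0 ` dir_nbhd (inverse (Suc k)) (inverse (Suc k)) u
       \<and> Vr x' - Vr x > real (Suc k) * norm (x - x')"
        using no[of "real (Suc k)" "inverse (Suc k)" "inverse (Suc k)"] by auto
    qed
    then obtain xs xs' where xs: "\<And>k. xs k \<in> (+) x0 ` dir_nbhd (inverse (Suc k)) (inverse (Suc k)) u"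
      and xs': "\<And>k. xs' k \<in> (+) x0 ` dir_nbhd (inverse (Suc k)) (inverse (Suc k)) u"
      and big: "\<And>k. Vr (xs' k) - Vr (xs k) > real (Suc k) * norm (xs k - xs' k)"
      by metis
    note ap = approaches_along_inverse[OF xs] and ap' = approaches_along_inverse[OF xs']
    obtain r ys yt where r: "strict_mono r" and yt: "yt \<in> T"
      and ys: "\<And>k. ys k \<in> solutions f g (xs (r k))" "ys \<longlonglongrightarrow> yt"
      using solutions_accumulate[OF ap] by blast
    obtain \<kappa> \<epsilon> \<delta> where \<kappa>: "\<kappa> > 0" "\<epsilon> > 0" "\<delta> > 0"
      and RS: "\<forall>x \<in> (+) x0 ` dir_nbhd \<epsilon> \<delta> u. \<forall>y \<in> ball yt \<epsilon>.
         \<exists>y'\<in>feasible g x. norm (y - y') \<le> \<kappa> * norm (pos_part (g (x, y)))"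
      by (rule robinson_stableD[OF T_RS[OF yt]])
    obtain \<rho>g Lg where Lg: "\<rho>g > 0" "Lg > 0" and g_lip: "\<And>p q. p \<in> ball (x0, yt) \<rho>g \<Longrightarrow> q \<in> ball (x0, yt) \<rho>g
       \<Longrightarrow> norm (g p - g q) \<le> Lg * norm (p - q)"
      using C1_local_Lipschitz[OF g_deriv g'_cont, where z = "(x0, yt)"] by blast
    obtain \<rho>f Lf where Lf: "\<rho>f > 0" "Lf > 0" and f_lip: "\<And>p q. p \<in> ball (x0, yt) \<rho>f \<Longrightarrow> q \<in> ball (x0, yt) \<rho>f
       \<Longrightarrow> norm (f p - f q) \<le> Lf * norm (p - q)"
      using C1_local_Lipschitz[OF f_deriv f'_cont, where z = "(x0, yt)"] by blast
    define X where "X = (\<lambda>k. xs (r k))"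
    define X' where "X' = (\<lambda>k. xs' (r k))"
    have X: "X \<longlonglongrightarrow> x0" and X': "X' \<longlonglongrightarrow> x0"
      using approaches_along_tendsto[OF ap] approaches_along_tendsto[OF ap'] LIMSEQ_subseq_LIMSEQ[OF _ r]
      unfolding X_def X'_def o_def by auto
    \<comment> \<open>The second membership guards against the value 0 that
      \<open>real_of_ereal\<close> gives to infinities: at \<open>X' k\<close> a solution exists and
      \<open>Vr\<close> is the true value.\<close>
    have dom: "\<forall>\<^sub>F k in sequentially. X' k \<in> (+) x0 ` dir_nbhd \<epsilon> \<delta> u"
        "\<forall>\<^sub>F k in sequentially. X' k \<in> (+) x0 ` dir_nbhd \<epsilon>0 \<delta>0 u"
      using approaches_along_subseq[OF ap' r] \<kappa> e0 unfolding approaches_along_def X'_def o_def by blast+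
    have limB: "\<forall>\<^sub>F k in sequentially. (Z k, W k) \<in> ball (x0, yt) e"
      if "Z \<longlonglongrightarrow> x0" "W \<longlonglongrightarrow> yt" "e > 0" for Z W e
      using tendsto_Pair[OF that(1,2)] that(3) by (auto simp: tendsto_iff dist_commute)
    \<comment> \<open>The solution at \<open>X k\<close> is repaired to be feasible at
      \<open>X' k\<close>, at a cost proportional to the distance of the two parameters.\<close>
    have "\<forall>\<^sub>F k in sequentially. \<exists>y'. y' \<in> feasible g (X' k) \<and> norm (ys k - y') \<le> \<kappa> * Lg * norm (X k - X' k)"
      using dom(1) limB[OF X ys(2) Lg(1)] limB[OF X' ys(2) Lg(1)] tendstoD[OF ys(2) \<kappa>(2)]
    proof eventually_elim
      case (elim k)
      then obtain y' where y': "y' \<in> feasible g (X' k)" "norm (ys k - y') \<le> \<kappa> * norm (pos_part (g (X' k, ys k)))"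
        using RS by (force simp: dist_commute)
      have "g (X k, ys k) \<le> 0" using ys(1)[of k] by (simp add: solutions_def feasible_def X_def)
      then have "norm (pos_part (g (X' k, ys k))) \<le> norm (g (X' k, ys k) - g (X k, ys k))"
        by (rule norm_pos_part_le)
      also have "\<dots> \<le> Lg * norm ((X' k, ys k) - (X k, ys k))" using g_lip elim by blast
      also have "\<dots> = Lg * norm (X k - X' k)" by (simp add: norm_Pair norm_minus_commute)
      finally have "\<kappa> * norm (pos_part (g (X' k, ys k))) \<le> \<kappa> * (Lg * norm (X k - X' k))"
        using \<kappa> by (intro mult_left_mono) auto
      then show ?case using y' by (auto simp: mult.assoc)
    qed
    then obtain y' where y': "\<forall>\<^sub>F k in sequentially. y' k \<in> feasible g (X' k)
        \<and> norm (ys k - y' k) \<le> \<kappa> * Lg * norm (X k - X' k)"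
      unfolding eventually_ex by blast
    have "(\<lambda>k. y' k - ys k) \<longlonglongrightarrow> 0"
    proof (rule Lim_null_comparison)
      show "\<forall>\<^sub>F k in sequentially. norm (y' k - ys k) \<le> \<kappa> * Lg * norm (X k - X' k)"
        using y' by eventually_elim (simp add: norm_minus_commute)
      have "(\<lambda>k. \<kappa> * Lg * norm (X k - X' k)) \<longlonglongrightarrow> \<kappa> * Lg * norm (x0 - x0)"
        by (intro tendsto_intros X X')
      then show "(\<lambda>k. \<kappa> * Lg * norm (X k - X' k)) \<longlonglongrightarrow> 0" by simp
    qed
    then have y'lim: "y' \<longlonglongrightarrow> yt"
      using tendsto_add[OF _ ys(2), of "\<lambda>k. y' k - ys k" 0] by simp
    define M where "M = Lf * (1 + \<kappa> * Lg)"
    have "\<forall>\<^sub>F k in sequentially. real k > M"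
      using filterlim_real_sequentially filterlim_at_top_dense by blast
    then have "\<forall>\<^sub>F k in sequentially. False"
      using y' dom(2) limB[OF X ys(2) Lf(1)] limB[OF X' y'lim Lf(1)]
    proof eventually_elim
      case (elim k)
      define n where "n = norm (X k - X' k)"
      have "Vr (X' k) \<le> f (X' k, y' k)"
        using elim solvable Vr_le by blast
      moreover have "Vr (X k) = f (X k, ys k)" using ys(1) unfolding X_def by (rule Vr_solution)
      moreover have "f (X' k, y' k) - f (X k, ys k) \<le> Lf * norm ((X' k, y' k) - (X k, ys k))"
        using f_lip[of "(X' k, y' k)" "(X k, ys k)"] elim by auto
      moreover have "Lf * norm ((X' k, y' k) - (X k, ys k)) \<le> Lf * (n + \<kappa> * Lg * n)"
      proof (rule mult_left_mono)
        have "norm ((X' k, y' k) - (X k, ys k)) \<le> norm (X' k - X k) + norm (y' k - ys k)"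
          by (simp add: norm_Pair sqrt_sum_squares_le_sum)
        also have "\<dots> \<le> n + \<kappa> * Lg * n"
          using elim by (simp add: n_def norm_minus_commute)
        finally show "norm ((X' k, y' k) - (X k, ys k)) \<le> n + \<kappa> * Lg * n" .
      qed (use Lf in simp)
      ultimately have "Vr (X' k) - Vr (X k) \<le> M * n" by (simp add: M_def algebra_simps)
      moreover have "Vr (X' k) - Vr (X k) > real (Suc (r k)) * n"
        using big[of "r k"] by (simp add: X_def X'_def n_def)
      moreover have "M * n \<le> real (Suc (r k)) * n"
      proof (rule mult_right_mono)
        show "M \<le> real (Suc (r k))" using elim(1) seq_suble[OF r, of k] by linarith
      qed (simp add: n_def)
      ultimately show False by linarith
    qed
    then show False by simp
  qed
  then obtain L \<epsilon> \<delta> where L: "L > 0" "\<epsilon> > 0" "\<delta> > 0"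
    and lip: "\<forall>x \<in> (+) x0 ` dir_nbhd \<epsilon> \<delta> u. \<forall>x' \<in> (+) x0 ` dir_nbhd \<epsilon> \<delta> u. Vr x' - Vr x \<le> L * norm (x - x')"
    by blast
  define \<epsilon>' \<delta>' where "\<epsilon>' = min \<epsilon> \<epsilon>0" and "\<delta>' = min \<delta> \<delta>0"
  have sub: "(+) x0 ` dir_nbhd \<epsilon>' \<delta>' u \<subseteq> (+) x0 ` dir_nbhd \<epsilon> \<delta> u"
       "(+) x0 ` dir_nbhd \<epsilon>' \<delta>' u \<subseteq> (+) x0 ` dir_nbhd \<epsilon>0 \<delta>0 u"
    by (intro image_mono dir_nbhd_mono; simp add: \<epsilon>'_def \<delta>'_def)+
  show thesis
  proof (rule that[OF L(1)])
    show "\<epsilon>' > 0" "\<delta>' > 0" using L e0 by (auto simp: \<epsilon>'_def \<delta>'_def)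
    show "\<forall>x \<in> (+) x0 ` dir_nbhd \<epsilon>' \<delta>' u. solutions f g x \<noteq> {}" using sub solvable by blast
    show "\<forall>x \<in> (+) x0 ` dir_nbhd \<epsilon>' \<delta>' u. \<forall>x' \<in> (+) x0 ` dir_nbhd \<epsilon>' \<delta>' u. \<bar>Vr x - Vr x'\<bar> \<le> L * norm (x - x')"
    proof (intro ballI)
      fix x x' assume "x \<in> (+) x0 ` dir_nbhd \<epsilon>' \<delta>' u" "x' \<in> (+) x0 ` dir_nbhd \<epsilon>' \<delta>' u"
      then have "Vr x' - Vr x \<le> L * norm (x - x')" "Vr x - Vr x' \<le> L * norm (x' - x)"
        using lip sub(1) by blast+
      then show "\<bar>Vr x - Vr x'\<bar> \<le> L * norm (x - x')"
        by (simp add: norm_minus_commute)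
    qed
  qed
qed

lemma dir_lipschitz_value: "dir_lipschitz V x0 u"
proof -
  obtain L \<epsilon> \<delta> where L: "L > 0" "\<epsilon> > 0" "\<delta> > 0"
    and sol: "\<forall>x \<in> (+) x0 ` dir_nbhd \<epsilon> \<delta> u. solutions f g x \<noteq> {}"
    and lip: "\<forall>x \<in> (+) x0 ` dir_nbhd \<epsilon> \<delta> u. \<forall>x' \<in> (+) x0 ` dir_nbhd \<epsilon> \<delta> u. \<bar>Vr x - Vr x'\<bar> \<le> L * norm (x - x')"
    by (rule value_Lipschitz)
  have V: "V x = ereal (Vr x)" if "x \<in> (+) x0 ` dir_nbhd \<epsilon> \<delta> u" for x
    using sol that value_fun_solution by fastforce
  have fin: "\<bar>V x\<bar> \<noteq> \<infinity>" if "x \<in> (+) x0 ` dir_nbhd \<epsilon> \<delta> u" for x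
    by (subst V[OF that]) simp
  have lipV: "\<bar>V x - V x'\<bar> \<le> ereal (L * norm (x - x'))"
    if "x \<in> (+) x0 ` dir_nbhd \<epsilon> \<delta> u" "x' \<in> (+) x0 ` dir_nbhd \<epsilon> \<delta> u" for x x'
    using bspec[OF bspec[OF lip that(1)] that(2)]
    by (subst V[OF that(1)], subst V[OF that(2)]) simp
  show ?thesis unfolding dir_lipschitz_def
    by (intro exI[of _ L] exI[of _ \<epsilon>] exI[of _ \<delta>] conjI ballI fin lipV L)
qed

end

section \<open>Regular subgradients and multipliers\<close>

text \<open>Trades the remainder for an arbitrary \<open>\<eta>\<close>. The filter
  \<open>nhds\<close> includes \<open>x\<close> itself, so rays that stay at \<open>x\<close> are
  covered too.\<close>

lemma regular_subdiff_lower_bound: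
  assumes "\<xi> \<in> regular_subdiff V x" "\<eta> > 0"
  shows "\<forall>\<^sub>F x' in nhds x. V x' \<ge> V x + ereal (\<xi> \<bullet> (x' - x) - \<eta> * norm (x' - x))"
proof -
  obtain r where r: "r \<in> o[at x](\<lambda>x'. norm (x' - x))"
    and lb: "\<forall>\<^sub>F x' in at x. V x' \<ge> V x + ereal (\<xi> \<bullet> (x' - x) + r x')"
    using assms(1) unfolding regular_subdiff_def by blast
  have "\<forall>\<^sub>F x' in at x. norm (r x') \<le> \<eta> * norm (norm (x' - x))"
    using landau_o.smallD[OF r assms(2)] .
  with lb have "\<forall>\<^sub>F x' in at x. V x' \<ge> V x + ereal (\<xi> \<bullet> (x' - x) - \<eta> * norm (x' - x))"
  proof eventually_elim
    case (elim x')
    have "ereal (\<xi> \<bullet> (x' - x) - \<eta> * norm (x' - x)) \<le> ereal (\<xi> \<bullet> (x' - x) + r x')"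
      using elim(2) by (simp add: abs_le_iff)
    then have "V x + ereal (\<xi> \<bullet> (x' - x) - \<eta> * norm (x' - x)) \<le> V x + ereal (\<xi> \<bullet> (x' - x) + r x')"
      by (rule add_left_mono)
    then show ?case using elim(1) order_trans by blast
  qed
  then show ?thesis by (simp add: eventually_nhds_conv_at)
qed

text \<open>A proximal subgradient is regular, the quadratic term being of smaller order than the
  distance.\<close>

lemma regular_subdiff_quadraticI:
  assumes fin: "\<bar>V p\<bar> \<noteq> \<infinity>"
    and lb: "\<forall>\<^sub>F x in at p. V x \<ge> V p + ereal (\<xi> \<bullet> (x - p) - c * (norm (x - p))\<^sup>2)"
  shows "\<xi> \<in> regular_subdiff V p"
proof -
  have "(\<lambda>x. - (c * (norm (x - p))\<^sup>2)) \<in> o[at p](\<lambda>x. norm (x - p))"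
  proof (rule landau_o.smallI)
    fix e :: real assume e: "e > 0"
    have "((\<lambda>x. \<bar>c\<bar> * norm (x - p)) \<longlongrightarrow> \<bar>c\<bar> * norm (p - p)) (at p)"
      by (intro tendsto_intros)
    then have "\<forall>\<^sub>F x in at p. \<bar>c\<bar> * norm (x - p) < e" using e by (simp add: order_tendstoD(2))
    then show "\<forall>\<^sub>F x in at p. norm (- (c * (norm (x - p))\<^sup>2)) \<le> e * norm (norm (x - p))"
    proof eventually_elim
      case (elim x)
      have "\<bar>c\<bar> * norm (x - p) * norm (x - p) \<le> e * norm (x - p)"
        using elim by (intro mult_right_mono) auto
      then show ?case by (simp add: abs_mult power2_eq_square mult.assoc)
    qed
  qed
  then show ?thesis
    unfolding regular_subdiff_def using fin lb by (auto intro!: exI[of _ "\<lambda>x. - (c * (norm (x - p))\<^sup>2)"])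
qed

text \<open>An exact-penalty form of Farkas' lemma; the penalty parameter bounds the multipliers.\<close>

lemma bounded_multipliers:
  fixes \<phi> :: "'z::euclidean_space \<Rightarrow> real" and \<psi> :: "'p::finite \<Rightarrow> 'z \<Rightarrow> real"
  assumes lin: "linear \<phi>" "\<And>i. linear (\<psi> i)" and M: "M \<ge> 0"
    and nonneg: "\<And>d. \<phi> d + M * (\<Sum>i\<in>A. max 0 (\<psi> i d)) \<ge> 0"
  obtains l :: "real^'p" where "\<forall>i. 0 \<le> l$i \<and> l$i \<le> M" "\<forall>i. i \<notin> A \<longrightarrow> l$i = 0"
    "\<forall>d. \<phi> d + (\<Sum>i\<in>UNIV. l$i * \<psi> i d) = 0"
proof -
  \<comment> \<open>\<open>c\<close> and \<open>G i\<close> represent the linear forms by inner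
    products; the claim becomes \<open>c + h l = 0\<close> for some \<open>l\<close> in the box
    \<open>B\<close>.\<close>
  define c where "c = adjoint \<phi> 1"
  define G where "G = (\<lambda>i. adjoint (\<psi> i) 1)"
  have c: "c \<bullet> d = \<phi> d" and G: "G i \<bullet> d = \<psi> i d" for i d
    using adjoint_works[OF lin(1), of d 1] adjoint_works[OF lin(2)[of i], of d 1]
    by (simp_all add: c_def G_def inner_commute)
  define h where "h = (\<lambda>l::real^'p. \<Sum>i\<in>UNIV. l$i *\<^sub>R G i)"
  define B where "B = cbox 0 (\<chi> i. if i \<in> A then M else (0::real))"
  have h: "bounded_linear h"
    unfolding h_def by (intro bounded_linear_sum bounded_linear_scaleR_const bounded_linear_vec_nth)
  have ip: "(c + h l) \<bullet> d = \<phi> d + (\<Sum>i\<in>UNIV. l$i * \<psi> i d)" for l d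
    by (simp add: inner_add_left c h_def inner_sum_left G)
  have "0 \<in> (\<lambda>l. c + h l) ` B"
  proof (rule ccontr)
    assume "0 \<notin> (\<lambda>l. c + h l) ` B"
    moreover have "convex ((\<lambda>l. c + h l) ` B)"
      using convex_translation[OF convex_linear_image[OF bounded_linear.linear[OF h]], of B c]
      by (simp add: B_def image_image)
    moreover have "compact ((\<lambda>l. c + h l) ` B)"
      unfolding B_def
      by (intro compact_continuous_image continuous_intros linear_continuous_on h) simp
    ultimately obtain a b where ab: "a \<bullet> 0 < b" "\<forall>x\<in>(\<lambda>l. c + h l) ` B. a \<bullet> x > b"
      using separating_hyperplane_closed_point compact_imp_closed by metis
    \<comment> \<open>The vertex of the box that maximises the multiplier sum at \<open>- a\<close>;
      there the sum equals the penalty term, and separation contradicts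
      \<open>nonneg\<close>.\<close>
    define l where "l = (\<chi> i. if i \<in> A \<and> \<psi> i (- a) > 0 then M else 0)"
    have "l \<in> B" using M by (auto simp: B_def mem_box_cart l_def)
    then have "a \<bullet> (c + h l) > 0" using ab by force
    then have "(c + h l) \<bullet> (- a) < 0" by (simp add: inner_commute)
    then have "\<phi> (- a) + (\<Sum>i\<in>UNIV. l$i * \<psi> i (- a)) < 0" by (simp only: ip)
    moreover have "(\<Sum>i\<in>UNIV. l$i * \<psi> i (- a)) = (\<Sum>i\<in>A. M * max 0 (\<psi> i (- a)))"
      by (rule sum.mono_neutral_cong_right) (auto simp: l_def max_def)
    ultimately show False using nonneg[of "- a"] by (simp add: sum_distrib_left)
  qed
  then obtain l where l: "l \<in> B" "c + h l = 0" by auto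
  show thesis
  proof (rule that)
    show "\<forall>i. 0 \<le> l$i \<and> l$i \<le> M" "\<forall>i. i \<notin> A \<longrightarrow> l$i = 0"
      using l(1) M by (auto simp: B_def mem_box_cart split: if_splits intro: antisym)
    show "\<forall>d. \<phi> d + (\<Sum>i\<in>UNIV. l$i * \<psi> i d) = 0" by (simp flip: ip add: l(2))
  qed
qed

context C1_program
begin

text \<open>Following the ray and then repairing feasibility moves the decision variable by at most
  \<open>\<kappa>\<close> times the violation, which costs the objective
  \<open>Lf * \<kappa>\<close> times the violation. To first order only active constraints are
  violated.\<close>

lemma feasible_ray_estimate:
  assumes feas: "y \<in> feasible g x" and \<kappa>: "\<kappa> > 0"
    and eb: "\<forall>\<^sub>F s in at_right 0. \<exists>y'\<in>feasible g (x + s *\<^sub>R a).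
        norm (y + s *\<^sub>R b - y') \<le> \<kappa> * norm (pos_part (g (x + s *\<^sub>R a, y + s *\<^sub>R b)))"
    and \<rho>: "\<rho> > 0" and Lf: "Lf > 0"
    and lip: "\<And>p q. p \<in> ball (x, y) \<rho> \<Longrightarrow> q \<in> ball (x, y) \<rho> \<Longrightarrow> norm (f p - f q) \<le> Lf * norm (p - q)"
    and \<eta>: "\<eta> > 0"
  shows "\<forall>\<^sub>F s in at_right 0. \<exists>y'\<in>feasible g (x + s *\<^sub>R a). f (x + s *\<^sub>R a, y') \<le> f (x, y) +
      s * (f' (x, y) (a, b) + Lf * \<kappa> * (\<Sum>i\<in>active g x y. max 0 (g' (x, y) (a, b) $ i)) + \<eta>)"
proof -
  define z where "z = (x, y)"
  define d where "d = (a, b)"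
  define p where "p = (\<lambda>s. z + s *\<^sub>R d)"
  define P where "P = (\<lambda>s. \<Sum>i\<in>UNIV. max 0 (g (p s) $ i) / s)"
  define S where "S = (\<Sum>i\<in>active g x y. max 0 (g' z d $ i))"
  have pos: "\<forall>\<^sub>F s in at_right (0::real). s > 0" by (rule eventually_at_right_less)
  have "(p \<longlongrightarrow> z + 0 *\<^sub>R d) (at_right 0)" unfolding p_def by (intro tendsto_intros)
  then have p: "(p \<longlongrightarrow> z) (at_right 0)" by simp
  have quot: "((\<lambda>s. (p s - z) /\<^sub>R s) \<longlongrightarrow> d) (at_right 0)"
    by (rule tendsto_eventually, use pos in eventually_elim) (simp add: p_def)
  have fq: "((\<lambda>s. (f (p s) - f z) /\<^sub>R s) \<longlongrightarrow> f' z d) (at_right 0)"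
    by (rule C1_difference_quotient[OF f_deriv f'_cont pos p tendsto_const quot])
  have gq: "((\<lambda>s. (g (p s) - g z) /\<^sub>R s) \<longlongrightarrow> g' z d) (at_right 0)"
    by (rule C1_difference_quotient[OF g_deriv g'_cont pos p tendsto_const quot])
  have "(P \<longlongrightarrow> (\<Sum>i\<in>UNIV. if i \<in> active g x y then max 0 (g' z d $ i) else 0)) (at_right 0)"
    unfolding P_def
  proof (rule tendsto_sum)
    fix i
    show "((\<lambda>s. max 0 (g (p s) $ i) / s) \<longlongrightarrow> (if i \<in> active g x y then max 0 (g' z d $ i) else 0)) (at_right 0)"
    proof (cases "i \<in> active g x y")
      case True
      then have gz: "g z $ i = 0" by (simp add: active_def z_def)
      have "((\<lambda>s. max 0 (((g (p s) - g z) /\<^sub>R s) $ i)) \<longlongrightarrow> max 0 (g' z d $ i)) (at_right 0)"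
        by (intro tendsto_max tendsto_const tendsto_vec_nth gq)
      then have "((\<lambda>s. max 0 (g (p s) $ i) / s) \<longlongrightarrow> max 0 (g' z d $ i)) (at_right 0)"
        by (rule Lim_transform_eventually, use pos in eventually_elim)
           (auto simp: gz max_def divide_inverse mult.commute mult_le_0_iff zero_le_mult_iff)
      then show ?thesis using True by simp
    next
      case False
      then have "g z $ i < 0" using feas by (simp add: active_def z_def feasible_iff order_less_le)
      then have "\<forall>\<^sub>F s in at_right 0. g (p s) $ i < 0"
        using order_tendstoD(2)[OF tendsto_g[OF p]] by blast
      then have "\<forall>\<^sub>F s in at_right 0. max 0 (g (p s) $ i) / s = 0" by eventually_elim simp
      then show ?thesis using False by (simp add: tendsto_eventually)
    qed
  qed
  then have Plim: "(P \<longlongrightarrow> S) (at_right 0)" by (simp add: S_def sum.If_cases)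
  \<comment> \<open>Makes \<open>Lf * \<kappa> * \<eta>'\<close> equal to \<open>\<eta> / 2\<close>;
    the other half pays for linearising \<open>f\<close>.\<close>
  define \<eta>' where "\<eta>' = \<eta> / (2 * (Lf * \<kappa>))"
  have \<eta>': "\<eta>' > 0" using \<eta> Lf \<kappa> by (simp add: \<eta>'_def)
  have evP: "\<forall>\<^sub>F s in at_right 0. P s < S + \<eta>'" using order_tendstoD(2)[OF Plim] \<eta>' by simp
  have evf: "\<forall>\<^sub>F s in at_right 0. (f (p s) - f z) /\<^sub>R s < f' z d + \<eta> / 2"
    using order_tendstoD(2)[OF fq] \<eta> by simp
  \<comment> \<open>Keeps the point on the ray and its repaired version inside the ball where
    \<open>f\<close> is Lipschitz.\<close>
  have "((\<lambda>s. dist (p s) z + \<kappa> * (s * (S + \<eta>'))) \<longlongrightarrow> dist z z + \<kappa> * (0 * (S + \<eta>'))) (at_right 0)"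
    by (intro tendsto_intros p)
  then have evB: "\<forall>\<^sub>F s in at_right 0. dist (p s) z + \<kappa> * (s * (S + \<eta>')) < \<rho>"
    using order_tendstoD(2) \<rho> by force
  show ?thesis
    using pos eb evP evf evB
  proof eventually_elim
    case (elim s)
    have ps: "p s = (x + s *\<^sub>R a, y + s *\<^sub>R b)" by (simp add: p_def z_def d_def)
    obtain y' where y': "y' \<in> feasible g (x + s *\<^sub>R a)"
      "norm (y + s *\<^sub>R b - y') \<le> \<kappa> * norm (pos_part (g (p s)))"
      using elim(2) unfolding ps by blast
    have "norm (pos_part (g (p s))) \<le> (\<Sum>i\<in>UNIV. \<bar>pos_part (g (p s)) $ i\<bar>)" by (rule norm_le_l1_cart)
    also have "\<dots> = s * P s" using elim(1) by (simp add: P_def sum_distrib_left pos_part_def)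
    also have "\<dots> \<le> s * (S + \<eta>')" using elim(1,3) by simp
    finally have "\<kappa> * norm (pos_part (g (p s))) \<le> \<kappa> * (s * (S + \<eta>'))" using \<kappa> by simp
    then have ny: "norm (y + s *\<^sub>R b - y') \<le> \<kappa> * (s * (S + \<eta>'))" using y'(2) by linarith
    have diff: "norm ((x + s *\<^sub>R a, y') - p s) = norm (y + s *\<^sub>R b - y')"
      by (simp add: ps norm_Pair norm_minus_commute)
    have "dist (x + s *\<^sub>R a, y') z \<le> norm ((x + s *\<^sub>R a, y') - p s) + dist (p s) z"
      using dist_triangle[of "(x + s *\<^sub>R a, y')" z "p s"] by (simp add: dist_norm)
    then have "(x + s *\<^sub>R a, y') \<in> ball z \<rho>" using diff ny elim(5) by (simp add: dist_commute)
    moreover have "p s \<in> ball z \<rho>"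
      using elim(5) order_trans[OF norm_ge_zero ny] by (simp add: dist_commute)
    ultimately have "norm (f (x + s *\<^sub>R a, y') - f (p s)) \<le> Lf * norm ((x + s *\<^sub>R a, y') - p s)"
      using lip unfolding z_def by blast
    also have "\<dots> \<le> Lf * (\<kappa> * (s * (S + \<eta>')))" using ny Lf unfolding diff by simp
    also have "\<dots> = s * (Lf * \<kappa> * S + \<eta> / 2)"
      using Lf \<kappa> by (simp add: \<eta>'_def field_simps)
    finally have "f (x + s *\<^sub>R a, y') \<le> f (p s) + s * (Lf * \<kappa> * S + \<eta> / 2)" by simp
    moreover have "f (p s) - f z \<le> s * (f' z d + \<eta> / 2)"
      using elim(1,4) by (simp add: field_simps)
    ultimately have "f (x + s *\<^sub>R a, y') \<le> f z + s * (f' z d + Lf * \<kappa> * S + \<eta>)"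
      by (simp add: algebra_simps)
    then show ?case using y'(1) unfolding z_def d_def S_def by blast
  qed
qed

end

lemma compact_eventually_subseq:
  fixes s :: "nat \<Rightarrow> 'a::metric_space"
  assumes "compact K" "\<forall>\<^sub>F k in sequentially. s k \<in> K"
  obtains r l where "strict_mono (r :: nat \<Rightarrow> nat)" "l \<in> K" "(\<lambda>k. s (r k)) \<longlonglongrightarrow> l"
proof -
  obtain n where n: "\<forall>k\<ge>n. s k \<in> K" using assms(2) unfolding eventually_sequentially by blast
  then have "\<forall>k. s (k + n) \<in> K" by simp
  then obtain l r where l: "l \<in> K" "strict_mono (r :: nat \<Rightarrow> nat)" "((\<lambda>k. s (k + n)) \<circ> r) \<longlonglongrightarrow> l"
    using assms(1) unfolding compact_def by metis
  have "strict_mono (\<lambda>k. r k + n)" using l(2) by (simp add: strict_mono_def)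
  then show thesis using that[of "\<lambda>k. r k + n" l] l by (simp add: o_def)
qed

context C1_program
begin

text \<open>The error bound is applied twice: to move \<open>yt\<close> to the perturbed feasible set at \<open>X k\<close>, and
  to move \<open>Y k\<close> back to the feasible set at \<open>x0\<close>. Both moves have size \<open>O(\<tau> k)\<close>, although
  \<open>Y k - yt\<close> need not.\<close>

lemma RCR_tangent_directions:
  assumes rcr: "rcr_regular g x0 yt" and yt: "yt \<in> feasible_eq J x0" and J: "J \<subseteq> active g x0 yt"
    and \<tau>: "\<And>k. \<tau> k > 0" "\<tau> \<longlonglongrightarrow> 0" and W: "W \<longlonglongrightarrow> u"
    and X: "\<And>k. X k = x0 + \<tau> k *\<^sub>R W k" and Y: "Y \<longlonglongrightarrow> yt"
    and feas: "\<forall>\<^sub>F k in sequentially. Y k \<in> feasible_eq J (X k)"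
  obtains r v w p q where "strict_mono (r :: nat \<Rightarrow> nat)"
    "\<forall>i\<in>active g x0 yt. g' (x0, yt) (u, v) $ i \<le> 0"
    "\<forall>i\<in>J. g' (x0, yt) (u, v) $ i = 0" "\<forall>i\<in>J. g' (x0, yt) (u, w) $ i = 0"
    "\<forall>\<^sub>F k in sequentially. p k \<in> feasible g (X (r k))" "\<forall>\<^sub>F k in sequentially. q k \<in> feasible g x0"
    "(\<lambda>k. (f (X (r k), p k) - f (x0, yt)) / \<tau> (r k)) \<longlonglongrightarrow> f' (x0, yt) (u, v)"
    "(\<lambda>k. (f (X (r k), Y (r k)) - f (x0, q k)) / \<tau> (r k)) \<longlonglongrightarrow> f' (x0, yt) (u, w)"
proof -
  obtain \<kappa> \<rho> where \<kappa>: "\<kappa> > 0" "\<rho> > 0"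
    and eb: "\<And>J x y. J \<subseteq> active g x0 yt \<Longrightarrow> x \<in> ball x0 \<rho> \<Longrightarrow> y \<in> ball yt \<rho>
       \<Longrightarrow> feasible_eq J x \<inter> ball yt \<rho> \<noteq> {}
       \<Longrightarrow> \<exists>y'\<in>feasible_eq J x. norm (y - y') \<le> \<kappa> * residual J (x, y)"
    using RCR_error_bound[OF rcr] yt unfolding feasible_eq_def by blast
  obtain \<rho>g Lg where Lg: "\<rho>g > 0" "Lg > 0" and g_lip: "\<And>p q. p \<in> ball (x0, yt) \<rho>g \<Longrightarrow> q \<in> ball (x0, yt) \<rho>g
       \<Longrightarrow> norm (g p - g q) \<le> Lg * norm (p - q)"
    using C1_local_Lipschitz[OF g_deriv g'_cont, where z = "(x0, yt)"] by blast
  have "(\<lambda>k. x0 + \<tau> k *\<^sub>R W k) \<longlonglongrightarrow> x0 + 0 *\<^sub>R u" by (intro tendsto_intros \<tau> W)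
  then have Xlim: "X \<longlonglongrightarrow> x0" by (simp flip: X)
  have XY: "(\<lambda>k. (X k, Y k)) \<longlonglongrightarrow> (x0, yt)" and Xyt: "(\<lambda>k. (X k, yt)) \<longlonglongrightarrow> (x0, yt)"
    and x0Y: "(\<lambda>k. (x0, Y k)) \<longlonglongrightarrow> (x0, yt)"
    by (intro tendsto_Pair Xlim Y tendsto_const)+
  have inB: "\<forall>\<^sub>F k in sequentially. Z k \<in> ball z e" if "Z \<longlonglongrightarrow> z" "e > 0"
    for Z and z :: "'z::metric_space" and e
    using that by (auto simp: tendsto_iff dist_commute)
  define C where "C = \<kappa> * (real CARD('p) * (Lg * (norm u + 1)))"
  have "\<forall>\<^sub>F k in sequentially. norm (W k) < norm u + 1"
    using order_tendstoD(2)[OF tendsto_norm[OF W]] by simp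
  then have evX: "\<forall>\<^sub>F k in sequentially. norm (X k - x0) \<le> \<tau> k * (norm u + 1)"
    by eventually_elim (use \<tau>(1) in \<open>simp add: X less_imp_le\<close>)
  \<comment> \<open>Serves both moves: \<open>c\<close> is the parameter at which \<open>y\<close>
    solves the system, \<open>x\<close> the one to which it is moved.\<close>
  have bound: "\<kappa> * residual J (x, y) \<le> \<tau> k * C"
    if "norm (X k - x0) \<le> \<tau> k * (norm u + 1)" "(x, y) \<in> ball (x0, yt) \<rho>g" "(c, y) \<in> ball (x0, yt) \<rho>g"
      "y \<in> feasible_eq J c" "norm (x - c) = norm (X k - x0)" for k x c y
  proof -
    have "residual J (x, y) \<le> real CARD('p) * norm (g (x, y) - g (c, y))"
      by (rule residual_le_diff[OF that(4)])
    also have "\<dots> \<le> real CARD('p) * (Lg * norm ((x, y) - (c, y)))"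
      using g_lip[OF that(2,3)] by (intro mult_left_mono) auto
    also have "\<dots> \<le> real CARD('p) * (Lg * (\<tau> k * (norm u + 1)))"
      using that(1,5) Lg by (intro mult_left_mono) (auto simp: norm_Pair)
    finally show ?thesis using \<kappa> by (simp add: C_def mult_ac)
  qed
  have "\<forall>\<^sub>F k in sequentially. \<exists>p. p \<in> feasible_eq J (X k) \<and> norm (p - yt) \<le> \<tau> k * C"
    using feas evX inB[OF Xlim \<kappa>(2)] inB[OF Y \<kappa>(2)] inB[OF Xyt Lg(1)]
  proof eventually_elim
    case (elim k)
    \<comment> \<open>\<open>Y k\<close> witnesses solvability at \<open>X k\<close>; in the reverse
      move \<open>yt\<close> does so at \<open>x0\<close>.\<close>
    have "feasible_eq J (X k) \<inter> ball yt \<rho> \<noteq> {}" using elim by blast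
    then obtain p where "p \<in> feasible_eq J (X k)" "norm (yt - p) \<le> \<kappa> * residual J (X k, yt)"
      using eb[OF J elim(3), of yt] \<kappa> by auto
    moreover have "\<kappa> * residual J (X k, yt) \<le> \<tau> k * C"
      by (rule bound[of k "X k" yt x0]) (use elim yt Lg in auto)
    ultimately show ?case by (auto simp: norm_minus_commute)
  qed
  then obtain p where p: "\<forall>\<^sub>F k in sequentially. p k \<in> feasible_eq J (X k) \<and> norm (p k - yt) \<le> \<tau> k * C"
    unfolding eventually_ex by blast
  have "\<forall>\<^sub>F k in sequentially. \<exists>q. q \<in> feasible_eq J x0 \<and> norm (Y k - q) \<le> \<tau> k * C"
    using feas evX inB[OF Y \<kappa>(2)] inB[OF XY Lg(1)] inB[OF x0Y Lg(1)]
  proof eventually_elim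
    case (elim k)
    have "feasible_eq J x0 \<inter> ball yt \<rho> \<noteq> {}" using yt \<kappa> by auto
    then obtain q where "q \<in> feasible_eq J x0" "norm (Y k - q) \<le> \<kappa> * residual J (x0, Y k)"
      using eb[OF J _ elim(3), of x0] \<kappa> by auto
    moreover have "\<kappa> * residual J (x0, Y k) \<le> \<tau> k * C"
      by (rule bound[of k x0 "Y k" "X k"]) (use elim in \<open>auto simp: norm_minus_commute\<close>)
    ultimately show ?case by auto
  qed
  then obtain q where q: "\<forall>\<^sub>F k in sequentially. q k \<in> feasible_eq J x0 \<and> norm (Y k - q k) \<le> \<tau> k * C"
    unfolding eventually_ex by blast
  \<comment> \<open>Pairing the two bounded displacements lets one subsequence serve both
    \<open>v\<close> and \<open>w\<close>.\<close>
  define D where "D = (\<lambda>k. ((p k - yt) /\<^sub>R \<tau> k, (Y k - q k) /\<^sub>R \<tau> k))"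
  have "\<forall>\<^sub>F k in sequentially. D k \<in> cball 0 C \<times> cball 0 C"
    using p q
  proof eventually_elim
    case (elim k)
    then have "norm (p k - yt) / \<tau> k \<le> C" "norm (Y k - q k) / \<tau> k \<le> C"
      using \<tau>(1)[of k] by (simp_all add: pos_divide_le_eq mult.commute)
    then show ?case using \<tau>(1)[of k] by (simp add: D_def divide_inverse mult.commute)
  qed
  then obtain r l where r: "strict_mono (r :: nat \<Rightarrow> nat)" and "(\<lambda>k. D (r k)) \<longlonglongrightarrow> l"
    using compact_eventually_subseq[OF compact_Times[OF compact_cball compact_cball]] by metis
  then obtain v w where vw: "(\<lambda>k. (p (r k) - yt) /\<^sub>R \<tau> (r k)) \<longlonglongrightarrow> v"
      "(\<lambda>k. (Y (r k) - q (r k)) /\<^sub>R \<tau> (r k)) \<longlonglongrightarrow> w"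
    using tendsto_fst[of "\<lambda>k. D (r k)" l] tendsto_snd[of "\<lambda>k. D (r k)" l] unfolding D_def by force
  note sub = LIMSEQ_subseq_LIMSEQ[OF _ r, unfolded o_def]
  have \<tau>r: "(\<lambda>k. \<tau> (r k)) \<longlonglongrightarrow> 0" and Xr: "(\<lambda>k. X (r k)) \<longlonglongrightarrow> x0" and Yr: "(\<lambda>k. Y (r k)) \<longlonglongrightarrow> yt"
    using sub[OF \<tau>(2)] sub[OF Xlim] sub[OF Y] .
  have pr: "\<forall>\<^sub>F k in sequentially. p (r k) \<in> feasible_eq J (X (r k))"
    and qr: "\<forall>\<^sub>F k in sequentially. q (r k) \<in> feasible_eq J x0"
    and feasr: "\<forall>\<^sub>F k in sequentially. Y (r k) \<in> feasible_eq J (X (r k))"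
    using eventually_subseq[OF r p] eventually_subseq[OF r q] eventually_subseq[OF r feas]
    by (auto elim: eventually_mono)
  have "(\<lambda>k. yt + \<tau> (r k) *\<^sub>R ((p (r k) - yt) /\<^sub>R \<tau> (r k))) \<longlonglongrightarrow> yt + 0 *\<^sub>R v"
    by (intro tendsto_intros \<tau>r vw)
  then have plim: "(\<lambda>k. p (r k)) \<longlonglongrightarrow> yt" using \<tau>(1) by (simp add: less_imp_neq[THEN not_sym])
  have "(\<lambda>k. Y (r k) - \<tau> (r k) *\<^sub>R ((Y (r k) - q (r k)) /\<^sub>R \<tau> (r k))) \<longlonglongrightarrow> yt - 0 *\<^sub>R w"
    by (intro tendsto_intros \<tau>r vw Yr)
  then have qlim: "(\<lambda>k. q (r k)) \<longlonglongrightarrow> yt" using \<tau>(1) by (simp add: less_imp_neq[THEN not_sym])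
  have Wr: "(\<lambda>k. (X (r k) - x0) /\<^sub>R \<tau> (r k)) \<longlonglongrightarrow> u"
    using sub[OF W] \<tau>(1) by (simp add: X less_imp_neq[THEN not_sym])
  have pos: "\<forall>\<^sub>F k in sequentially. \<tau> (r k) > 0" using \<tau>(1) by simp
  have d1: "(\<lambda>k. ((X (r k), p (r k)) - (x0, yt)) /\<^sub>R \<tau> (r k)) \<longlonglongrightarrow> (u, v)"
    using tendsto_Pair[OF Wr vw(1)] by simp
  \<comment> \<open>Both ends move here: \<open>w\<close> is the direction of \<open>Y - q\<close>,
    not of \<open>Y - yt\<close>.\<close>
  have d2: "(\<lambda>k. ((X (r k), Y (r k)) - (x0, q (r k))) /\<^sub>R \<tau> (r k)) \<longlonglongrightarrow> (u, w)"
    using tendsto_Pair[OF Wr vw(2)] by simp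
  note quot1 = C1_difference_quotient[OF _ _ pos tendsto_Pair[OF Xr plim] tendsto_const d1]
  note quot2 = C1_difference_quotient[OF _ _ pos tendsto_Pair[OF Xr Yr] tendsto_Pair[OF tendsto_const qlim] d2]
  have g1: "(\<lambda>k. (g (X (r k), p (r k)) $ i - g (x0, yt) $ i) / \<tau> (r k)) \<longlonglongrightarrow> g' (x0, yt) (u, v) $ i" for i
    using tendsto_vec_nth[OF quot1[OF g_deriv g'_cont], of i] by (simp add: divide_inverse mult.commute)
  have g2: "(\<lambda>k. (g (X (r k), Y (r k)) $ i - g (x0, q (r k)) $ i) / \<tau> (r k)) \<longlonglongrightarrow> g' (x0, yt) (u, w) $ i" for i
    using tendsto_vec_nth[OF quot2[OF g_deriv g'_cont], of i] by (simp add: divide_inverse mult.commute)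
  show thesis
  proof (rule that[OF r, where v = v and w = w and p = "\<lambda>k. p (r k)" and q = "\<lambda>k. q (r k)"])
    show "\<forall>i\<in>active g x0 yt. g' (x0, yt) (u, v) $ i \<le> 0"
    proof
      fix i assume "i \<in> active g x0 yt"
      then have gi: "g (x0, yt) $ i = 0" by (simp add: active_def)
      have "\<forall>\<^sub>F k in sequentially. (g (X (r k), p (r k)) $ i - g (x0, yt) $ i) / \<tau> (r k) \<le> 0"
        using pr by eventually_elim
          (use gi \<tau>(1) in \<open>auto simp: feasible_eq_def feasible_iff divide_le_0_iff less_imp_le\<close>)
      then show "g' (x0, yt) (u, v) $ i \<le> 0"
        by (rule tendsto_upperbound[OF g1]) simp
    qed
    show "\<forall>i\<in>J. g' (x0, yt) (u, v) $ i = 0"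
    proof
      fix i assume i: "i \<in> J"
      have "\<forall>\<^sub>F k in sequentially. (g (X (r k), p (r k)) $ i - g (x0, yt) $ i) / \<tau> (r k) = 0"
        using pr by eventually_elim (use i yt in \<open>auto simp: feasible_eq_def\<close>)
      then show "g' (x0, yt) (u, v) $ i = 0"
        by (rule LIMSEQ_unique[OF g1 tendsto_eventually])
    qed
    \<comment> \<open>Only equalities pass to \<open>w\<close>: at other active constraints
      \<open>g\<close> may be negative at \<open>q\<close>, which leaves the sign of the quotient
      open.\<close>
    show "\<forall>i\<in>J. g' (x0, yt) (u, w) $ i = 0"
    proof
      fix i assume i: "i \<in> J"
      have "\<forall>\<^sub>F k in sequentially. (g (X (r k), Y (r k)) $ i - g (x0, q (r k)) $ i) / \<tau> (r k) = 0"
        using qr feasr by eventually_elim (use i in \<open>auto simp: feasible_eq_def\<close>)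
      then show "g' (x0, yt) (u, w) $ i = 0"
        by (rule LIMSEQ_unique[OF g2 tendsto_eventually])
    qed
    show "\<forall>\<^sub>F k in sequentially. p (r k) \<in> feasible g (X (r k))"
      "\<forall>\<^sub>F k in sequentially. q (r k) \<in> feasible g x0"
      using pr qr by (auto simp: feasible_eq_def elim: eventually_mono)
    show "(\<lambda>k. (f (X (r k), p (r k)) - f (x0, yt)) / \<tau> (r k)) \<longlonglongrightarrow> f' (x0, yt) (u, v)"
      using quot1[OF f_deriv f'_cont] by (simp add: divide_inverse mult.commute)
    show "(\<lambda>k. (f (X (r k), Y (r k)) - f (x0, q (r k))) / \<tau> (r k)) \<longlonglongrightarrow> f' (x0, yt) (u, w)"
      using quot2[OF f_deriv f'_cont] by (simp add: divide_inverse mult.commute)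
  qed
qed

end

text \<open>Regular subgradients test every direction around their base point, so interior points
  are required; the affine image of a ball around \<open>u\<close> is a suitable open set.\<close>

lemma eventually_interior_dir_nbhd:
  fixes u :: "'a::real_normed_vector"
  assumes t: "\<And>k. t k > 0" "t \<longlonglongrightarrow> 0" and us: "us \<longlonglongrightarrow> u" and pos: "\<epsilon> > 0" "\<delta> > 0"
  shows "\<forall>\<^sub>F k in sequentially. x0 + t k *\<^sub>R us k \<in> interior ((+) x0 ` dir_nbhd \<epsilon> \<delta> u)"
proof -
  obtain \<rho> \<sigma> where \<rho>: "\<rho> > 0" "\<sigma> > 0"
    "\<forall>s w. 0 < s \<longrightarrow> s < \<sigma> \<longrightarrow> w \<in> ball u \<rho> \<longrightarrow> s *\<^sub>R w \<in> dir_nbhd \<epsilon> \<delta> u"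
    using scaleR_mem_dir_nbhd[OF pos] by metis
  have "\<forall>\<^sub>F k in sequentially. t k < \<sigma>" using t(2) \<rho>(2) by (simp add: order_tendstoD(2))
  moreover have "\<forall>\<^sub>F k in sequentially. us k \<in> ball u \<rho>"
    using us \<rho>(1) by (auto simp: tendsto_iff dist_commute)
  ultimately show ?thesis
  proof eventually_elim
    case (elim k)
    have "(\<lambda>w. x0 + t k *\<^sub>R w) ` ball u \<rho> \<subseteq> (+) x0 ` dir_nbhd \<epsilon> \<delta> u"
      using \<rho>(3) t(1) elim by auto
    moreover have "open ((\<lambda>w. x0 + t k *\<^sub>R w) ` ball u \<rho>)"
      using t(1)[of k] open_affinity[OF open_ball[of u \<rho>], of "t k" x0] by simp
    ultimately show ?case using elim by (intro interiorI) auto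
  qed
qed

lemma eventually_ray_dir_nbhd:
  assumes "\<epsilon> > 0" "\<delta> > 0"
  shows "\<forall>\<^sub>F s in at_right 0. x0 + s *\<^sub>R u \<in> (+) x0 ` dir_nbhd \<epsilon> \<delta> u"
proof -
  obtain \<rho> \<sigma> where "\<rho> > 0" "\<sigma> > 0"
    "\<forall>s w. 0 < s \<longrightarrow> s < \<sigma> \<longrightarrow> w \<in> ball u \<rho> \<longrightarrow> s *\<^sub>R w \<in> dir_nbhd \<epsilon> \<delta> u"
    using scaleR_mem_dir_nbhd[OF assms] by metis
  then show ?thesis
    unfolding eventually_at_right_field by (intro exI[of _ \<sigma>]) auto
qed

lemma tendsto_ray_at_right: "((\<lambda>s. x + s *\<^sub>R (a :: 'a::real_normed_vector)) \<longlongrightarrow> x) (at_right 0)"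
proof -
  have "((\<lambda>s. x + s *\<^sub>R a) \<longlongrightarrow> x + 0 *\<^sub>R a) (at_right 0)" by (intro tendsto_intros)
  then show ?thesis by simp
qed

text \<open>Fixes the constants provided by \<open>value_Lipschitz\<close>, so that the arguments
  below share one neighbourhood on which \<open>Vr\<close> represents \<open>V\<close>.\<close>

locale Lipschitz_directional_program = directional_program f g f' g' x0 u T
  for f :: "(real^'n) \<times> (real^'m) \<Rightarrow> real" and g :: "(real^'n) \<times> (real^'m) \<Rightarrow> real^'p"
    and f' g' x0 u T +
  fixes L \<epsilon>0 \<delta>0 :: real
  assumes L_pos: "L > 0" and \<epsilon>0_pos: "\<epsilon>0 > 0" and \<delta>0_pos: "\<delta>0 > 0"
    and solvable: "\<forall>x \<in> (+) x0 ` dir_nbhd \<epsilon>0 \<delta>0 u. solutions f g x \<noteq> {}"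
    and Vr_Lipschitz: "\<forall>x \<in> (+) x0 ` dir_nbhd \<epsilon>0 \<delta>0 u. \<forall>x' \<in> (+) x0 ` dir_nbhd \<epsilon>0 \<delta>0 u.
        \<bar>Vr x - Vr x'\<bar> \<le> L * norm (x - x')"
begin

abbreviation "N \<equiv> (+) x0 ` dir_nbhd \<epsilon>0 \<delta>0 u"

lemma V_eq_Vr: "x \<in> N \<Longrightarrow> V x = ereal (Vr x)"
  using solvable value_fun_solution by fastforce

lemma x0_in_N: "x0 \<in> N"
  using \<epsilon>0_pos by (intro image_eqI[of _ _ 0]) (auto simp: dir_nbhd_def)

text \<open>At an interior minimiser of \<open>Vr\<close> plus a quadratic centred at
  \<open>c\<close>, the negative gradient of the quadratic is a proximal subgradient; Lipschitz
  continuity keeps the minimiser interior.\<close>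

lemma regular_subgradient_nearby:
  assumes R: "R > 0" and sub: "cball c R \<subseteq> N"
  obtains p \<xi> where "p \<in> ball c R" "\<xi> \<in> regular_subdiff V p" "norm \<xi> \<le> 2 * L"
proof -
  \<comment> \<open>The minimiser satisfies \<open>k * n \<le> L\<close>, so this weight gives
    \<open>n \<le> R / 2\<close>, while the subgradient has norm
    \<open>2 * k * n \<le> 2 * L\<close> for any radius.\<close>
  define k where "k = 2 * L / R"
  have k: "k > 0" using L_pos R by (simp add: k_def)
  have "L-lipschitz_on (cball c R) Vr"
    by (rule lipschitz_onI) (use Vr_Lipschitz sub L_pos in \<open>auto simp: dist_norm simp del: mem_cball subset_iff dest!: subsetD[OF sub]\<close>)
  then have "continuous_on (cball c R) (\<lambda>x. Vr x + k * (norm (x - c))\<^sup>2)"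
    by (intro continuous_intros lipschitz_on_continuous_on)
  then have "\<exists>p\<in>cball c R. \<forall>x\<in>cball c R. Vr p + k * (norm (p - c))\<^sup>2 \<le> Vr x + k * (norm (x - c))\<^sup>2"
    by (intro continuous_attains_inf) (use R in auto)
  then obtain p where p: "p \<in> cball c R"
    and min: "\<And>x. x \<in> cball c R \<Longrightarrow> Vr p + k * (norm (p - c))\<^sup>2 \<le> Vr x + k * (norm (x - c))\<^sup>2"
    by blast
  define n where "n = norm (p - c)"
  have pN: "p \<in> N" and cN: "c \<in> N" using p sub R by auto
  have "k * n\<^sup>2 \<le> Vr c - Vr p" using min[of c] R by (simp add: n_def)
  also have "\<dots> \<le> L * n"
    using bspec[OF bspec[OF Vr_Lipschitz cN] pN] by (simp add: n_def norm_minus_commute abs_le_iff)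
  finally have kn: "k * n \<le> L"
    using L_pos by (cases "n = 0") (auto simp: power2_eq_square n_def)
  then have "2 * n \<le> R" using L_pos R by (simp add: k_def field_simps)
  then have "n < R" using R by linarith
  then have pB: "p \<in> ball c R" by (simp add: n_def dist_norm norm_minus_commute)
  define \<xi> where "\<xi> = - (2 * k) *\<^sub>R (p - c)"
  have "norm \<xi> \<le> 2 * L" using kn k by (simp add: \<xi>_def n_def abs_mult)
  moreover have "\<xi> \<in> regular_subdiff V p"
  proof (rule regular_subdiff_quadraticI[where c = k])
    show "\<bar>V p\<bar> \<noteq> \<infinity>" by (subst V_eq_Vr[OF pN]) simp
    have "\<forall>\<^sub>F x in at p. x \<in> ball c R" using pB by (intro eventually_at_in_open') auto
    then show "\<forall>\<^sub>F x in at p. V p + ereal (\<xi> \<bullet> (x - p) - k * (norm (x - p))\<^sup>2) \<le> V x"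
    proof eventually_elim
      case (elim x)
      then have xN: "x \<in> N" and xc: "x \<in> cball c R" using sub by auto
      have "(norm (x - c))\<^sup>2 = (norm (p - c))\<^sup>2 + 2 * ((p - c) \<bullet> (x - p)) + (norm (x - p))\<^sup>2"
        unfolding power2_norm_eq_inner by (simp add: inner_diff_left inner_diff_right inner_commute)
      then have "k * (norm (x - c))\<^sup>2 = k * (norm (p - c))\<^sup>2 - \<xi> \<bullet> (x - p) + k * (norm (x - p))\<^sup>2"
        by (simp only: \<xi>_def inner_scaleR_left) (simp add: distrib_left)
      then have "Vr p + (\<xi> \<bullet> (x - p) - k * (norm (x - p))\<^sup>2) \<le> Vr x" using min[OF xc] by linarith
      then show ?case by (subst V_eq_Vr[OF pN], subst V_eq_Vr[OF xN]) simp
    qed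
  qed
  ultimately show thesis using that pB by blast
qed

text \<open>A subgradient bounds \<open>V\<close> from below along rays,
  \<open>feasible_ray_estimate\<close> from above; their comparison is the penalised inequality that
  \<open>bounded_multipliers\<close> needs. The bound \<open>Lf * \<kappa>\<close> depends only on
  \<open>yt\<close>, so it is uniform along sequences.\<close>

lemma subgradient_multipliers:
  assumes yt: "yt \<in> T"
  obtains M \<epsilon> \<delta> \<rho> where "\<epsilon> > 0" "\<delta> > 0" "\<rho> > 0"
    "\<forall>x y \<xi>. x \<in> interior ((+) x0 ` dir_nbhd \<epsilon> \<delta> u) \<longrightarrow> x \<in> interior N \<longrightarrow> (x, y) \<in> ball (x0, yt) \<rho> \<longrightarrow>
       y \<in> solutions f g x \<longrightarrow> \<xi> \<in> regular_subdiff V x \<longrightarrow>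
       (\<exists>l::real^'p. (\<forall>i. 0 \<le> l$i \<and> l$i \<le> M) \<and> (\<forall>i. i \<notin> active g x y \<longrightarrow> l$i = 0) \<and>
          (\<forall>d. f' (x, y) d + (\<Sum>i\<in>UNIV. l$i * g' (x, y) d $ i) = \<xi> \<bullet> fst d))"
proof -
  obtain \<kappa> \<epsilon> \<delta> where \<kappa>: "\<kappa> > 0" "\<epsilon> > 0" "\<delta> > 0"
    and RS: "\<forall>x \<in> (+) x0 ` dir_nbhd \<epsilon> \<delta> u. \<forall>y \<in> ball yt \<epsilon>.
       \<exists>y'\<in>feasible g x. norm (y - y') \<le> \<kappa> * norm (pos_part (g (x, y)))"
    by (rule robinson_stableD[OF T_RS[OF yt]])
  obtain \<rho>f Lf where Lf: "\<rho>f > 0" "Lf > 0" and f_lip: "\<And>p q. p \<in> ball (x0, yt) \<rho>f \<Longrightarrow> q \<in> ball (x0, yt) \<rho>f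
       \<Longrightarrow> norm (f p - f q) \<le> Lf * norm (p - q)"
    using C1_local_Lipschitz[OF f_deriv f'_cont, where z = "(x0, yt)"] by blast
  have "\<exists>l::real^'p. (\<forall>i. 0 \<le> l$i \<and> l$i \<le> Lf * \<kappa>) \<and> (\<forall>i. i \<notin> active g x y \<longrightarrow> l$i = 0) \<and>
          (\<forall>d. f' (x, y) d + (\<Sum>i\<in>UNIV. l$i * g' (x, y) d $ i) = \<xi> \<bullet> fst d)"
    if xint: "x \<in> interior ((+) x0 ` dir_nbhd \<epsilon> \<delta> u)" "x \<in> interior N"
      and xy: "(x, y) \<in> ball (x0, yt) (min \<epsilon> \<rho>f)"
      and y: "y \<in> solutions f g x" and \<xi>: "\<xi> \<in> regular_subdiff V x" for x y \<xi>
  proof -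
    have yB: "y \<in> ball yt \<epsilon>"
      using xy dist_snd_le[of "(x0, yt)" "(x, y)"] by simp
    obtain \<rho> where \<rho>: "\<rho> > 0" "ball (x, y) \<rho> \<subseteq> ball (x0, yt) \<rho>f"
      using xy openE[OF open_ball, of "(x, y)" "(x0, yt)" \<rho>f] by auto
    have ineq: "f' (x, y) d - \<xi> \<bullet> fst d + Lf * \<kappa> * (\<Sum>i\<in>active g x y. max 0 (g' (x, y) d $ i)) \<ge> 0" for d
    proof -
      obtain a b where d: "d = (a, b)" by (cases d)
      define Q where "Q = f' (x, y) d + Lf * \<kappa> * (\<Sum>i\<in>active g x y. max 0 (g' (x, y) d $ i))"
      have evI: "\<forall>\<^sub>F s in at_right 0. x + s *\<^sub>R a \<in> interior ((+) x0 ` dir_nbhd \<epsilon> \<delta> u)"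
        "\<forall>\<^sub>F s in at_right 0. x + s *\<^sub>R a \<in> interior N"
        "\<forall>\<^sub>F s in at_right 0. y + s *\<^sub>R b \<in> ball yt \<epsilon>"
        using topological_tendstoD[OF tendsto_ray_at_right open_interior] xint
          topological_tendstoD[OF tendsto_ray_at_right open_ball yB] by blast+
      have "\<xi> \<bullet> a \<le> Q + \<eta> * (1 + norm a)" if \<eta>: "\<eta> > 0" for \<eta>
      proof -
        have eb: "\<forall>\<^sub>F s in at_right 0. \<exists>y'\<in>feasible g (x + s *\<^sub>R a).
            norm (y + s *\<^sub>R b - y') \<le> \<kappa> * norm (pos_part (g (x + s *\<^sub>R a, y + s *\<^sub>R b)))"
          using evI(1,3) by eventually_elim (use RS interior_subset in blast)
        have "\<forall>\<^sub>F s in at_right 0. \<exists>y'\<in>feasible g (x + s *\<^sub>R a). f (x + s *\<^sub>R a, y') \<le> f (x, y) + s * (Q + \<eta>)"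
          unfolding Q_def d
          by (rule feasible_ray_estimate[OF _ \<kappa>(1) eb \<rho>(1) Lf(2) f_lip \<eta>])
             (use y \<rho>(2) in \<open>auto simp: solutions_def\<close>)
        moreover have "\<forall>\<^sub>F s in at_right 0. V (x + s *\<^sub>R a) \<ge> V x
            + ereal (\<xi> \<bullet> (x + s *\<^sub>R a - x) - \<eta> * norm (x + s *\<^sub>R a - x))"
          using regular_subdiff_lower_bound[OF \<xi> \<eta>] tendsto_ray_at_right[of x a]
          unfolding filterlim_iff by blast
        ultimately have "\<forall>\<^sub>F s in at_right (0::real). \<xi> \<bullet> a \<le> Q + \<eta> * (1 + norm a)"
          using eventually_at_right_less[of "0::real"]
        proof eventually_elim
          case (elim s)
          then obtain y' where y': "y' \<in> feasible g (x + s *\<^sub>R a)" "f (x + s *\<^sub>R a, y') \<le> f (x, y) + s * (Q + \<eta>)"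
            by blast
          have "ereal (f (x, y) + (s * (\<xi> \<bullet> a) - \<eta> * (s * norm a))) \<le> V (x + s *\<^sub>R a)"
            using elim(2,3) value_fun_solution[OF y] by simp
          also have "\<dots> \<le> ereal (f (x + s *\<^sub>R a, y'))" by (rule value_fun_le[OF y'(1)])
          finally have "f (x, y) + (s * (\<xi> \<bullet> a) - \<eta> * (s * norm a)) \<le> f (x + s *\<^sub>R a, y')"
            by simp
          then have "s * (\<xi> \<bullet> a) \<le> s * (Q + \<eta> * (1 + norm a))"
            using y'(2) by (simp add: algebra_simps)
          then show ?case using elim(3) by simp
        qed
        then show ?thesis by simp
      qed
      note le = this
      have "\<xi> \<bullet> a \<le> Q + 0 * (1 + norm a)"
      proof (rule tendsto_lowerbound[where F = "at_right (0::real)"])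
        show "((\<lambda>\<eta>. Q + \<eta> * (1 + norm a)) \<longlongrightarrow> Q + 0 * (1 + norm a)) (at_right 0)" by (intro tendsto_intros)
        show "\<forall>\<^sub>F \<eta> in at_right 0. \<xi> \<bullet> a \<le> Q + \<eta> * (1 + norm a)"
          using eventually_at_right_less[of "0::real"] by eventually_elim (rule le)
      qed simp
      then show ?thesis by (simp add: Q_def d)
    qed
    have lin: "linear (\<lambda>d. f' (x, y) d - \<xi> \<bullet> fst d)" "linear (\<lambda>d. g' (x, y) d $ i)" for i
      by (intro bounded_linear.linear bounded_linear_sub bounded_linear_compose[OF bounded_linear_vec_nth]
          bounded_linear_compose[OF bounded_linear_inner_right] bounded_linear_fst blinfun.bounded_linear_right)+
    obtain l :: "real^'p" where "\<forall>i. 0 \<le> l$i \<and> l$i \<le> Lf * \<kappa>" "\<forall>i. i \<notin> active g x y \<longrightarrow> l$i = 0"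
      "\<forall>d. f' (x, y) d - \<xi> \<bullet> fst d + (\<Sum>i\<in>UNIV. l$i * g' (x, y) d $ i) = 0"
      by (rule bounded_multipliers[OF lin _ ineq]) (use Lf \<kappa> in auto)
    moreover from this(3) have "f' (x, y) d + (\<Sum>i\<in>UNIV. l$i * g' (x, y) d $ i) = \<xi> \<bullet> fst d" for d
      by (drule_tac spec[of _ d]) linarith
    ultimately show ?thesis by blast
  qed
  then show thesis using \<kappa> Lf by (intro that[of \<epsilon> \<delta> "min \<epsilon> \<rho>f" "Lf * \<kappa>"]) auto
qed

text \<open>A direction in the linearisation cone has zero penalty term. The bound holds for all
  small \<open>s\<close>, not only along a sequence, and this makes existence of the directional
  derivative accessible.\<close>

lemma directional_upper_estimate:
  assumes yt: "yt \<in> T" and v: "\<forall>i\<in>active g x0 yt. g' (x0, yt) (u, v) $ i \<le> 0" and \<eta>: "\<eta> > 0"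
  shows "\<forall>\<^sub>F s in at_right 0. (Vr (x0 + s *\<^sub>R u) - Vr x0) / s \<le> f' (x0, yt) (u, v) + \<eta>"
proof -
  obtain \<kappa> \<epsilon> \<delta> where \<kappa>: "\<kappa> > 0" "\<epsilon> > 0" "\<delta> > 0"
    and RS: "\<forall>x \<in> (+) x0 ` dir_nbhd \<epsilon> \<delta> u. \<forall>y \<in> ball yt \<epsilon>.
       \<exists>y'\<in>feasible g x. norm (y - y') \<le> \<kappa> * norm (pos_part (g (x, y)))"
    by (rule robinson_stableD[OF T_RS[OF yt]])
  obtain \<rho>f Lf where Lf: "\<rho>f > 0" "Lf > 0" and f_lip: "\<And>p q. p \<in> ball (x0, yt) \<rho>f \<Longrightarrow> q \<in> ball (x0, yt) \<rho>f
       \<Longrightarrow> norm (f p - f q) \<le> Lf * norm (p - q)"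
    using C1_local_Lipschitz[OF f_deriv f'_cont, where z = "(x0, yt)"] by blast
  have "\<forall>\<^sub>F s in at_right 0. yt + s *\<^sub>R v \<in> ball yt \<epsilon>"
    using topological_tendstoD[OF tendsto_ray_at_right open_ball, of yt yt \<epsilon> v] \<kappa> by simp
  with eventually_ray_dir_nbhd[OF \<kappa>(2,3), of x0 u] have eb: "\<forall>\<^sub>F s in at_right 0. \<exists>y'\<in>feasible g (x0 + s *\<^sub>R u).
      norm (yt + s *\<^sub>R v - y') \<le> \<kappa> * norm (pos_part (g (x0 + s *\<^sub>R u, yt + s *\<^sub>R v)))"
    by eventually_elim (use RS in blast)
  have ytS: "yt \<in> solutions f g x0" using yt T_solutions by blast
  then have "yt \<in> feasible g x0" by (simp add: solutions_def)
  then have "\<forall>\<^sub>F s in at_right 0. \<exists>y'\<in>feasible g (x0 + s *\<^sub>R u). f (x0 + s *\<^sub>R u, y') \<le> f (x0, yt)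
      + s * (f' (x0, yt) (u, v) + Lf * \<kappa> * (\<Sum>i\<in>active g x0 yt. max 0 (g' (x0, yt) (u, v) $ i)) + \<eta>)"
    by (rule feasible_ray_estimate[OF _ \<kappa>(1) eb Lf f_lip \<eta>])
  then show ?thesis
    using eventually_ray_dir_nbhd[OF \<epsilon>0_pos \<delta>0_pos, of x0 u] eventually_at_right_less[of "0::real"]
  proof eventually_elim
    case (elim s)
    have "(\<Sum>i\<in>active g x0 yt. max 0 (g' (x0, yt) (u, v) $ i)) = 0"
      using v by (intro sum.neutral) (auto simp: max_def)
    then obtain y' where y': "y' \<in> feasible g (x0 + s *\<^sub>R u)"
        "f (x0 + s *\<^sub>R u, y') \<le> f (x0, yt) + s * (f' (x0, yt) (u, v) + \<eta>)"
      using elim(1) by auto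
    have "Vr (x0 + s *\<^sub>R u) \<le> f (x0 + s *\<^sub>R u, y')" using y'(1) elim(2) solvable Vr_le by blast
    then show ?case using y'(2) elim(3) Vr_solution[OF ytS] by (simp add: pos_divide_le_eq mult.commute)
  qed
qed

end

section \<open>Limits of subgradients\<close>

context Lipschitz_directional_program
begin

lemma subgradient_limit:
  assumes t: "\<And>k. t k > 0" "t \<longlonglongrightarrow> 0" and us: "us \<longlonglongrightarrow> u" and \<xi>s: "\<xi>s \<longlonglongrightarrow> \<xi>"
    and sub: "\<And>k. \<xi>s k \<in> regular_subdiff V (x0 + t k *\<^sub>R us k)"
  obtains r yt ys l v where "strict_mono (r :: nat \<Rightarrow> nat)" "yt \<in> T"
    "\<forall>k. ys k \<in> solutions f g (x0 + t (r k) *\<^sub>R us (r k))" "ys \<longlonglongrightarrow> yt"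
    "\<forall>i. 0 \<le> l $ i" "\<forall>i. i \<notin> active g x0 yt \<longrightarrow> l $ i = 0"
    "\<forall>d. f' (x0, yt) d + (\<Sum>i\<in>UNIV. l $ i * g' (x0, yt) d $ i) = \<xi> \<bullet> fst d"
    "\<forall>i\<in>active g x0 yt. g' (x0, yt) (u, v) $ i \<le> 0"
    "\<forall>i. l $ i * g' (x0, yt) (u, v) $ i = 0"
    "(\<lambda>k. (Vr (x0 + t (r k) *\<^sub>R us (r k)) - Vr x0) / t (r k)) \<longlonglongrightarrow> \<xi> \<bullet> u"
proof -
  define xs where "xs = (\<lambda>k. x0 + t k *\<^sub>R us k)"
  have ap: "approaches_along x0 u xs"
    unfolding xs_def by (rule approaches_along_scaled[OF t us])
  obtain r0 ys0 yt where r0: "strict_mono (r0 :: nat \<Rightarrow> nat)" and yt: "yt \<in> T"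
    and ys0: "\<And>k. ys0 k \<in> solutions f g (xs (r0 k))" "ys0 \<longlonglongrightarrow> yt"
    using solutions_accumulate[OF ap] by blast
  obtain M \<epsilon> \<delta> \<rho> where pos: "\<epsilon> > 0" "\<delta> > 0" "\<rho> > 0"
    and mult: "\<forall>x y \<xi>. x \<in> interior ((+) x0 ` dir_nbhd \<epsilon> \<delta> u) \<longrightarrow> x \<in> interior N \<longrightarrow> (x, y) \<in> ball (x0, yt) \<rho> \<longrightarrow>
       y \<in> solutions f g x \<longrightarrow> \<xi> \<in> regular_subdiff V x \<longrightarrow>
       (\<exists>l::real^'p. (\<forall>i. 0 \<le> l$i \<and> l$i \<le> M) \<and> (\<forall>i. i \<notin> active g x y \<longrightarrow> l$i = 0) \<and>
          (\<forall>d. f' (x, y) d + (\<Sum>i\<in>UNIV. l$i * g' (x, y) d $ i) = \<xi> \<bullet> fst d))"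
    by (rule subgradient_multipliers[OF yt])
  have xslim: "xs \<longlonglongrightarrow> x0" by (rule approaches_along_tendsto[OF ap])
  have "(\<lambda>k. (xs (r0 k), ys0 k)) \<longlonglongrightarrow> (x0, yt)"
    using LIMSEQ_subseq_LIMSEQ[OF xslim r0] ys0(2) by (intro tendsto_Pair) (auto simp: o_def)
  then have "\<forall>\<^sub>F k in sequentially. (xs (r0 k), ys0 k) \<in> ball (x0, yt) \<rho>"
    using pos(3) by (auto simp: tendsto_iff dist_commute)
  then have "\<forall>\<^sub>F k in sequentially. \<exists>l::real^'p. (\<forall>i. 0 \<le> l$i \<and> l$i \<le> M) \<and> (\<forall>i. i \<notin> active g (xs (r0 k)) (ys0 k) \<longrightarrow> l$i = 0) \<and>
          (\<forall>d. f' (xs (r0 k), ys0 k) d + (\<Sum>i\<in>UNIV. l$i * g' (xs (r0 k), ys0 k) d $ i) = \<xi>s (r0 k) \<bullet> fst d)"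
    using eventually_subseq[OF r0 eventually_interior_dir_nbhd[OF t us pos(1,2), of x0]]
      eventually_subseq[OF r0 eventually_interior_dir_nbhd[OF t us \<epsilon>0_pos \<delta>0_pos, of x0]]
  proof eventually_elim
    case (elim k)
    show ?case
      using mult[rule_format, of "xs (r0 k)" "ys0 k" "\<xi>s (r0 k)"] elim ys0(1)[of k] sub[of "r0 k"]
      unfolding xs_def by blast
  qed
  then obtain ls :: "nat \<Rightarrow> real^'p" where ls: "\<forall>\<^sub>F k in sequentially. (\<forall>i. 0 \<le> ls k$i \<and> ls k$i \<le> M) \<and> (\<forall>i. i \<notin> active g (xs (r0 k)) (ys0 k) \<longrightarrow> ls k$i = 0) \<and>
          (\<forall>d. f' (xs (r0 k), ys0 k) d + (\<Sum>i\<in>UNIV. ls k$i * g' (xs (r0 k), ys0 k) d $ i) = \<xi>s (r0 k) \<bullet> fst d)"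
    unfolding eventually_ex by blast
  then have "\<forall>\<^sub>F k in sequentially. ls k \<in> cbox 0 (\<chi> i. M)"
    by eventually_elim (simp add: mem_box_cart)
  then obtain r1 l where r1: "strict_mono (r1 :: nat \<Rightarrow> nat)" and "l \<in> cbox 0 (\<chi> i. M)"
    and llim: "(\<lambda>k. ls (r1 k)) \<longlonglongrightarrow> l"
    using compact_eventually_subseq[OF compact_cbox] by metis
  then have l0: "0 \<le> l $ i" for i by (simp add: mem_box_cart)
  define R where "R = (\<lambda>k. r0 (r1 k))"
  have R: "strict_mono R" unfolding R_def using strict_mono_o[OF r0 r1] by (simp add: o_def)
  define X where "X = (\<lambda>k. xs (R k))"
  define Y where "Y = (\<lambda>k. ys0 (r1 k))"
  define m where "m = (\<lambda>k. ls (r1 k))"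
  have Xlim: "X \<longlonglongrightarrow> x0" and Ylim: "Y \<longlonglongrightarrow> yt" and mlim: "m \<longlonglongrightarrow> l"
    using LIMSEQ_subseq_LIMSEQ[OF xslim R] LIMSEQ_subseq_LIMSEQ[OF ys0(2) r1] llim
    by (auto simp: X_def Y_def m_def o_def)
  have Ysol: "Y k \<in> solutions f g (X k)" for k
    using ys0(1)[of "r1 k"] by (simp add: X_def Y_def R_def)
  have m: "\<forall>\<^sub>F k in sequentially. (\<forall>i. i \<notin> active g (X k) (Y k) \<longrightarrow> m k$i = 0) \<and>
          (\<forall>d. f' (X k, Y k) d + (\<Sum>i\<in>UNIV. m k$i * g' (X k, Y k) d $ i) = \<xi>s (R k) \<bullet> fst d)"
    using eventually_subseq[OF r1 ls] by eventually_elim (simp add: X_def Y_def m_def R_def)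
  have XY: "(\<lambda>k. (X k, Y k)) \<longlonglongrightarrow> (x0, yt)" by (intro tendsto_Pair Xlim Ylim)
  have ytS: "yt \<in> solutions f g x0" using yt T_solutions by blast
  then have ytF: "yt \<in> feasible g x0" by (simp add: solutions_def)
  \<comment> \<open>A constraint negative at the limit is inactive along the sequence, so its
    multipliers vanish there.\<close>
  have inact: "l $ i = 0" if "i \<notin> active g x0 yt" for i
  proof -
    have "g (x0, yt) $ i < 0" using that ytF by (simp add: active_def feasible_iff order_less_le)
    then have "\<forall>\<^sub>F k in sequentially. g (X k, Y k) $ i < 0"
      using order_tendstoD(2)[OF tendsto_g[OF XY]] by blast
    with m have "\<forall>\<^sub>F k in sequentially. m k $ i = 0"
      by eventually_elim (auto simp: active_def)
    then show ?thesis by (intro LIMSEQ_unique[OF tendsto_vec_nth[OF mlim] tendsto_eventually])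
  qed
  have eqn: "f' (x0, yt) d + (\<Sum>i\<in>UNIV. l $ i * g' (x0, yt) d $ i) = \<xi> \<bullet> fst d" for d
  proof (rule LIMSEQ_unique)
    have "isCont f' (x0, yt)" "isCont g' (x0, yt)"
      using f'_cont g'_cont by (metis UNIV_I continuous_on_eq_continuous_at open_UNIV)+
    then have "(\<lambda>k. f' (X k, Y k)) \<longlonglongrightarrow> f' (x0, yt)" "(\<lambda>k. g' (X k, Y k)) \<longlonglongrightarrow> g' (x0, yt)"
      using isCont_tendsto_compose[OF _ XY] by blast+
    then show "(\<lambda>k. f' (X k, Y k) d + (\<Sum>i\<in>UNIV. m k$i * g' (X k, Y k) d $ i))
        \<longlonglongrightarrow> f' (x0, yt) d + (\<Sum>i\<in>UNIV. l $ i * g' (x0, yt) d $ i)"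
      by (intro tendsto_intros mlim)
    have "(\<lambda>k. \<xi>s (R k) \<bullet> fst d) \<longlonglongrightarrow> \<xi> \<bullet> fst d"
      using LIMSEQ_subseq_LIMSEQ[OF \<xi>s R] by (intro tendsto_intros) (simp add: o_def)
    then show "(\<lambda>k. f' (X k, Y k) d + (\<Sum>i\<in>UNIV. m k$i * g' (X k, Y k) d $ i)) \<longlonglongrightarrow> \<xi> \<bullet> fst d"
      by (rule Lim_transform_eventually) (use m in \<open>eventually_elim, metis\<close>)
  qed
  define J where "J = {i. l $ i > 0}"
  have J: "J \<subseteq> active g x0 yt" using inact by (force simp: J_def)
  have ytJ: "yt \<in> feasible_eq J x0" using ytF J by (auto simp: feasible_eq_def active_def)
  \<comment> \<open>Finiteness of \<open>J\<close> gives one index from which all these multipliers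
    are positive.\<close>
  have "\<forall>\<^sub>F k in sequentially. \<forall>i\<in>J. m k $ i > 0"
    using order_tendstoD(1)[OF tendsto_vec_nth[OF mlim]]
    by (intro eventually_ball_finite) (auto simp: J_def)
  with m have YJ: "\<forall>\<^sub>F k in sequentially. Y k \<in> feasible_eq J (X k)"
  proof eventually_elim
    case (elim k)
    have "Y k \<in> feasible g (X k)" using Ysol by (simp add: solutions_def)
    then show ?case using elim by (force simp: feasible_eq_def active_def)
  qed
  define \<tau> where "\<tau> = (\<lambda>k. t (R k))"
  have \<tau>: "\<And>k. \<tau> k > 0" "\<tau> \<longlonglongrightarrow> 0"
    using t(1) LIMSEQ_subseq_LIMSEQ[OF t(2) R] by (auto simp: \<tau>_def o_def)
  have W: "(\<lambda>k. us (R k)) \<longlonglongrightarrow> u" using LIMSEQ_subseq_LIMSEQ[OF us R] by (simp add: o_def)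
  obtain r2 v w p q where r2: "strict_mono (r2 :: nat \<Rightarrow> nat)"
    and v: "\<forall>i\<in>active g x0 yt. g' (x0, yt) (u, v) $ i \<le> 0"
    and vJ: "\<forall>i\<in>J. g' (x0, yt) (u, v) $ i = 0" and wJ: "\<forall>i\<in>J. g' (x0, yt) (u, w) $ i = 0"
    and p: "\<forall>\<^sub>F k in sequentially. p k \<in> feasible g (X (r2 k))" and q: "\<forall>\<^sub>F k in sequentially. q k \<in> feasible g x0"
    and up: "(\<lambda>k. (f (X (r2 k), p k) - f (x0, yt)) / \<tau> (r2 k)) \<longlonglongrightarrow> f' (x0, yt) (u, v)"
    and lo: "(\<lambda>k. (f (X (r2 k), Y (r2 k)) - f (x0, q k)) / \<tau> (r2 k)) \<longlonglongrightarrow> f' (x0, yt) (u, w)"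
    by (rule RCR_tangent_directions[OF T_RCR[OF yt] ytJ J \<tau> W _ Ylim YJ]) (auto simp: X_def xs_def \<tau>_def)
  have compl: "l $ i * g' (x0, yt) (u, b) $ i = 0" if "\<forall>i\<in>J. g' (x0, yt) (u, b) $ i = 0" for b i
    using that l0[of i] by (cases "i \<in> J") (auto simp: J_def)
  \<comment> \<open>Off \<open>J\<close> the multiplier is zero, on \<open>J\<close> the derivative
    is; hence \<open>v\<close> and \<open>w\<close> have the same slope.\<close>
  have slope: "f' (x0, yt) (u, b) = \<xi> \<bullet> u" if "\<forall>i\<in>J. g' (x0, yt) (u, b) $ i = 0" for b
    using eqn[of "(u, b)"] compl[OF that] by simp
  \<comment> \<open>\<open>p k\<close> is a competitor at \<open>X (r2 k)\<close> and gives the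
    upper bound; \<open>q k\<close> is a competitor at \<open>x0\<close> and gives the lower
    one.\<close>
  have lim: "(\<lambda>k. (Vr (X (r2 k)) - Vr x0) / \<tau> (r2 k)) \<longlonglongrightarrow> \<xi> \<bullet> u"
  proof (rule real_tendsto_sandwich[where f = "\<lambda>k. (f (X (r2 k), Y (r2 k)) - f (x0, q k)) / \<tau> (r2 k)"
        and h = "\<lambda>k. (f (X (r2 k), p k) - f (x0, yt)) / \<tau> (r2 k)"])
    show "(\<lambda>k. (f (X (r2 k), p k) - f (x0, yt)) / \<tau> (r2 k)) \<longlonglongrightarrow> \<xi> \<bullet> u"
      using up slope[OF vJ] by simp
    show "(\<lambda>k. (f (X (r2 k), Y (r2 k)) - f (x0, q k)) / \<tau> (r2 k)) \<longlonglongrightarrow> \<xi> \<bullet> u"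
      using lo slope[OF wJ] by simp
    show "\<forall>\<^sub>F k in sequentially. (Vr (X (r2 k)) - Vr x0) / \<tau> (r2 k) \<le> (f (X (r2 k), p k) - f (x0, yt)) / \<tau> (r2 k)"
      using p
    proof eventually_elim
      case (elim k)
      show ?case
        using Vr_le[OF Ysol elim] Vr_solution[OF ytS] \<tau>(1)[of "r2 k"] by (intro divide_right_mono) auto
    qed
    show "\<forall>\<^sub>F k in sequentially. (f (X (r2 k), Y (r2 k)) - f (x0, q k)) / \<tau> (r2 k) \<le> (Vr (X (r2 k)) - Vr x0) / \<tau> (r2 k)"
      using q
    proof eventually_elim
      case (elim k)
      show ?case
        using Vr_le[OF ytS elim] Vr_solution[OF Ysol, of "r2 k"] \<tau>(1)[of "r2 k"] by (intro divide_right_mono) auto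
    qed
  qed
  show thesis
  proof (rule that[where r = "\<lambda>k. R (r2 k)" and yt = yt and ys = "\<lambda>k. Y (r2 k)" and l = l and v = v])
    show "strict_mono (\<lambda>k. R (r2 k))" using strict_mono_o[OF R r2] by (simp add: o_def)
    show "\<forall>k. Y (r2 k) \<in> solutions f g (x0 + t (R (r2 k)) *\<^sub>R us (R (r2 k)))"
      using Ysol by (simp add: X_def xs_def)
    show "(\<lambda>k. Y (r2 k)) \<longlonglongrightarrow> yt" using LIMSEQ_subseq_LIMSEQ[OF Ylim r2] by (simp add: o_def)
    show "(\<lambda>k. (Vr (x0 + t (R (r2 k)) *\<^sub>R us (R (r2 k))) - Vr x0) / t (R (r2 k))) \<longlonglongrightarrow> \<xi> \<bullet> u"
      using lim by (simp add: X_def xs_def \<tau>_def)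
  qed (use yt l0 inact eqn v compl[OF vJ] in blast)+
qed

text \<open>Balls of radius proportional to \<open>s k\<close> around points of the ray lie in
  \<open>N\<close>. Letting the factor tend to 0 sends the scaled base points to \<open>u\<close>,
  and the bound \<open>2 * L\<close> yields a convergent subsequence. The scales remain those of the
  given sequence, so slopes along it can be compared.\<close>

lemma subgradients_along_ray:
  assumes s: "\<And>k. s k > 0" "s \<longlonglongrightarrow> 0"
  obtains r us \<xi>s \<xi> where "strict_mono (r :: nat \<Rightarrow> nat)" "us \<longlonglongrightarrow> u" "\<xi>s \<longlonglongrightarrow> \<xi>"
    "\<forall>k. \<xi>s k \<in> regular_subdiff V (x0 + s (r k) *\<^sub>R us k)"
proof -
  obtain \<rho> \<sigma> where \<rho>: "\<rho> > 0" "\<sigma> > 0"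
    "\<forall>s w. 0 < s \<longrightarrow> s < \<sigma> \<longrightarrow> w \<in> ball u \<rho> \<longrightarrow> s *\<^sub>R w \<in> dir_nbhd \<epsilon>0 \<delta>0 u"
    using scaleR_mem_dir_nbhd[OF \<epsilon>0_pos \<delta>0_pos] by metis
  have "\<forall>\<^sub>F k in sequentially. s k < \<sigma>" using s(2) \<rho>(2) by (simp add: order_tendstoD(2))
  then obtain n where n: "\<And>k. k \<ge> n \<Longrightarrow> s k < \<sigma>" unfolding eventually_sequentially by blast
  \<comment> \<open>\<open>\<rho> / 2\<close> keeps the scaled points in the cone; the reciprocal
    makes them converge to \<open>u\<close>.\<close>
  define e where "e = (\<lambda>k. min (\<rho> / 2) (inverse (real (Suc k))))"
  have e: "e k > 0" "e k < \<rho>" "e k \<le> inverse (real (Suc k))" for k using \<rho>(1) by (auto simp: e_def)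
  have ex: "\<exists>w \<zeta>. norm (w - u) \<le> e k \<and> norm \<zeta> \<le> 2 * L \<and> \<zeta> \<in> regular_subdiff V (x0 + s (k + n) *\<^sub>R w)" for k
  proof -
    define c where "c = x0 + s (k + n) *\<^sub>R u"
    have sk: "s (k + n) > 0" "s (k + n) < \<sigma>" using s(1) n by auto
    have scale: "norm ((1 / s (k + n)) *\<^sub>R (x - x0) - u) = norm (x - c) / s (k + n)" for x
    proof -
      have "(1 / s (k + n)) *\<^sub>R (x - x0) - u = (1 / s (k + n)) *\<^sub>R (x - c)"
        using sk by (simp add: c_def algebra_simps)
      then show ?thesis using sk by simp
    qed
    have sub: "cball c (s (k + n) * e k) \<subseteq> N"
    proof
      fix x assume "x \<in> cball c (s (k + n) * e k)"
      then have "norm ((1 / s (k + n)) *\<^sub>R (x - x0) - u) \<le> e k"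
        unfolding scale using sk by (simp add: dist_norm norm_minus_commute pos_divide_le_eq mult.commute)
      then have "(1 / s (k + n)) *\<^sub>R (x - x0) \<in> ball u \<rho>"
        using e(2)[of k] by (simp add: dist_norm norm_minus_commute)
      then have "s (k + n) *\<^sub>R ((1 / s (k + n)) *\<^sub>R (x - x0)) \<in> dir_nbhd \<epsilon>0 \<delta>0 u"
        using \<rho>(3) sk by blast
      then show "x \<in> N" using sk by (intro image_eqI[of _ _ "x - x0"]) auto
    qed
    obtain p \<zeta> where p: "p \<in> ball c (s (k + n) * e k)" "\<zeta> \<in> regular_subdiff V p" "norm \<zeta> \<le> 2 * L"
      by (rule regular_subgradient_nearby[OF _ sub]) (use sk e(1) in auto)
    have "norm ((1 / s (k + n)) *\<^sub>R (p - x0) - u) \<le> e k"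
      unfolding scale using p(1) sk
      by (simp add: dist_norm norm_minus_commute pos_divide_le_eq mult.commute)
    moreover have "x0 + s (k + n) *\<^sub>R ((1 / s (k + n)) *\<^sub>R (p - x0)) = p" using sk by simp
    ultimately show ?thesis using p by metis
  qed
  then obtain W \<zeta> where W: "\<And>k. norm (W k - u) \<le> e k" and \<zeta>: "\<And>k. norm (\<zeta> k) \<le> 2 * L"
    "\<And>k. \<zeta> k \<in> regular_subdiff V (x0 + s (k + n) *\<^sub>R W k)" by metis
  have "(\<lambda>k. W k - u) \<longlonglongrightarrow> 0"
    by (rule Lim_null_comparison[OF _ LIMSEQ_inverse_real_of_nat])
       (use W e(3) order_trans in \<open>blast intro: always_eventually\<close>)
  then have Wlim: "W \<longlonglongrightarrow> u" by (simp add: LIM_zero_iff)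
  have "\<forall>\<^sub>F k in sequentially. \<zeta> k \<in> cball 0 (2 * L)" using \<zeta>(1) by simp
  then obtain r \<xi> where r: "strict_mono (r :: nat \<Rightarrow> nat)" "(\<lambda>k. \<zeta> (r k)) \<longlonglongrightarrow> \<xi>"
    using compact_eventually_subseq[OF compact_cball] by metis
  show thesis
  \<comment> \<open>The shift by \<open>n\<close> skips the scales that are too large for the
    cone.\<close>
  proof (rule that[of "\<lambda>k. r k + n" "\<lambda>k. W (r k)" "\<lambda>k. \<zeta> (r k)" \<xi>])
    show "strict_mono (\<lambda>k. r k + n)" using r(1) by (simp add: strict_mono_def)
    show "(\<lambda>k. W (r k)) \<longlonglongrightarrow> u" using LIMSEQ_subseq_LIMSEQ[OF Wlim r(1)] by (simp add: o_def)
  qed (use r \<zeta> in auto)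
qed

definition quotient :: "real \<Rightarrow> real" where
  "quotient s = (Vr (x0 + s *\<^sub>R u) - Vr x0) / s"

text \<open>The direction \<open>v\<close> from \<open>subgradient_limit\<close> has slope
  \<open>\<xi> \<bullet> u\<close> and lies in the linearisation cone, so it bounds the quotient on
  the whole ray. Lipschitz continuity carries the limit from the directions \<open>us\<close> to the
  fixed \<open>u\<close> at the same scales.\<close>

lemma subgradient_slope:
  assumes t: "\<And>k. t k > 0" "t \<longlonglongrightarrow> 0" and us: "us \<longlonglongrightarrow> u" and \<xi>s: "\<xi>s \<longlonglongrightarrow> \<xi>"
    and sub: "\<And>k. \<xi>s k \<in> regular_subdiff V (x0 + t k *\<^sub>R us k)"
  shows "\<eta> > 0 \<Longrightarrow> \<forall>\<^sub>F s in at_right 0. quotient s \<le> \<xi> \<bullet> u + \<eta>"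
    and "\<exists>r. strict_mono (r :: nat \<Rightarrow> nat) \<and> (\<lambda>k. quotient (t (r k))) \<longlonglongrightarrow> \<xi> \<bullet> u"
proof -
  obtain r yt ys l v where r: "strict_mono (r :: nat \<Rightarrow> nat)" and yt: "yt \<in> T"
    and ys: "\<forall>k. ys k \<in> solutions f g (x0 + t (r k) *\<^sub>R us (r k))" "ys \<longlonglongrightarrow> yt"
    and l: "\<forall>i. 0 \<le> l $ i" "\<forall>i. i \<notin> active g x0 yt \<longrightarrow> l $ i = 0"
    and eqn: "\<forall>d. f' (x0, yt) d + (\<Sum>i\<in>UNIV. l $ i * g' (x0, yt) d $ i) = \<xi> \<bullet> fst d"
    and v: "\<forall>i\<in>active g x0 yt. g' (x0, yt) (u, v) $ i \<le> 0"
    and compl: "\<forall>i. l $ i * g' (x0, yt) (u, v) $ i = 0"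
    and lim: "(\<lambda>k. (Vr (x0 + t (r k) *\<^sub>R us (r k)) - Vr x0) / t (r k)) \<longlonglongrightarrow> \<xi> \<bullet> u"
    by (rule subgradient_limit[OF assms])
  have "f' (x0, yt) (u, v) = \<xi> \<bullet> u" using spec[OF eqn, of "(u, v)"] compl by simp
  then show "\<eta> > 0 \<Longrightarrow> \<forall>\<^sub>F s in at_right 0. quotient s \<le> \<xi> \<bullet> u + \<eta>"
    using directional_upper_estimate[OF yt v, of \<eta>] by (simp add: quotient_def)
  have near: "\<forall>\<^sub>F k in sequentially. x0 + t (r k) *\<^sub>R W k \<in> N" if "W \<longlonglongrightarrow> u" for W
    using eventually_interior_dir_nbhd[of "\<lambda>k. t (r k)" W u \<epsilon>0 \<delta>0 x0] t(1) LIMSEQ_subseq_LIMSEQ[OF t(2) r]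
      that \<epsilon>0_pos \<delta>0_pos interior_subset by (fastforce simp: o_def elim!: eventually_mono)
  have usr: "(\<lambda>k. us (r k)) \<longlonglongrightarrow> u" using LIMSEQ_subseq_LIMSEQ[OF us r] by (simp add: o_def)
  have "(\<lambda>k. quotient (t (r k)) - (Vr (x0 + t (r k) *\<^sub>R us (r k)) - Vr x0) / t (r k)) \<longlonglongrightarrow> 0"
  proof (rule Lim_null_comparison)
    have "(\<lambda>k. L * norm (u - us (r k))) \<longlonglongrightarrow> L * norm (u - u)" by (intro tendsto_intros usr)
    then show "(\<lambda>k. L * norm (u - us (r k))) \<longlonglongrightarrow> 0" by simp
    show "\<forall>\<^sub>F k in sequentially. norm (quotient (t (r k)) - (Vr (x0 + t (r k) *\<^sub>R us (r k)) - Vr x0) / t (r k))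
        \<le> L * norm (u - us (r k))"
      using near[OF tendsto_const] near[OF usr]
    proof eventually_elim
      case (elim k)
      have "\<bar>Vr (x0 + t (r k) *\<^sub>R u) - Vr (x0 + t (r k) *\<^sub>R us (r k))\<bar>
          \<le> L * norm (x0 + t (r k) *\<^sub>R u - (x0 + t (r k) *\<^sub>R us (r k)))"
        using bspec[OF bspec[OF Vr_Lipschitz elim(1)] elim(2)] .
      also have "\<dots> = t (r k) * (L * norm (u - us (r k)))"
        using t(1)[of "r k"] by (simp flip: scaleR_diff_right)
      finally have "\<bar>Vr (x0 + t (r k) *\<^sub>R u) - Vr (x0 + t (r k) *\<^sub>R us (r k))\<bar> / t (r k) \<le> L * norm (u - us (r k))"
        using t(1)[of "r k"] by (simp add: pos_divide_le_eq mult.commute)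
      then show ?case using t(1)[of "r k"] by (simp add: quotient_def flip: diff_divide_distrib)
    qed
  qed
  from tendsto_add[OF this lim] have "(\<lambda>k. quotient (t (r k))) \<longlonglongrightarrow> \<xi> \<bullet> u" by simp
  then show "\<exists>r. strict_mono (r :: nat \<Rightarrow> nat) \<and> (\<lambda>k. quotient (t (r k))) \<longlonglongrightarrow> \<xi> \<bullet> u"
    using r by blast
qed

text \<open>A slope below \<open>\<xi> \<bullet> u\<close> along some sequence would be attained by subgradients near that
  sequence, and these again bound the upper slope.\<close>

lemma quotient_tendsto:
  assumes t: "\<And>k. t k > 0" "t \<longlonglongrightarrow> 0" and us: "us \<longlonglongrightarrow> u" and \<xi>s: "\<xi>s \<longlonglongrightarrow> \<xi>"
    and sub: "\<And>k. \<xi>s k \<in> regular_subdiff V (x0 + t k *\<^sub>R us k)"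
  shows "(quotient \<longlongrightarrow> \<xi> \<bullet> u) (at_right 0)"
proof (rule order_tendstoI)
  fix a assume "a > \<xi> \<bullet> u"
  then have "\<forall>\<^sub>F s in at_right 0. quotient s \<le> \<xi> \<bullet> u + (a - \<xi> \<bullet> u) / 2"
    by (intro subgradient_slope(1)[OF assms]) simp
  then show "\<forall>\<^sub>F s in at_right 0. quotient s < a"
    by eventually_elim (use \<open>a > \<xi> \<bullet> u\<close> in \<open>simp add: field_simps\<close>)
next
  fix a assume a: "a < \<xi> \<bullet> u"
  show "\<forall>\<^sub>F s in at_right 0. a < quotient s"
  proof (rule ccontr)
    assume "\<not> ?thesis"
    then have "\<forall>b>0. \<exists>s>0. s < b \<and> quotient s \<le> a"
      unfolding eventually_at_right_field by (meson not_le)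
    then have "\<forall>k. \<exists>s>0. s < inverse (real (Suc k)) \<and> quotient s \<le> a" by simp
    then obtain s where s: "\<And>k. s k > 0" "\<And>k. s k < inverse (real (Suc k))" "\<And>k. quotient (s k) \<le> a"
      by metis
    have slim: "s \<longlonglongrightarrow> 0"
      by (rule Lim_null_comparison[OF _ LIMSEQ_inverse_real_of_nat])
         (use s in \<open>auto simp: less_imp_le intro!: always_eventually\<close>)
    \<comment> \<open>The scales with quotient at most \<open>a\<close> carry subgradients of their
      own; their limit will satisfy \<open>\<zeta> \<bullet> u \<le> a\<close>.\<close>
    obtain r ws \<zeta>s \<zeta> where r: "strict_mono (r :: nat \<Rightarrow> nat)" and ws: "ws \<longlonglongrightarrow> u" and \<zeta>s: "\<zeta>s \<longlonglongrightarrow> \<zeta>"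
      and \<zeta>: "\<forall>k. \<zeta>s k \<in> regular_subdiff V (x0 + s (r k) *\<^sub>R ws k)"
      by (rule subgradients_along_ray[OF s(1) slim])
    have sr: "(\<lambda>k. s (r k)) \<longlonglongrightarrow> 0" using LIMSEQ_subseq_LIMSEQ[OF slim r] by (simp add: o_def)
    note slope = subgradient_slope[of "\<lambda>k. s (r k)", OF s(1) sr ws \<zeta>s \<zeta>[rule_format]]
    obtain r' where "(\<lambda>k. quotient (s (r (r' k)))) \<longlonglongrightarrow> \<zeta> \<bullet> u" using slope(2) by blast
    then have \<zeta>a: "\<zeta> \<bullet> u \<le> a" by (rule tendsto_upperbound) (use s(3) in auto)
    obtain r'' where r'': "strict_mono (r'' :: nat \<Rightarrow> nat)" "(\<lambda>k. quotient (t (r'' k))) \<longlonglongrightarrow> \<xi> \<bullet> u"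
      using subgradient_slope(2)[OF assms] by blast
    \<comment> \<open>Half the gap, so that
      \<open>\<zeta> \<bullet> u + \<eta> \<le> a + \<eta>\<close> stays below
      \<open>\<xi> \<bullet> u\<close>.\<close>
    define \<eta> where "\<eta> = (\<xi> \<bullet> u - a) / 2"
    have "\<eta> > 0" using a by (simp add: \<eta>_def)
    then have "\<forall>\<^sub>F s in at_right 0. quotient s \<le> \<zeta> \<bullet> u + \<eta>" by (rule slope(1))
    moreover have "filterlim (\<lambda>k. t (r'' k)) (at_right 0) sequentially"
      using LIMSEQ_subseq_LIMSEQ[OF t(2) r''(1)] t(1)
      by (intro tendsto_imp_filterlim_at_right) (auto simp: o_def)
    ultimately have "\<forall>\<^sub>F k in sequentially. quotient (t (r'' k)) \<le> \<zeta> \<bullet> u + \<eta>"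
      unfolding filterlim_iff by blast
    then have "\<xi> \<bullet> u \<le> \<zeta> \<bullet> u + \<eta>" by (rule tendsto_upperbound[OF r''(2)]) simp
    then show False using \<zeta>a a by (simp add: \<eta>_def field_simps)
  qed
qed

lemma has_dir_deriv_value:
  assumes "(quotient \<longlongrightarrow> c) (at_right 0)"
  shows "has_dir_deriv V x0 u (ereal c)"
  unfolding has_dir_deriv_def
proof (rule Lim_transform_eventually)
  show "((\<lambda>s. ereal (quotient s)) \<longlongrightarrow> ereal c) (at_right 0)" using assms by (rule tendsto_ereal)
  show "\<forall>\<^sub>F s in at_right 0. ereal (quotient s) = (V (x0 + s *\<^sub>R u) - V x0) / ereal s"
    using eventually_ray_dir_nbhd[OF \<epsilon>0_pos \<delta>0_pos, of x0 u] eventually_at_right_less[of "0::real"]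
  proof eventually_elim
    case (elim s)
    show ?case
      by (subst V_eq_Vr[OF elim(1)], subst V_eq_Vr[OF x0_in_N]) (use elim(2) in \<open>simp add: quotient_def\<close>)
  qed
qed

text \<open>Supplies the convergence of values demanded in
  \<open>dir_limiting_subdiff\<close>.\<close>

lemma V_tendsto:
  assumes t: "\<And>k. t k > 0" "t \<longlonglongrightarrow> 0" and us: "us \<longlonglongrightarrow> u"
  shows "(\<lambda>k. V (x0 + t k *\<^sub>R us k)) \<longlonglongrightarrow> V x0"
proof -
  note ap = approaches_along_scaled[OF t us, of x0]
  have evN: "\<forall>\<^sub>F k in sequentially. x0 + t k *\<^sub>R us k \<in> N"
    using ap \<epsilon>0_pos \<delta>0_pos unfolding approaches_along_def by blast
  have "(\<lambda>k. Vr (x0 + t k *\<^sub>R us k) - Vr x0) \<longlonglongrightarrow> 0"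
  proof (rule Lim_null_comparison)
    have "(\<lambda>k. L * norm (x0 + t k *\<^sub>R us k - x0)) \<longlonglongrightarrow> L * norm (x0 - x0)"
      by (intro tendsto_mult tendsto_const tendsto_norm tendsto_diff approaches_along_tendsto[OF ap])
    then show "(\<lambda>k. L * norm (x0 + t k *\<^sub>R us k - x0)) \<longlonglongrightarrow> 0" by simp
    show "\<forall>\<^sub>F k in sequentially. norm (Vr (x0 + t k *\<^sub>R us k) - Vr x0) \<le> L * norm (x0 + t k *\<^sub>R us k - x0)"
      using evN by eventually_elim (use Vr_Lipschitz x0_in_N in \<open>simp only: real_norm_def\<close>)
  qed
  then have "(\<lambda>k. ereal (Vr (x0 + t k *\<^sub>R us k))) \<longlonglongrightarrow> ereal (Vr x0)"
    by (intro tendsto_ereal) (simp add: LIM_zero_iff)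
  moreover have "\<forall>\<^sub>F k in sequentially. ereal (Vr (x0 + t k *\<^sub>R us k)) = V (x0 + t k *\<^sub>R us k)"
    using evN by eventually_elim (rule V_eq_Vr[symmetric])
  ultimately show ?thesis
    by (subst V_eq_Vr[OF x0_in_N]) (rule Lim_transform_eventually)
qed

lemma dir_limiting_subdiff_nonempty: "dir_limiting_subdiff V x0 u \<noteq> {}"
proof -
  have s: "\<And>k. inverse (real (Suc k)) > 0" by simp
  obtain r us \<xi>s \<xi> where r: "strict_mono (r :: nat \<Rightarrow> nat)" and us: "us \<longlonglongrightarrow> u" and \<xi>: "\<xi>s \<longlonglongrightarrow> \<xi>"
    "\<forall>k. \<xi>s k \<in> regular_subdiff V (x0 + inverse (real (Suc (r k))) *\<^sub>R us k)"
    by (rule subgradients_along_ray[OF s LIMSEQ_inverse_real_of_nat])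
  have t: "(\<lambda>k. inverse (real (Suc (r k)))) \<longlonglongrightarrow> 0"
    using LIMSEQ_subseq_LIMSEQ[OF LIMSEQ_inverse_real_of_nat r] by (simp add: o_def)
  have "\<xi> \<in> dir_limiting_subdiff V x0 u"
    unfolding dir_limiting_subdiff_def
    by (intro CollectI exI[of _ "\<lambda>k. inverse (real (Suc (r k)))"] exI[of _ us] exI[of _ \<xi>s])
       (use t us \<xi> V_tendsto[OF _ t us] in simp)
  then show ?thesis by blast
qed

end

section \<open>The upper estimates\<close>

lemma inner_gradient:
  fixes h :: "'a::euclidean_space \<Rightarrow> real"
  assumes "(h has_derivative h') (at z)"
  shows "a \<bullet> gradient h z = h' a"
proof -
  define D where "D = adjoint h' 1"
  have lin: "linear h'" using assms has_derivative_linear by blast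
  have D: "h' b = b \<bullet> D" for b
    using adjoint_works[OF lin, of b 1] by (simp add: D_def)
  have "gradient h z = D"
    unfolding gradient_def
  proof (rule the_equality)
    show "GDERIV h z :> D" unfolding gderiv_def using assms by (simp add: D[abs_def, symmetric])
    fix E assume "GDERIV h z :> E"
    then have "(\<lambda>b. b \<bullet> E) = h'" unfolding gderiv_def using assms has_derivative_unique by blast
    then have "b \<bullet> E = b \<bullet> D" for b by (metis D)
    then show "E = D" using vector_eq_ldot by blast
  qed
  then show ?thesis by (simp add: D)
qed

context C1_program
begin

lemma frechet_f: "frechet_derivative f (at z) = f' z"
  using frechet_derivative_at[OF f_deriv] by simp

lemma frechet_g: "frechet_derivative g (at z) = g' z"
  using frechet_derivative_at[OF g_deriv] by simp

lemma frechet_g_component: "frechet_derivative (\<lambda>z. g z $ i) (at z) = (\<lambda>d. g' z d $ i)"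
  using frechet_derivative_at[OF bounded_linear.has_derivative[OF bounded_linear_vec_nth g_deriv]]
  by metis

lemma inner_grad_x: "a \<bullet> grad_x f x y = f' (x, y) (a, 0)"
  unfolding grad_x_def
  by (rule inner_gradient[OF has_derivative_compose[OF has_derivative_Pair[OF has_derivative_ident
        has_derivative_const] f_deriv]])

lemma inner_grad_y: "b \<bullet> grad_y f x y = f' (x, y) (0, b)"
  unfolding grad_y_def
  by (rule inner_gradient[OF has_derivative_compose[OF has_derivative_Pair[OF has_derivative_const
        has_derivative_ident] f_deriv]])

lemma jac_x_mult: "jac_x g x y *v a = g' (x, y) (a, 0)"
proof -
  have D: "((\<lambda>x. g (x, y)) has_derivative (\<lambda>a. g' (x, y) (a, 0))) (at x)"
    using has_derivative_compose[OF has_derivative_Pair[OF has_derivative_ident has_derivative_const]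
        g_deriv] .
  show ?thesis
    unfolding jac_x_def jacobian_def frechet_derivative_at[OF D, symmetric]
    by (rule matrix_works[OF has_derivative_linear[OF D, THEN linear_matrix_vector_mul_eq[THEN iffD2]]])
qed

lemma jac_y_mult: "jac_y g x y *v b = g' (x, y) (0, b)"
  by (simp add: vec_eq_iff matrix_vector_mul_component grad_yg_inner[symmetric] row_jac_y[symmetric]
      row_def)

lemma inner_transpose_jac:
  "a \<bullet> (transpose (jac_x g x y) *v l) = (\<Sum>i\<in>UNIV. l $ i * g' (x, y) (a, 0) $ i)"
  "b \<bullet> (transpose (jac_y g x y) *v l) = (\<Sum>i\<in>UNIV. l $ i * g' (x, y) (0, b) $ i)"
  by (simp_all add: dot_lmul_matrix inner_commute[of a] inner_commute[of b] jac_x_mult jac_y_mult)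
     (simp_all add: inner_vec_def)

text \<open>Testing the joint identity with \<open>(0, b)\<close> gives stationarity in the decision
  variable, testing it with \<open>(a, 0)\<close> the formula for \<open>\<xi>\<close>.\<close>

lemma multiplier_estimate:
  assumes l: "\<forall>i. 0 \<le> l $ i" "\<forall>i. i \<notin> active g x y \<longrightarrow> l $ i = 0"
    and eqn: "\<forall>d. f' (x, y) d + (\<Sum>i\<in>UNIV. l $ i * g' (x, y) d $ i) = \<xi> \<bullet> fst d"
  shows "l \<in> multipliers f g x y" "\<xi> = grad_x f x y + transpose (jac_x g x y) *v l"
proof -
  have "b \<bullet> (grad_y f x y + transpose (jac_y g x y) *v l) = 0" for b
    using spec[OF eqn, of "(0, b)"] by (simp add: inner_add_right inner_grad_y inner_transpose_jac
        del: transpose_matrix_vector)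
  then have "grad_y f x y + transpose (jac_y g x y) *v l = 0"
    using inner_eq_zero_iff by blast
  moreover have "g (x, y) \<bullet> l = 0"
    unfolding inner_vec_def using l(2) by (intro sum.neutral) (auto simp: active_def)
  moreover have "0 \<le> l" using l(1) by (simp add: less_eq_vec_def)
  ultimately show "l \<in> multipliers f g x y" by (simp add: multipliers_def)
  have "a \<bullet> \<xi> = a \<bullet> (grad_x f x y + transpose (jac_x g x y) *v l)" for a
    using spec[OF eqn, of "(a, 0)"]
    by (simp add: inner_add_right inner_grad_x inner_transpose_jac inner_commute[of a \<xi>]
        del: transpose_matrix_vector)
  then show "\<xi> = grad_x f x y + transpose (jac_x g x y) *v l"
    using vector_eq_ldot by blast
qed

end

context Lipschitz_directional_program
begin

text \<open>By complementarity the multiplier identity at \<open>(u, v)\<close> reads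
  \<open>f' (x0, yt) (u, v) = \<xi> \<bullet> u\<close>, and the right-hand side is the directional
  derivative of \<open>V\<close>; hence \<open>v\<close> is critical. Complementarity also gives the
  orthogonality of \<open>l\<close>.\<close>

lemma dir_limiting_subdiff_estimate:
  assumes "\<xi> \<in> dir_limiting_subdiff V x0 u"
  shows "\<exists>y\<in>T \<inter> dir_solutions f g x0 u. \<xi> \<in> estimate_at f g x0 y u"
proof -
  obtain t us \<xi>s where t: "\<And>k. t k > 0" "t \<longlonglongrightarrow> 0" and us: "us \<longlonglongrightarrow> u" and \<xi>s: "\<xi>s \<longlonglongrightarrow> \<xi>"
    and sub: "\<And>k. \<xi>s k \<in> regular_subdiff V (x0 + t k *\<^sub>R us k)"
    using assms unfolding dir_limiting_subdiff_def by blast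
  obtain r yt ys l v where r: "strict_mono (r :: nat \<Rightarrow> nat)" and yt: "yt \<in> T"
    and ys: "\<forall>k. ys k \<in> solutions f g (x0 + t (r k) *\<^sub>R us (r k))" "ys \<longlonglongrightarrow> yt"
    and l: "\<forall>i. 0 \<le> l $ i" "\<forall>i. i \<notin> active g x0 yt \<longrightarrow> l $ i = 0"
    and eqn: "\<forall>d. f' (x0, yt) d + (\<Sum>i\<in>UNIV. l $ i * g' (x0, yt) d $ i) = \<xi> \<bullet> fst d"
    and v: "\<forall>i\<in>active g x0 yt. g' (x0, yt) (u, v) $ i \<le> 0"
    and compl: "\<forall>i. l $ i * g' (x0, yt) (u, v) $ i = 0"
    and lim: "(\<lambda>k. (Vr (x0 + t (r k) *\<^sub>R us (r k)) - Vr x0) / t (r k)) \<longlonglongrightarrow> \<xi> \<bullet> u"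
    by (rule subgradient_limit[OF t us \<xi>s sub])
  have "yt \<in> dir_solutions f g x0 u"
    unfolding dir_solutions_def
  proof (intro CollectI conjI exI)
    show "yt \<in> solutions f g x0" using yt T_solutions by blast
    show "\<forall>k. t (r k) > 0" using t(1) by simp
    show "(\<lambda>k. t (r k)) \<longlonglongrightarrow> 0" "(\<lambda>k. us (r k)) \<longlonglongrightarrow> u"
      using LIMSEQ_subseq_LIMSEQ[OF t(2) r] LIMSEQ_subseq_LIMSEQ[OF us r] by (simp_all add: o_def)
  qed (use ys in auto)
  moreover have "v \<in> critical_directions f g x0 yt u"
  proof -
    have "f' (x0, yt) (u, v) = \<xi> \<bullet> u" using spec[OF eqn, of "(u, v)"] compl by simp
    then show ?thesis
      using v has_dir_deriv_value[OF quotient_tendsto[OF t us \<xi>s sub]]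
      by (simp add: critical_directions_def linearization_cone_def frechet_g_component frechet_f)
  qed
  moreover have "l \<in> {frechet_derivative g (at (x0, yt)) (u, v)}\<^sup>\<bottom>"
  proof -
    have "g' (x0, yt) (u, v) \<bullet> l = (\<Sum>i\<in>UNIV. l $ i * g' (x0, yt) (u, v) $ i)"
      by (simp add: inner_vec_def mult.commute)
    then have "g' (x0, yt) (u, v) \<bullet> l = 0" using compl by simp
    then show ?thesis by (simp add: orthogonal_comp_def frechet_g orthogonal_def)
  qed
  ultimately show ?thesis
    using multiplier_estimate[OF l eqn] yt unfolding estimate_at_def by blast
qed

end

context directional_program
begin

lemma dir_limiting_subdiff_properties:
  "dir_limiting_subdiff V x0 u \<noteq> {}"
  "\<xi> \<in> dir_limiting_subdiff V x0 u \<Longrightarrow>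
     \<exists>y\<in>T \<inter> dir_solutions f g x0 u. \<xi> \<in> estimate_at f g x0 y u"
proof -
  obtain L \<epsilon> \<delta> where "L > 0" "\<epsilon> > 0" "\<delta> > 0"
    "\<forall>x \<in> (+) x0 ` dir_nbhd \<epsilon> \<delta> u. solutions f g x \<noteq> {}"
    "\<forall>x \<in> (+) x0 ` dir_nbhd \<epsilon> \<delta> u. \<forall>x' \<in> (+) x0 ` dir_nbhd \<epsilon> \<delta> u. \<bar>Vr x - Vr x'\<bar> \<le> L * norm (x - x')"
    by (rule value_Lipschitz)
  then interpret Lipschitz_directional_program f g f' g' x0 u T L \<epsilon> \<delta>
    by unfold_locales
  show "dir_limiting_subdiff V x0 u \<noteq> {}" by (rule dir_limiting_subdiff_nonempty)
  show "\<xi> \<in> dir_limiting_subdiff V x0 u \<Longrightarrow>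
     \<exists>y\<in>T \<inter> dir_solutions f g x0 u. \<xi> \<in> estimate_at f g x0 y u"
    by (rule dir_limiting_subdiff_estimate)
qed

end

section \<open>Both sets of hypotheses provide a suitable set of limit solutions\<close>

context C1_program
begin

text \<open>\<open>x0\<close> lies in its own directional neighbourhood, so inf-compactness yields a
  solution \<open>y0\<close>. Robinson stability there gives feasible points converging to
  \<open>y0\<close>, hence the upper bound on \<open>V\<close> under which inf-compactness applies
  at nearby parameters.\<close>

lemma directional_program_inf_compact:
  assumes ric: "restricted_inf_compact f g x0 u \<Omega>"
    and rcr: "\<forall>y\<in>solutions f g x0. rcr_regular g x0 y"
    and rs: "\<forall>y\<in>solutions f g x0. robinson_stable g x0 y u"
  shows "directional_program f g f' g' x0 u (solutions f g x0 \<inter> \<Omega>)"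
proof
  fix xs assume ap: "approaches_along x0 u xs"
  have \<Omega>: "compact \<Omega>" and fin: "\<bar>value_fun f g x0\<bar> \<noteq> \<infinity>"
    using ric by (auto simp: restricted_inf_compact_def)
  obtain \<epsilon> \<delta> where \<epsilon>: "\<epsilon> > 0" "\<delta> > 0" and solv: "\<And>x. x \<in> (+) x0 ` dir_nbhd \<epsilon> \<delta> u \<Longrightarrow>
      value_fun f g x < value_fun f g x0 + ereal \<epsilon> \<Longrightarrow> solutions f g x \<inter> \<Omega> \<noteq> {}"
    using ric unfolding restricted_inf_compact_def by metis
  have "x0 \<in> (+) x0 ` dir_nbhd \<epsilon> \<delta> u"
    using \<epsilon> by (intro image_eqI[of _ _ 0]) (auto simp: dir_nbhd_def)
  moreover have "value_fun f g x0 < value_fun f g x0 + ereal \<epsilon>"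
    using fin \<epsilon> by (cases "value_fun f g x0") auto
  ultimately obtain y0 where y0: "y0 \<in> solutions f g x0" using solv by blast
  have V0: "value_fun f g x0 = ereal (f (x0, y0))" by (rule value_fun_solution[OF y0])
  obtain \<kappa> \<epsilon>' \<delta>' where \<kappa>: "\<kappa> > 0" "\<epsilon>' > 0" "\<delta>' > 0"
    and RS: "\<forall>x \<in> (+) x0 ` dir_nbhd \<epsilon>' \<delta>' u. \<forall>y \<in> ball y0 \<epsilon>'.
       \<exists>y'\<in>feasible g x. norm (y - y') \<le> \<kappa> * norm (pos_part (g (x, y)))"
    using robinson_stableD[OF bspec[OF rs y0]] by blast
  have xs: "xs \<longlonglongrightarrow> x0" by (rule approaches_along_tendsto[OF ap])
  have evN: "\<forall>\<^sub>F k in sequentially. xs k \<in> (+) x0 ` dir_nbhd a b u" if "a > 0" "b > 0" for a b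
    using ap that unfolding approaches_along_def by blast
  have "\<forall>\<^sub>F k in sequentially. \<exists>p. p \<in> feasible g (xs k) \<and> norm (y0 - p) \<le> \<kappa> * norm (pos_part (g (xs k, y0)))"
    using evN[OF \<kappa>(2,3)] by eventually_elim (use RS \<kappa>(2) in force)
  then obtain p where p: "\<forall>\<^sub>F k in sequentially. p k \<in> feasible g (xs k)
      \<and> norm (y0 - p k) \<le> \<kappa> * norm (pos_part (g (xs k, y0)))"
    unfolding eventually_ex by blast
  have "(\<lambda>k. g (xs k, y0)) \<longlonglongrightarrow> g (x0, y0)"
    by (rule isCont_tendsto_compose[OF isCont_g]) (intro tendsto_Pair xs tendsto_const)
  then have glim: "(\<lambda>k. \<kappa> * norm (g (xs k, y0) - g (x0, y0))) \<longlonglongrightarrow> 0"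
    by (auto intro!: tendsto_mult_right_zero tendsto_norm_zero simp: LIM_zero_iff)
  have g0: "g (x0, y0) \<le> 0" using y0 by (simp add: solutions_def feasible_def)
  have "(\<lambda>k. p k - y0) \<longlonglongrightarrow> 0"
  proof (rule Lim_null_comparison[OF _ glim])
    show "\<forall>\<^sub>F k in sequentially. norm (p k - y0) \<le> \<kappa> * norm (g (xs k, y0) - g (x0, y0))"
      using p
    proof eventually_elim
      case (elim k)
      have "\<kappa> * norm (pos_part (g (xs k, y0))) \<le> \<kappa> * norm (g (xs k, y0) - g (x0, y0))"
        using norm_pos_part_le[OF g0] \<kappa>(1) by (intro mult_left_mono) auto
      then show ?case using elim by (simp add: norm_minus_commute)
    qed
  qed
  then have "p \<longlonglongrightarrow> y0" by (simp add: LIM_zero_iff)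
  then have fp: "(\<lambda>k. f (xs k, p k)) \<longlonglongrightarrow> f (x0, y0)" by (intro tendsto_f tendsto_Pair xs)
  then have "\<forall>\<^sub>F k in sequentially. f (xs k, p k) < f (x0, y0) + \<epsilon>"
    using order_tendstoD(2) \<epsilon>(1) by fastforce
  with p evN[OF \<epsilon>] have "\<forall>\<^sub>F k in sequentially. \<exists>y. y \<in> solutions f g (xs k) \<inter> \<Omega>"
  proof eventually_elim
    case (elim k)
    have "value_fun f g (xs k) \<le> ereal (f (xs k, p k))" using elim by (intro value_fun_le) simp
    also have "\<dots> < value_fun f g x0 + ereal \<epsilon>" using elim V0 by simp
    finally show ?case using solv[OF elim(2)] by blast
  qed
  then obtain ys where ys: "\<forall>\<^sub>F k in sequentially. ys k \<in> solutions f g (xs k) \<inter> \<Omega>"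
    unfolding eventually_ex by blast
  then obtain n where n: "\<And>k. k \<ge> n \<Longrightarrow> ys k \<in> solutions f g (xs k) \<inter> \<Omega>"
    unfolding eventually_sequentially by blast
  have "\<forall>\<^sub>F k in sequentially. ys (k + n) \<in> \<Omega>" using n by simp
  then obtain r yt where r: "strict_mono (r :: nat \<Rightarrow> nat)" and yt: "yt \<in> \<Omega>" "(\<lambda>k. ys (r k + n)) \<longlonglongrightarrow> yt"
    by (rule compact_eventually_subseq[OF \<Omega>])
  define R where "R = (\<lambda>k. r k + n)"
  have R: "strict_mono R" using r by (simp add: strict_mono_def R_def)
  have sol: "ys (R k) \<in> solutions f g (xs (R k))" for k using n[of "R k"] by (simp add: R_def)
  have lim: "(\<lambda>k. (xs (R k), ys (R k))) \<longlonglongrightarrow> (x0, yt)"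
    using LIMSEQ_subseq_LIMSEQ[OF xs R] yt(2) by (intro tendsto_Pair) (auto simp: o_def R_def)
  have "yt \<in> feasible g x0"
    unfolding feasible_iff
  proof
    fix i
    show "g (x0, yt) $ i \<le> 0"
      by (rule tendsto_upperbound[OF tendsto_g[OF lim]])
         (use sol in \<open>auto simp: solutions_def feasible_iff\<close>)
  qed
  \<comment> \<open>Optimality of \<open>ys\<close> against the competitors \<open>p\<close>, which
    converge to \<open>y0\<close>, survives the limit.\<close>
  moreover have "f (x0, yt) \<le> f (x0, y0)"
  proof (rule tendsto_le[OF _ _ tendsto_f[OF lim]])
    show "(\<lambda>k. f (xs (R k), p (R k))) \<longlonglongrightarrow> f (x0, y0)"
      using LIMSEQ_subseq_LIMSEQ[OF fp R] by (simp add: o_def)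
    show "\<forall>\<^sub>F k in sequentially. f (xs (R k), ys (R k)) \<le> f (xs (R k), p (R k))"
      using eventually_subseq[OF R p] by eventually_elim (use sol in \<open>auto simp: solutions_def\<close>)
  qed simp
  ultimately have "yt \<in> solutions f g x0" using y0 by (fastforce simp: solutions_def)
  then show "\<exists>r ys y. strict_mono (r :: nat \<Rightarrow> nat) \<and> y \<in> solutions f g x0 \<inter> \<Omega>
      \<and> (\<forall>k. ys k \<in> solutions f g (xs (r k))) \<and> ys \<longlonglongrightarrow> y"
    using R sol yt by (intro exI[of _ R] exI[of _ "\<lambda>k. ys (R k)"] exI[of _ yt]) (auto simp: R_def)
qed (use rcr rs in auto)

text \<open>Turns the sequential notion into one over neighbourhoods; the work lies in writing a
  sequence of counterexamples as \<open>x0 + t k *\<^sub>R us k\<close> with \<open>us\<close>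
  tending to \<open>u\<close>.\<close>

lemma solutions_near_inner_semicontinuous:
  assumes y0: "y0 \<in> solutions f g x0" and isc: "dir_inner_semicontinuous (solutions f g) x0 y0 u"
    and \<eta>: "\<eta> > 0"
  shows "\<exists>\<epsilon>>0. \<exists>\<delta>>0. \<forall>x \<in> (+) x0 ` dir_nbhd \<epsilon> \<delta> u. solutions f g x \<inter> ball y0 \<eta> \<noteq> {}"
proof (rule ccontr)
  assume "\<not> ?thesis"
  then have "\<forall>k. \<exists>x \<in> (+) x0 ` dir_nbhd (inverse (Suc k)) (inverse (Suc k)) u. solutions f g x \<inter> ball y0 \<eta> = {}"
    by (metis inverse_positive_iff_positive of_nat_0_less_iff zero_less_Suc)
  then obtain xs where xs: "\<And>k. xs k \<in> (+) x0 ` dir_nbhd (inverse (Suc k)) (inverse (Suc k)) u"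
    and far: "\<And>k. solutions f g (xs k) \<inter> ball y0 \<eta> = {}" by metis
  define z where "z = (\<lambda>k. xs k - x0)"
  have z: "z k \<in> dir_nbhd (inverse (Suc k)) (inverse (Suc k)) u" for k using xs[of k] by (auto simp: z_def)
  \<comment> \<open>\<open>x0\<close> is no counterexample, because \<open>y0\<close> is a solution
    there.\<close>
  have nz: "z k \<noteq> 0" for k using far[of k] y0 \<eta> by (auto simp: z_def)
  have zn: "norm (z k) < inverse (real (Suc k))" for k using z[of k] by (simp add: dir_nbhd_def)
  have zlim: "(\<lambda>k. norm (z k)) \<longlonglongrightarrow> 0"
    by (rule Lim_null_comparison[OF _ LIMSEQ_inverse_real_of_nat])
       (use zn in \<open>auto simp: less_imp_le intro!: always_eventually\<close>)
  have "\<exists>t us. (\<forall>k. t k > 0) \<and> t \<longlonglongrightarrow> 0 \<and> us \<longlonglongrightarrow> u \<and> (\<forall>k. xs k = x0 + t k *\<^sub>R us k)"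
  proof (cases "u = 0")
    case True
    \<comment> \<open>The square root gives scale and direction the same size, so both tend to
      0.\<close>
    let ?t = "\<lambda>k. sqrt (norm (z k))"
    have t: "?t \<longlonglongrightarrow> 0" using tendsto_real_sqrt[OF zlim] by simp
    have "(\<lambda>k. z k /\<^sub>R ?t k) \<longlonglongrightarrow> 0"
    proof (rule Lim_null_comparison[OF _ t])
      show "\<forall>\<^sub>F k in sequentially. norm (z k /\<^sub>R ?t k) \<le> ?t k"
      proof (rule always_eventually, rule allI)
        fix k
        have "norm (z k /\<^sub>R ?t k) = norm (z k) / ?t k" by (simp add: divide_inverse mult.commute)
        then show "norm (z k /\<^sub>R ?t k) \<le> ?t k" by (simp add: real_div_sqrt)
      qed
    qed
    then show ?thesis
      using t nz True by (intro exI[of _ ?t] exI[of _ "\<lambda>k. z k /\<^sub>R ?t k"]) (auto simp: z_def)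
  next
    case False
    \<comment> \<open>With \<open>z k\<close> rescaled to length \<open>norm u\<close>, the angular
      inequality of \<open>dir_nbhd\<close> bounds the distance to \<open>u\<close>
      directly.\<close>
    let ?t = "\<lambda>k. norm (z k) / norm u" and ?u = "\<lambda>k. (norm u / norm (z k)) *\<^sub>R z k"
    have "?t \<longlonglongrightarrow> 0 / norm u" by (intro tendsto_divide zlim tendsto_const) (use False in simp)
    then have t: "?t \<longlonglongrightarrow> 0" by simp
    have "(\<lambda>k. ?u k - u) \<longlonglongrightarrow> 0"
    proof (rule Lim_null_comparison)
      have "(\<lambda>k. inverse (real (Suc k)) * norm u) \<longlonglongrightarrow> 0 * norm u"
        by (intro tendsto_intros LIMSEQ_inverse_real_of_nat)
      then show "(\<lambda>k. inverse (real (Suc k)) * norm u) \<longlonglongrightarrow> 0" by simp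
      show "\<forall>\<^sub>F k in sequentially. norm (?u k - u) \<le> inverse (real (Suc k)) * norm u"
      proof (rule always_eventually, rule allI)
        fix k
        have "?u k - u = (1 / norm (z k)) *\<^sub>R (norm u *\<^sub>R z k - norm (z k) *\<^sub>R u)"
          using nz[of k] by (simp add: algebra_simps)
        then have "norm (?u k - u) = norm (norm u *\<^sub>R z k - norm (z k) *\<^sub>R u) / norm (z k)" by simp
        also have "\<dots> \<le> (inverse (real (Suc k)) * norm (z k) * norm u) / norm (z k)"
          using z[of k] by (intro divide_right_mono) (auto simp: dir_nbhd_def)
        also have "\<dots> = inverse (real (Suc k)) * norm u" using nz[of k] by simp
        finally show "norm (?u k - u) \<le> inverse (real (Suc k)) * norm u" .
      qed
    qed
    then have "?u \<longlonglongrightarrow> u" by (simp add: LIM_zero_iff)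
    then show ?thesis
      using t nz False by (intro exI[of _ ?t] exI[of _ ?u]) (auto simp: z_def)
  qed
  then obtain t us where t: "\<forall>k. t k > 0" "t \<longlonglongrightarrow> 0" "us \<longlonglongrightarrow> u" and xs_eq: "\<And>k. xs k = x0 + t k *\<^sub>R us k"
    by blast
  then obtain ys where ys: "\<forall>\<^sub>F k in sequentially. ys k \<in> solutions f g (x0 + t k *\<^sub>R us k)" "ys \<longlonglongrightarrow> y0"
    using isc unfolding dir_inner_semicontinuous_def by blast
  have "\<forall>\<^sub>F k in sequentially. dist (ys k) y0 < \<eta>" using ys(2) \<eta> by (rule tendstoD)
  with ys(1) have "\<forall>\<^sub>F k in sequentially. False"
  proof eventually_elim
    case (elim k)
    then have "ys k \<in> solutions f g (xs k) \<inter> ball y0 \<eta>" by (simp add: xs_eq dist_commute)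
    then show False using far[of k] by blast
  qed
  then show False by simp
qed

text \<open>Solutions near \<open>y0\<close> are feasible points near \<open>y0\<close>, so constant
  rank yields Robinson stability; a diagonal choice gives solutions that converge to
  \<open>y0\<close>.\<close>

lemma directional_program_inner_semicontinuous:
  assumes y0: "y0 \<in> solutions f g x0" and isc: "dir_inner_semicontinuous (solutions f g) x0 y0 u"
    and rcr: "rcr_regular g x0 y0"
  shows "directional_program f g f' g' x0 u {y0}"
proof
  note near = solutions_near_inner_semicontinuous[OF y0 isc]
  show "{y0} \<subseteq> solutions f g x0" using y0 by simp
  show "rcr_regular g x0 y" if "y \<in> {y0}" for y using rcr that by simp
  have "\<exists>\<epsilon>>0. \<exists>\<delta>>0. \<forall>x \<in> (+) x0 ` dir_nbhd \<epsilon> \<delta> u. feasible g x \<inter> ball y0 \<eta> \<noteq> {}" if "\<eta> > 0" for \<eta>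
  proof -
    obtain \<epsilon> \<delta> where *: "\<epsilon> > 0" "\<delta> > 0"
      "\<forall>x \<in> (+) x0 ` dir_nbhd \<epsilon> \<delta> u. solutions f g x \<inter> ball y0 \<eta> \<noteq> {}"
      using near[OF \<open>\<eta> > 0\<close>] by metis
    have "solutions f g x \<inter> ball y0 \<eta> \<subseteq> feasible g x \<inter> ball y0 \<eta>" for x
      by (auto simp: solutions_def)
    then have "\<forall>x \<in> (+) x0 ` dir_nbhd \<epsilon> \<delta> u. feasible g x \<inter> ball y0 \<eta> \<noteq> {}"
      using *(3) by (metis subset_empty)
    then show ?thesis using *(1,2) by metis
  qed
  then have "robinson_stable g x0 y0 u"
    using y0 by (intro robinson_stable_from_RCR[OF rcr]) (auto simp: solutions_def)
  then show "robinson_stable g x0 y u" if "y \<in> {y0}" for y using that by simp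
  fix xs assume ap: "approaches_along x0 u xs"
  have ev: "\<exists>n. \<forall>k\<ge>n. solutions f g (xs k) \<inter> ball y0 (inverse (real (Suc j))) \<noteq> {}" for j
  proof -
    obtain \<epsilon> \<delta> where *: "\<epsilon> > 0" "\<delta> > 0"
      "\<forall>x \<in> (+) x0 ` dir_nbhd \<epsilon> \<delta> u. solutions f g x \<inter> ball y0 (inverse (real (Suc j))) \<noteq> {}"
      using near[of "inverse (real (Suc j))"] by auto
    then have "\<forall>\<^sub>F k in sequentially. xs k \<in> (+) x0 ` dir_nbhd \<epsilon> \<delta> u"
      using ap unfolding approaches_along_def by blast
    then show ?thesis using *(3) unfolding eventually_sequentially by blast
  qed
  then obtain n where n: "\<And>j k. k \<ge> n j \<Longrightarrow> solutions f g (xs k) \<inter> ball y0 (inverse (real (Suc j))) \<noteq> {}"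
    by metis
  \<comment> \<open>Strictly increasing and at least \<open>n j\<close>, so \<open>xs (r j)\<close>
    has a solution within \<open>inverse (Suc j)\<close> of \<open>y0\<close>.\<close>
  define r where "r = (\<lambda>j. j + (\<Sum>i\<le>j. n i))"
  have r: "strict_mono r" unfolding r_def by (rule strict_monoI_Suc) simp
  have "r j \<ge> n j" for j
    using member_le_sum[of j "{..j}" n] by (simp add: r_def)
  then have "\<forall>j. \<exists>y. y \<in> solutions f g (xs (r j)) \<and> dist y y0 < inverse (real (Suc j))"
    using n by (fastforce simp: dist_commute)
  then obtain ys where ys: "\<And>j. ys j \<in> solutions f g (xs (r j))" "\<And>j. dist (ys j) y0 < inverse (real (Suc j))"
    by metis
  have "(\<lambda>j. ys j - y0) \<longlonglongrightarrow> 0"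
    by (rule Lim_null_comparison[OF _ LIMSEQ_inverse_real_of_nat])
       (use ys(2) in \<open>auto simp: dist_norm less_imp_le intro!: always_eventually\<close>)
  then have "ys \<longlonglongrightarrow> y0" by (simp add: LIM_zero_iff)
  then show "\<exists>r ys y. strict_mono (r :: nat \<Rightarrow> nat) \<and> y \<in> {y0}
      \<and> (\<forall>k. ys k \<in> solutions f g (xs (r k))) \<and> ys \<longlonglongrightarrow> y"
    using r ys(1) by blast
qed

end

theorem theorem4p2:
  fixes f :: "(real^'n) \<times> (real^'m) \<Rightarrow> real"
    and g :: "(real^'n) \<times> (real^'m) \<Rightarrow> real^'p"
    and xbar u :: "real^'n"
  assumes "continuously_differentiable f" and "continuously_differentiable g"
  shows
    "(\<forall>\<Omega>. restricted_inf_compact f g xbar u \<Omega> \<and>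
          (\<forall>y\<in>solutions f g xbar. rcr_regular g xbar y) \<and>
          (\<forall>y\<in>solutions f g xbar. robinson_stable g xbar y u) \<longrightarrow>
        dir_lipschitz (value_fun f g) xbar u \<and>
        dir_limiting_subdiff (value_fun f g) xbar u \<noteq> {} \<and>
        dir_limiting_subdiff (value_fun f g) xbar u \<subseteq> Theta f g xbar u \<Omega>) \<and>
     (\<forall>ybar\<in>solutions f g xbar.
        dir_inner_semicontinuous (solutions f g) xbar ybar u \<and> rcr_regular g xbar ybar \<longrightarrow>
        dir_lipschitz (value_fun f g) xbar u \<and>
        dir_limiting_subdiff (value_fun f g) xbar u \<noteq> {} \<and>
        dir_limiting_subdiff (value_fun f g) xbar u \<subseteq> estimate_at f g xbar ybar u)"
proof -
  obtain f' where f': "\<And>z. (f has_derivative blinfun_apply (f' z)) (at z)" "continuous_on UNIV f'"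
    using assms(1) unfolding continuously_differentiable_def by blast
  obtain g' where g': "\<And>z. (g has_derivative blinfun_apply (g' z)) (at z)" "continuous_on UNIV g'"
    using assms(2) unfolding continuously_differentiable_def by blast
  interpret C1_program f g f' g'
    by unfold_locales (fact f' g')+
  show ?thesis
  proof (intro conjI allI ballI impI; (elim conjE)?)
    fix \<Omega>
    assume "restricted_inf_compact f g xbar u \<Omega>" "\<forall>y\<in>solutions f g xbar. rcr_regular g xbar y"
      "\<forall>y\<in>solutions f g xbar. robinson_stable g xbar y u"
    then interpret directional_program f g f' g' xbar u "solutions f g xbar \<inter> \<Omega>"
      by (rule directional_program_inf_compact)
    show "dir_lipschitz (value_fun f g) xbar u" by (rule dir_lipschitz_value)
    show "dir_limiting_subdiff (value_fun f g) xbar u \<noteq> {}" by (rule dir_limiting_subdiff_properties)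
    show "dir_limiting_subdiff (value_fun f g) xbar u \<subseteq> Theta f g xbar u \<Omega>"
      unfolding Theta_def using dir_limiting_subdiff_properties(2) by blast
  next
    fix ybar
    assume "ybar \<in> solutions f g xbar" "dir_inner_semicontinuous (solutions f g) xbar ybar u"
      "rcr_regular g xbar ybar"
    then interpret directional_program f g f' g' xbar u "{ybar}"
      by (rule directional_program_inner_semicontinuous)
    show "dir_lipschitz (value_fun f g) xbar u" by (rule dir_lipschitz_value)
    show "dir_limiting_subdiff (value_fun f g) xbar u \<noteq> {}" by (rule dir_limiting_subdiff_properties)
    show "dir_limiting_subdiff (value_fun f g) xbar u \<subseteq> estimate_at f g xbar ybar u"
      using dir_limiting_subdiff_properties(2) by blast
  qed
qed

end
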